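(* For any constant $\varepsilon>0$, there is a deterministic algorithm in the $\mathsf{CONGEST}$ model that, on every graph $G$ with $n$ nodes and maximum degree $\Delta$, computes an $(8+\varepsilon)\Delta$-edge coloring of $G$ in $\operatorname{poly}\log\Delta + O(\log^* n)$ rounds.
   Context: $\mathsf{CONGEST}$ model: the network is an undirected graph $G=(V,E)$ with $n=|V|$ nodes and maximum degree $\Delta$. Nodes are computational entities with unique identifiers from $\{1,\dots,\operatorname{poly}(n)\}$; initially each node knows its own identifier, $n$ and $\Delta$. Computation proceeds in synchronous rounds; in each round every node may send (possibly different) messages of at most $O(\log n)$ bits to its neighbors, receive their messages, and perform arbitrary internal computation. The complexity of an algorithm is the worst-case number of rounds until all nodes have produced their output. $K$-edge coloring: assign to each edge one of at most $K$ colors such that any two distinct edges sharing an endpoint get different colors; each node must output the colors of all its incident edges. $\operatorname{poly}\log\Delta$ means $(\log\Delta)^{O(1)}$. *)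

theory Defs
  imports Complex_Main "HOL-Computational_Algebra.Polynomial"
begin

section \<open>Networks\<close>

text \<open>
  A network is a finite simple undirected graph with unique node identifiers and a port
  numbering. The vertices are natural numbers, used only to name the nodes from outside: an
  algorithm never sees them, only the identifiers. Port \<open>i\<close> of node \<open>v\<close> is its link to the
  neighbour \<open>nbr N v i\<close>. The numbering is arbitrary, and it is not tied to the identifiers, so
  a node does not know its neighbours' identifiers unless they are sent to it.
\<close>

record network =
  nodes :: "nat set"
  edges :: "nat set set"
  ident :: "nat \<Rightarrow> nat"
  nbr   :: "nat \<Rightarrow> nat \<Rightarrow> nat"

definition neighbours :: "network \<Rightarrow> nat \<Rightarrow> nat set" where
  "neighbours N v = {u. {v, u} \<in> edges N}"

definition num_nodes :: "network \<Rightarrow> nat" where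
  "num_nodes N = card (nodes N)"

definition deg :: "network \<Rightarrow> nat \<Rightarrow> nat" where
  "deg N v = card (neighbours N v)"

definition max_deg :: "network \<Rightarrow> nat" where
  "max_deg N = Max (insert 0 (deg N ` nodes N))"

definition is_graph :: "network \<Rightarrow> bool" where
  "is_graph N \<longleftrightarrow> finite (nodes N) \<and>
     (\<forall>e\<in>edges N. \<exists>u\<in>nodes N. \<exists>v\<in>nodes N. u \<noteq> v \<and> e = {u, v})"

text \<open>The polynomial \<open>p\<close> fixes the range of the identifiers.\<close>

definition valid_network :: "nat poly \<Rightarrow> network \<Rightarrow> bool" where
  "valid_network p N \<longleftrightarrow> is_graph N \<and>
     inj_on (ident N) (nodes N) \<and> ident N ` nodes N \<subseteq> {1..poly p (num_nodes N)} \<and>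
     (\<forall>v\<in>nodes N. bij_betw (nbr N v) {..<deg N v} (neighbours N v))"

text \<open>The port of \<open>u\<close> that leads to its neighbour \<open>v\<close>.\<close>

definition port_to :: "network \<Rightarrow> nat \<Rightarrow> nat \<Rightarrow> nat" where
  "port_to N u v = inv_into {..<deg N u} (nbr N u) v"


section \<open>Synchronous deterministic algorithms\<close>

type_synonym message = "bool list"

text \<open>
  Everything a node knows at some point of an execution: its identifier, \<open>n\<close>, \<open>\<Delta>\<close>, the number
  of its ports, and all the messages it has received; \<open>received K ! r ! i\<close> is the message that
  arrived through port \<open>i\<close> in the \<open>r\<close>-th round (counting from 0).
\<close>

record knowledge =
  own_id   :: nat
  size_n   :: nat
  delta    :: nat
  ports    :: nat
  received :: "message list list"

text \<open>
  Internal computation is unrestricted and deterministic, so the state of a node is a function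
  of its knowledge; an algorithm therefore consists of the message sent through each port and
  the output (\<open>None\<close>: not yet produced), as functions of the knowledge. The empty message stands
  for not sending anything.
\<close>

record 'o algorithm =
  send :: "knowledge \<Rightarrow> nat \<Rightarrow> message"
  out :: "knowledge \<Rightarrow> 'o option"

definition mk_knowledge :: "network \<Rightarrow> nat \<Rightarrow> message list list \<Rightarrow> knowledge" where
  "mk_knowledge N v h =
     \<lparr>own_id = ident N v, size_n = num_nodes N, delta = max_deg N, ports = deg N v, received = h\<rparr>"

primrec history :: "'o algorithm \<Rightarrow> network \<Rightarrow> nat \<Rightarrow> nat \<Rightarrow> message list list" where
  "history A N 0 = (\<lambda>v. [])"
| "history A N (Suc t) = (\<lambda>v. history A N t v @
     [map (\<lambda>i. let u = nbr N v i
               in send A (mk_knowledge N u (history A N t u)) (port_to N u v)) [0..<deg N v]])"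

definition knowledge_after :: "'o algorithm \<Rightarrow> network \<Rightarrow> nat \<Rightarrow> nat \<Rightarrow> knowledge" where
  "knowledge_after A N t v = mk_knowledge N v (history A N t v)"

definition output_after :: "'o algorithm \<Rightarrow> network \<Rightarrow> nat \<Rightarrow> nat \<Rightarrow> 'o option" where
  "output_after A N t v = out A (knowledge_after A N t v)"

definition terminates :: "'o algorithm \<Rightarrow> network \<Rightarrow> bool" where
  "terminates A N \<longleftrightarrow> (\<forall>v\<in>nodes N. \<exists>t. output_after A N t v \<noteq> None)"

text \<open>Outputs are irrevocable: only the first one that a node produces counts.\<close>

definition node_output :: "'o algorithm \<Rightarrow> network \<Rightarrow> nat \<Rightarrow> 'o" where
  "node_output A N v = the (output_after A N (LEAST t. output_after A N t v \<noteq> None) v)"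

text \<open>Meaningful only together with \<^const>\<open>terminates\<close>.\<close>

definition rounds :: "'o algorithm \<Rightarrow> network \<Rightarrow> nat" where
  "rounds A N = (LEAST T. \<forall>v\<in>nodes N. \<exists>t\<le>T. output_after A N t v \<noteq> None)"

text \<open>
  The bandwidth restriction: all messages have \<open>O(log n)\<close> bits. For \<open>n \<le> 1\<close> there are no ports,
  so the bound \<open>C * log 2 n\<close> needs no additive constant.
\<close>

definition congest_algorithm :: "nat poly \<Rightarrow> 'o algorithm \<Rightarrow> bool" where
  "congest_algorithm p A \<longleftrightarrow> (\<exists>C::real. \<forall>N. valid_network p N \<longrightarrow>
     (\<forall>v\<in>nodes N. \<forall>t. \<forall>i<deg N v.
        real (length (send A (knowledge_after A N t v) i)) \<le> C * log 2 (real (num_nodes N))))"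


section \<open>Edge coloring\<close>

definition is_edge_coloring :: "network \<Rightarrow> nat \<Rightarrow> (nat set \<Rightarrow> nat) \<Rightarrow> bool" where
  "is_edge_coloring N K c \<longleftrightarrow> (\<forall>e\<in>edges N. c e \<in> {1..K}) \<and>
     (\<forall>e\<in>edges N. \<forall>f\<in>edges N. e \<noteq> f \<and> e \<inter> f \<noteq> {} \<longrightarrow> c e \<noteq> c f)"

text \<open>Every node outputs the list of the colors of its incident edges, in port order.\<close>

definition computes_edge_coloring :: "nat list algorithm \<Rightarrow> network \<Rightarrow> nat \<Rightarrow> bool" where
  "computes_edge_coloring A N K \<longleftrightarrow> terminates A N \<and>
     (\<exists>c. is_edge_coloring N K c \<and>
       (\<forall>v\<in>nodes N. node_output A N v = map (\<lambda>i. c {v, nbr N v i}) [0..<deg N v]))"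

definition log_star :: "nat \<Rightarrow> nat" where
  "log_star n = (LEAST i. (log 2 ^^ i) (real n) \<le> 1)"

end

theory Submission
  imports Defs "HOL-Library.FuncSet"
begin

text \<open>
  Orienting every edge towards the larger identifier splits each node into an out-half and an in-half
  and turns the network into a bipartite graph in which the degrees of the two ends of an edge add up
  to at most \<open>D = 2 \<Delta>\<close>. A class of edges is repeatedly split in two, such that \<open>D\<close> is
  multiplied by at most \<open>1/2 + O(1 / log \<Delta>)\<close>: if the class is oriented such that
  \<open>2 * indeg - deg\<close> is nearly non-increasing along each edge, then the edges oriented towards the
  in-side and those oriented towards the out-side are such halves. The orientation is built in stages; in each
  stage, every node accepts a bounded number of unoriented edges, and a token game in which every edge
  flips at most once restores the balance. Once \<open>D\<close> is polylogarithmic in \<open>\<Delta>\<close>, an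
  edge shares a node of the network with fewer than \<open>3 * D\<close> other edges of its class, so \<open>3 * D\<close>
  colours suffice for each of the \<open>2^L\<close> classes. They are found greedily, along a schedule
  that Linial's colour reduction provides in \<open>O(log\<^sup>* n)\<close> rounds. As \<open>2^L * D\<close> is at most
  \<open>4/3 * 2 \<Delta>\<close>, this uses at most \<open>8 \<Delta>\<close> colours.
\<close>

section \<open>Ports and edges of a network\<close>

text \<open>The measure adds the degrees of both ends of an edge because this is the quantity that
  balance halves: for an edge from x to y, the new degrees are the indegree of y and the outdegree
  of x, and a slack X in the heights bounds twice their sum by the old sum plus X. The slack has two
  sources. A node gains at most \<open>k + 4 * a\<close> indegree in a stage, which is paid only
  once; an edge that the token game leaves in place loses \<open>8 * a\<close>, which adds up over
  all stages. With about \<open>D / k\<close> stages and a total slack of order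
  \<open>D / log \<Delta>\<close>, this forces \<open>k\<close> to be of order
  \<open>D / log \<Delta>\<close> and \<open>a\<close> smaller than \<open>k\<close> by another
  factor log \<Delta>. The game then retires \<open>d\<close> of order \<open>a ^ 3 / D ^ 2\<close>
  tokens per phase. Rounded down, these parameters make sense only while \<open>D\<close> exceeds a
  fixed power of log \<Delta>, which is why splitting stops there. The final colouring works on the
  network itself, where the two halves of a node are merged again; this costs the factor 3 in
  \<open>3 * D\<close>. The colour reduction takes its codes from a Gilbert-Varshamov counting
  argument, so no finite fields are involved.\<close>

fun encode :: "nat \<Rightarrow> message" where
  "encode m = (if m = 0 then [] else odd m # encode (m div 2))"

declare encode.simps [simp del]

fun decode :: "message \<Rightarrow> nat" where
  "decode [] = 0"
| "decode (x # xs) = of_bool x + 2 * decode xs"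

lemma decode_encode [simp]: "decode (encode m) = m"
proof (induction m rule: less_induct)
  case (less m)
  show ?case
  proof (cases "m = 0")
    case False
    have "decode (encode m) = of_bool (odd m) + 2 * (m div 2)"
      using False less[of "m div 2"] by (subst encode.simps) simp
    then show ?thesis by (simp add: of_bool_def)
  qed (simp add: encode.simps)
qed

lemma encode_length: "m < 2 ^ b \<Longrightarrow> length (encode m) \<le> b"
proof (induction b arbitrary: m)
  case 0 then show ?case by (simp add: encode.simps)
next
  case (Suc b)
  show ?case
  proof (cases "m = 0")
    case False
    have "m div 2 < 2 ^ b" using Suc.prems by (simp add: less_mult_imp_div_less mult.commute)
    then show ?thesis using Suc.IH False by (subst encode.simps) simp
  qed (simp add: encode.simps)
qed

text \<open>Rounding the logarithm of \<open>m\<close> up costs one bit, and this bit is covered by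
  one more multiple of \<open>log 2 n\<close>, which is at least 1.\<close>

lemma encode_length_log:
  assumes "2 \<le> n" "m \<le> n ^ c"
  shows "real (length (encode m)) \<le> (real c + 1) * log 2 (real n)"
proof -
  have n: "1 \<le> log 2 (real n)" using assms by (simp add: le_log_iff)
  define b where "b = nat \<lceil>log 2 (real n)\<rceil>"
  show ?thesis
  proof (cases "m = 0")
    case True
    then show ?thesis using n by (simp add: encode.simps)
  next
    case False
    define l where "l = nat \<lfloor>log 2 (real m)\<rfloor>"
    have l0: "0 \<le> log 2 (real m)" using False by simp
    have "log 2 (real m) < real (Suc l)" unfolding l_def using l0 by linarith
    then have "real m < 2 powr (real (Suc l))" using False by (subst (asm) log_less_iff) auto
    then have "m < 2 ^ Suc l" by (simp only: powr_realpow) (metis of_nat_less_iff of_nat_numeral of_nat_power)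
    then have "length (encode m) \<le> Suc l" by (rule encode_length)
    moreover have "real l \<le> log 2 (real m)" unfolding l_def using l0 by linarith
    moreover have "log 2 (real m) \<le> real c * log 2 (real n)"
    proof -
      have "log 2 (real m) \<le> log 2 (real n ^ c)"
        using assms False by (subst log_le_cancel_iff) (auto simp flip: of_nat_power)
      then show ?thesis using assms by (simp add: log_nat_power)
    qed
    ultimately show ?thesis using n by (simp add: algebra_simps)
  qed
qed

text \<open>Coefficients are absorbed by the exponent: \<open>a < 2 ^ a \<le> n ^ a\<close> for
  \<open>n \<ge> 2\<close>.\<close>

lemma poly_nat_bound: "\<exists>c. \<forall>n\<ge>2. poly p n \<le> (n::nat) ^ c"
proof (induction p)
  case 0 then show ?case by simp
next
  case (pCons a p)
  then obtain c where c: "\<And>n. 2 \<le> n \<Longrightarrow> poly p n \<le> n ^ c" by auto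
  show ?case
  proof (intro exI allI impI)
    fix n :: nat assume n: "2 \<le> n"
    have "a \<le> n ^ a" using n less_exp[of a] power_mono[of 2 n a] by linarith
    then have "a \<le> n ^ (a + c + 1)" using n power_increasing[of a "a + c + 1" n] by linarith
    moreover have "n * poly p n \<le> n * n ^ c" using c[OF n] by (rule mult_le_mono2)
    moreover have "n ^ (c + 1) \<le> n ^ (a + c + 1)" by (rule power_increasing) (use n in auto)
    moreover have "n ^ (c + 1) = n * n ^ c" by simp
    ultimately have "a + n * poly p n \<le> 2 * n ^ (a + c + 1)" by linarith
    then have "poly (pCons a p) n \<le> 2 * n ^ (a + c + 1)" by simp
    also have "\<dots> \<le> n * n ^ (a + c + 1)" using n by (rule mult_le_mono1)
    finally show "poly (pCons a p) n \<le> n ^ (a + c + 2)" by simp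
  qed
qed

text \<open>The lower end \<open>endp N e False\<close> of an edge is the one with the smaller identifier.\<close>

definition endp :: "network \<Rightarrow> nat set \<Rightarrow> bool \<Rightarrow> nat" where
  "endp N e b = (SOME u. u \<in> e \<and> (\<forall>w\<in>e. if b then ident N w \<le> ident N u else ident N u \<le> ident N w))"

definition port :: "network \<Rightarrow> nat set \<Rightarrow> bool \<Rightarrow> nat" where
  "port N e b = port_to N (endp N e b) (endp N e (\<not> b))"

definition side :: "network \<Rightarrow> nat \<Rightarrow> nat \<Rightarrow> bool" where
  "side N v i \<longleftrightarrow> ident N (nbr N v i) < ident N v"

definition link :: "network \<Rightarrow> nat \<Rightarrow> nat \<Rightarrow> nat set" where
  "link N v i = {v, nbr N v i}"

locale net =
  fixes p :: "nat poly" and N :: network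
  assumes valid: "valid_network p N"
begin

abbreviation "E \<equiv> edges N"
abbreviation "\<Delta> \<equiv> max_deg N"

lemma finite_nodes: "finite (nodes N)"
  using valid by (simp add: valid_network_def is_graph_def)

lemma edgeE:
  assumes "e \<in> E"
  obtains u v where "u \<in> nodes N" "v \<in> nodes N" "e = {u, v}" "ident N u < ident N v"
proof -
  obtain u v where uv: "u \<in> nodes N" "v \<in> nodes N" "u \<noteq> v" "e = {u, v}"
    using valid assms unfolding valid_network_def is_graph_def by meson
  have "ident N u \<noteq> ident N v" using uv valid unfolding valid_network_def inj_on_def by auto
  then consider "ident N u < ident N v" | "ident N v < ident N u" by linarith
  then show ?thesis
  proof cases
    case 1 then show ?thesis using that uv by blast
  next
    case 2 then show ?thesis using that[of v u] uv by (simp add: insert_commute)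
  qed
qed

lemma finite_edges: "finite E"
  by (rule finite_subset[of _ "Pow (nodes N)"]) (use finite_nodes in \<open>auto elim!: edgeE\<close>)

lemma endp_pair:
  assumes "ident N u < ident N v"
  shows "endp N {u, v} b = (if b then v else u)"
  unfolding endp_def by (rule some_equality) (use assms in \<open>auto split: if_splits\<close>)

lemma ident_endp: "e \<in> E \<Longrightarrow> ident N (endp N e False) < ident N (endp N e True)"
  by (erule edgeE) (simp add: endp_pair)

lemma edge_eq: "e \<in> E \<Longrightarrow> e = {endp N e b, endp N e (\<not> b)}"
  by (erule edgeE) (auto simp: endp_pair)

lemma endp_node: "e \<in> E \<Longrightarrow> endp N e b \<in> nodes N"
  by (erule edgeE) (auto simp: endp_pair)

lemma endp_nbr: "e \<in> E \<Longrightarrow> endp N e (\<not> b) \<in> neighbours N (endp N e b)"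
  using edge_eq[of e b] by (simp add: neighbours_def)

lemma bij_nbr: "v \<in> nodes N \<Longrightarrow> bij_betw (nbr N v) {..<deg N v} (neighbours N v)"
  using valid by (simp add: valid_network_def)

lemma nbr_in: "v \<in> nodes N \<Longrightarrow> i < deg N v \<Longrightarrow> nbr N v i \<in> neighbours N v"
  using bij_nbr[of v] by (auto simp: bij_betw_def)

lemma port_props:
  assumes "e \<in> E"
  shows "port N e b < deg N (endp N e b)" "nbr N (endp N e b) (port N e b) = endp N e (\<not> b)"
    "link N (endp N e b) (port N e b) = e" "side N (endp N e b) (port N e b) = b"
proof -
  have "endp N e (\<not> b) \<in> nbr N (endp N e b) ` {..<deg N (endp N e b)}"
    using endp_nbr[OF assms] bij_nbr[OF endp_node[OF assms]] by (auto simp: bij_betw_def)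
  then show 1: "port N e b < deg N (endp N e b)" and 2: "nbr N (endp N e b) (port N e b) = endp N e (\<not> b)"
    unfolding port_def port_to_def using inv_into_into f_inv_into_f by (metis lessThan_iff)+
  show "link N (endp N e b) (port N e b) = e" using 2 edge_eq[OF assms, of b] by (simp add: link_def)
  show "side N (endp N e b) (port N e b) = b" using 2 ident_endp[OF assms] by (cases b) (auto simp: side_def)
qed

lemma link_props:
  assumes "v \<in> nodes N" "i < deg N v"
  shows "link N v i \<in> E" "endp N (link N v i) (side N v i) = v"
    "endp N (link N v i) (\<not> side N v i) = nbr N v i" "port N (link N v i) (side N v i) = i"
    "port N (link N v i) (\<not> side N v i) = port_to N (nbr N v i) v" "nbr N v i \<in> nodes N"
proof -
  show e: "link N v i \<in> E" using nbr_in[OF assms] by (simp add: link_def neighbours_def)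
  obtain x y where xy: "link N v i = {x, y}" "ident N x < ident N y" using e by (rule edgeE)
  then have "(v = x \<and> nbr N v i = y \<or> v = y \<and> nbr N v i = x)" by (auto simp: link_def doubleton_eq_iff)
  then show 1: "endp N (link N v i) (side N v i) = v" and 2: "endp N (link N v i) (\<not> side N v i) = nbr N v i"
    using xy by (auto simp: endp_pair side_def)
  show "port N (link N v i) (side N v i) = i"
    unfolding port_def port_to_def 1 2 using bij_nbr[OF assms(1)] assms(2)
    by (auto simp: bij_betw_def inv_into_f_f)
  show "port N (link N v i) (\<not> side N v i) = port_to N (nbr N v i) v"
    unfolding port_def using 1 2 by simp
  show "nbr N v i \<in> nodes N" using endp_node[OF e] 2 by metis
qed

lemma deg_le_max: "v \<in> nodes N \<Longrightarrow> deg N v \<le> \<Delta>"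
  unfolding max_deg_def using finite_nodes by (intro Max_ge) auto

lemma neighbours_sub: "v \<in> nodes N \<Longrightarrow> neighbours N v \<subseteq> nodes N - {v}"
proof
  fix u assume "u \<in> neighbours N v"
  then have "{v, u} \<in> E" by (simp add: neighbours_def)
  then obtain x y where "x \<in> nodes N" "y \<in> nodes N" "{v, u} = {x, y}" "ident N x < ident N y" by (rule edgeE)
  then show "u \<in> nodes N - {v}" by (auto simp: doubleton_eq_iff)
qed

lemma deg_less: "v \<in> nodes N \<Longrightarrow> deg N v < num_nodes N"
  unfolding deg_def num_nodes_def
  by (rule psubset_card_mono[OF finite_nodes]) (use neighbours_sub in blast)

lemma max_deg_less: "nodes N \<noteq> {} \<Longrightarrow> \<Delta> < num_nodes N"
proof -
  assume "nodes N \<noteq> {}"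
  then have "0 < num_nodes N" using finite_nodes by (simp add: num_nodes_def card_gt_0_iff)
  then show ?thesis unfolding max_deg_def using finite_nodes deg_less by (subst Max_less_iff) auto
qed

lemma two_nodes: "v \<in> nodes N \<Longrightarrow> i < deg N v \<Longrightarrow> 2 \<le> num_nodes N"
  using deg_less[of v] by linarith

lemma bij_link: "v \<in> nodes N \<Longrightarrow> bij_betw (link N v) {..<deg N v} {e \<in> E. v \<in> e}"
proof (rule bij_betw_byWitness[where f' = "\<lambda>e. port_to N v (THE u. e = {v, u})"])
  assume v: "v \<in> nodes N"
  have [simp]: "(THE u. {v, w} = {v, u}) = w" for w by (rule the_equality) (auto simp: doubleton_eq_iff)
  have 1: "port_to N v (nbr N v i) = i" if "i < deg N v" for i
    using that bij_nbr[OF v] unfolding port_to_def bij_betw_def by (auto simp: inv_into_f_f)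
  have 2: "nbr N v (port_to N v u) = u \<and> port_to N v u < deg N v" if "u \<in> neighbours N v" for u
    using that bij_nbr[OF v] unfolding port_to_def bij_betw_def
    by (metis f_inv_into_f inv_into_into lessThan_iff)
  show "\<forall>i\<in>{..<deg N v}. port_to N v (THE u. link N v i = {v, u}) = i"
    using 1 by (simp add: link_def)
  have 3: "\<exists>u. e = {v, u} \<and> u \<in> neighbours N v" if "e \<in> E" "v \<in> e" for e
  proof -
    obtain x y where "e = {x, y}" by (rule edgeE[OF \<open>e \<in> E\<close>])
    then have "e = {v, if v = x then y else x}" using \<open>v \<in> e\<close> by auto
    then show ?thesis using \<open>e \<in> E\<close> unfolding neighbours_def by blast
  qed
  show "\<forall>e\<in>{e \<in> E. v \<in> e}. link N v (port_to N v (THE u. e = {v, u})) = e"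
    using 3 2 unfolding link_def by fastforce
  show "link N v ` {..<deg N v} \<subseteq> {e \<in> E. v \<in> e}"
    using link_props(1)[OF v] by (auto simp: link_def)
  show "(\<lambda>e. port_to N v (THE u. e = {v, u})) ` {e \<in> E. v \<in> e} \<subseteq> {..<deg N v}"
    using 3 2 by fastforce
qed

end

section \<open>Edge programs and their execution by an algorithm\<close>

text \<open>One entry per port. The boolean tells which end of the link the node is:
  \<open>True\<close> for the end with the larger identifier.\<close>

type_synonym 's port_view = "(bool \<times> 's) list"

text \<open>Both ends of an edge keep the same copy of its state: what a step does to an edge depends only on the
  two messages that cross it.\<close>

record 's step =
  msg :: "'s port_view \<Rightarrow> nat \<Rightarrow> nat"
  upd :: "'s \<Rightarrow> (bool \<Rightarrow> nat) \<Rightarrow> 's"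

definition view :: "network \<Rightarrow> (nat set \<Rightarrow> 's) \<Rightarrow> nat \<Rightarrow> 's port_view" where
  "view N \<sigma> v = map (\<lambda>i. (side N v i, \<sigma> (link N v i))) [0..<deg N v]"

definition sent :: "network \<Rightarrow> 's step \<Rightarrow> (nat set \<Rightarrow> 's) \<Rightarrow> nat set \<Rightarrow> bool \<Rightarrow> nat" where
  "sent N st \<sigma> e b = msg st (view N \<sigma> (endp N e b)) (port N e b)"

definition run_step :: "network \<Rightarrow> 's step \<Rightarrow> (nat set \<Rightarrow> 's) \<Rightarrow> nat set \<Rightarrow> 's" where
  "run_step N st \<sigma> e = upd st (\<sigma> e) (sent N st \<sigma> e)"

definition exec :: "network \<Rightarrow> 's step list \<Rightarrow> (nat set \<Rightarrow> 's) \<Rightarrow> nat set \<Rightarrow> 's" where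
  "exec N = fold (run_step N)"

text \<open>The bound is demanded for all views of suitable length, reachable or not, so that
  message sizes can be checked without invariants of the execution.\<close>

definition small_step :: "nat \<Rightarrow> nat \<Rightarrow> nat \<Rightarrow> 's step \<Rightarrow> bool" where
  "small_step c n \<Delta> st \<longleftrightarrow> (\<forall>L i. i < length L \<longrightarrow> length L \<le> \<Delta> \<longrightarrow> \<Delta> \<le> n \<longrightarrow> 2 \<le> n \<longrightarrow> msg st L i \<le> n ^ c)"

text \<open>Histories depend on the sending rule only, so the output is filled with a dummy.\<close>

definition knows :: "(knowledge \<Rightarrow> nat \<Rightarrow> message) \<Rightarrow> network \<Rightarrow> nat \<Rightarrow> nat \<Rightarrow> knowledge" where
  "knows s N t v = knowledge_after \<lparr>send = s, out = \<lambda>_. None :: unit option\<rparr> N t v"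

text \<open>The notion is designed to be closed under running edge programs and under local maps.
  The length bound covers all rounds, also those after \<open>T\<close>, as the bandwidth
  restriction does.\<close>

definition computable :: "nat poly \<Rightarrow> (nat \<Rightarrow> nat \<Rightarrow> nat) \<Rightarrow> (network \<Rightarrow> nat set \<Rightarrow> 's) \<Rightarrow> bool" where
  "computable p T \<sigma> \<longleftrightarrow> (\<exists>s dec C. \<forall>N. valid_network p N \<longrightarrow> (\<forall>v\<in>nodes N.
     (\<forall>t. \<forall>i<deg N v. real (length (s (knows s N t v) i)) \<le> C * log 2 (real (num_nodes N))) \<and>
     dec (knows s N (T (num_nodes N) (max_deg N)) v) = view N (\<sigma> N) v))"

lemma length_view [simp]: "length (view N \<sigma> v) = deg N v"
  by (simp add: view_def)

lemma nth_view [simp]: "i < deg N v \<Longrightarrow> view N \<sigma> v ! i = (side N v i, \<sigma> (link N v i))"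
  by (simp add: view_def)

text \<open>One more round of messages is paired with the next step of the program.\<close>

lemma zip_snoc_right: "length ys < length xs \<Longrightarrow> zip xs (ys @ [y]) = zip xs ys @ [(xs ! length ys, y)]"
proof (induction ys arbitrary: xs)
  case Nil then show ?case by (cases xs) auto
next
  case (Cons a ys) then show ?case by (cases xs) auto
qed

lemma history_cong: "send A = send B \<Longrightarrow> history A N t = history B N t"
  by (induction t) (simp_all add: Let_def)

lemma knows_eq: "knowledge_after A N t v = knows (send A) N t v"
  unfolding knows_def knowledge_after_def
  using history_cong[of A "\<lparr>send = send A, out = \<lambda>_. None :: unit option\<rparr>" N t] by simp

lemma knows_props [simp]:
  "own_id (knows s N t v) = ident N v" "size_n (knows s N t v) = num_nodes N" "delta (knows s N t v) = max_deg N"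
  "ports (knows s N t v) = deg N v"
  by (simp_all add: knows_def knowledge_after_def mk_knowledge_def)

lemma received_knows_0: "received (knows s N 0 v) = []"
  by (simp add: knows_def knowledge_after_def mk_knowledge_def)

lemma received_knows_Suc: "received (knows s N (Suc t) v) = received (knows s N t v) @
    [map (\<lambda>i. s (knows s N t (nbr N v i)) (port_to N (nbr N v i) v)) [0..<deg N v]]"
  by (simp add: knows_def knowledge_after_def mk_knowledge_def Let_def)

lemma length_received [simp]: "length (received (knows s N t v)) = t"
  by (induction t) (simp_all add: received_knows_0 received_knows_Suc)

lemma take_received: "t \<le> t' \<Longrightarrow> take t (received (knows s N t' v)) = received (knows s N t v)"
proof (induction t' rule: dec_induct)
  case (step t') then show ?case by (simp add: received_knows_Suc)
qed simp

text \<open>Knowledge only grows, so an algorithm without a state of its own can recover every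
  earlier situation and replay the computation from there.\<close>

lemma knows_truncate: "t \<le> t' \<Longrightarrow> (knows s N t' v)\<lparr>received := take t (received (knows s N t' v))\<rparr> = knows s N t v"
  by (simp only: take_received) (simp add: knows_def knowledge_after_def mk_knowledge_def)

lemma knows_cong:
  assumes "\<And>t' v i. t' < t \<Longrightarrow> s (knows s N t' v) i = s' (knows s N t' v) i"
  shows "knows s N t v = knows s' N t v"
  using assms
proof (induction t arbitrary: v)
  case 0
  then show ?case by (simp add: knows_def knowledge_after_def)
next
  case (Suc t)
  then have IH: "knows s N t v = knows s' N t v" for v by simp
  have "received (knows s N (Suc t) v) = received (knows s' N (Suc t) v)"
    unfolding received_knows_Suc using Suc.prems[of t] by (simp add: IH)
  then show ?case by (simp add: knows_def knowledge_after_def mk_knowledge_def)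
qed

text \<open>Of the two messages that cross a link, a node recomputes its own and decodes the
  other.\<close>

definition local_step :: "'s step \<Rightarrow> message list \<Rightarrow> 's port_view \<Rightarrow> 's port_view" where
  "local_step st ms L = map (\<lambda>i. case L ! i of (b, x) \<Rightarrow>
     (b, upd st x (\<lambda>b'. if b' = b then msg st L i else decode (ms ! i)))) [0..<length L]"

text \<open>The \<open>zip\<close> stops at the steps whose messages have already arrived, so the
  same term describes the state in the middle of the program.\<close>

definition local_exec :: "nat \<Rightarrow> (knowledge \<Rightarrow> 's port_view) \<Rightarrow> 's step list \<Rightarrow> knowledge \<Rightarrow> 's port_view" where
  "local_exec T dec prog K = fold (\<lambda>(st, ms) L. local_step st ms L) (zip prog (drop T (received K)))
     (dec (K\<lparr>received := take T (received K)\<rparr>))"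

context net
begin

lemma local_step_view:
  assumes v: "v \<in> nodes N"
    and ms: "\<And>i. i < deg N v \<Longrightarrow> decode (ms ! i) = msg st (view N \<sigma> (nbr N v i)) (port_to N (nbr N v i) v)"
  shows "local_step st ms (view N \<sigma> v) = view N (run_step N st \<sigma>) v"
proof -
  have "upd st (\<sigma> (link N v i)) (\<lambda>b'. if b' = side N v i then msg st (view N \<sigma> v) i else decode (ms ! i)) =
        run_step N st \<sigma> (link N v i)" if i: "i < deg N v" for i
  proof -
    have "sent N st \<sigma> (link N v i) b' = (if b' = side N v i then msg st (view N \<sigma> v) i else decode (ms ! i))" for b'
    proof (cases "b' = side N v i")
      case True
      then show ?thesis using link_props[OF v i] by (simp add: sent_def)
    next
      case False
      then have "b' = (\<not> side N v i)" by auto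
      then show ?thesis using link_props[OF v i] ms[OF i] by (simp add: sent_def)
    qed
    then show ?thesis unfolding run_step_def by presburger
  qed
  then show ?thesis by (intro nth_equalityI) (simp_all add: local_step_def cong: if_cong)
qed

end

text \<open>In each round a node rebuilds the states of its links from its whole history. By
  induction on the number of executed steps, what it rebuilds is its view of the global execution,
  hence the two copies of an edge state never diverge.\<close>

lemma computable_exec:
  fixes prog :: "nat \<Rightarrow> nat \<Rightarrow> 's step list"
  assumes comp: "computable p T \<sigma>"
    and small: "\<And>n \<Delta> st. 2 \<le> n \<Longrightarrow> \<Delta> \<le> n \<Longrightarrow> st \<in> set (prog n \<Delta>) \<Longrightarrow> small_step c n \<Delta> st"
  shows "computable p (\<lambda>n \<Delta>. T n \<Delta> + length (prog n \<Delta>))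
           (\<lambda>N. exec N (prog (num_nodes N) (max_deg N)) (\<sigma> N))"
proof -
  obtain s dec C where s: "\<And>N v t i. valid_network p N \<Longrightarrow> v \<in> nodes N \<Longrightarrow> i < deg N v \<Longrightarrow>
       real (length (s (knows s N t v) i)) \<le> C * log 2 (real (num_nodes N))"
    and dec: "\<And>N v. valid_network p N \<Longrightarrow> v \<in> nodes N \<Longrightarrow>
       dec (knows s N (T (num_nodes N) (max_deg N)) v) = view N (\<sigma> N) v"
    using comp unfolding computable_def by metis
  define TK where "TK K = T (size_n K) (delta K)" for K :: knowledge
  define PK where "PK K = prog (size_n K) (delta K)" for K :: knowledge
  \<comment> \<open>Three periods: the given rule, the program, and silence afterwards, since the
    length bound must hold in every round.\<close>
  define s' where "s' K i = (if length (received K) < TK K then s K i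
     else let j = length (received K) - TK K in
       if j < length (PK K) then encode (msg (PK K ! j) (local_exec (TK K) dec (PK K) K) i) else [])" for K i
  define T' where "T' N = T (num_nodes N) (max_deg N) + length (prog (num_nodes N) (max_deg N))" for N
  have "(\<forall>t. \<forall>i<deg N v. real (length (s' (knows s' N t v) i)) \<le> max C (real c + 1) * log 2 (real (num_nodes N))) \<and>
     (let K = knows s' N (T' N) v in local_exec (TK K) dec (PK K) K) =
      view N (exec N (prog (num_nodes N) (max_deg N)) (\<sigma> N)) v" if N: "valid_network p N" and v0: "v \<in> nodes N" for N v
  proof -
    interpret net p N by unfold_locales (fact N)
    define T0 where "T0 = T (num_nodes N) (max_deg N)"
    define pr where "pr = prog (num_nodes N) (max_deg N)"
    have TK [simp]: "TK (knows s' N t v) = T0" "PK (knows s' N t v) = pr" for t v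
      by (simp_all add: TK_def PK_def T0_def pr_def)
    have TK' [simp]: "TK (knows s N t v) = T0" for t v
      by (simp add: TK_def T0_def)
    have s'_early: "s' (knows s' N t v) i = s (knows s' N t v) i" if "t < T0" for t v i
      using that by (subst s'_def) simp
    have s'_late: "s' (knows s' N (T0 + j) v) i = encode (msg (pr ! j) (local_exec T0 dec pr (knows s' N (T0 + j) v)) i)"
      if "j < length pr" for j v i
      using that by (subst s'_def) (simp add: Let_def)
    have s'_end: "s' (knows s' N (T0 + j) v) i = []" if "length pr \<le> j" for j v i
      using that by (subst s'_def) (simp add: Let_def)
    have s_eq: "knows s' N t v = knows s N t v" if "t \<le> T0" for t v
      by (rule knows_cong) (use that s'_early in simp)
    have dec': "dec (knows s' N T0 v) = view N (\<sigma> N) v" if "v \<in> nodes N" for v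
      using dec[OF N that] s_eq[of T0 v] by (simp add: T0_def)
    have main: "local_exec T0 dec pr (knows s' N (T0 + j) v) = view N (exec N (take j pr) (\<sigma> N)) v"
      if "j \<le> length pr" "v \<in> nodes N" for j v
      using that
    proof (induction j arbitrary: v)
      case 0
      then show ?case
        using knows_truncate[of T0 T0 s' N v] dec'[of v] by (simp add: local_exec_def exec_def)
    next
      case (Suc j)
      let ?K = "knows s' N (T0 + j) v"
      let ?ms = "map (\<lambda>i. s' (knows s' N (T0 + j) (nbr N v i)) (port_to N (nbr N v i) v)) [0..<deg N v]"
      have "zip pr (drop T0 (received (knows s' N (T0 + Suc j) v))) = zip pr (drop T0 (received ?K)) @ [(pr ! j, ?ms)]"
        using Suc.prems zip_snoc_right[of "drop T0 (received ?K)" pr] by (simp add: received_knows_Suc)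
      moreover have "(knows s' N (T0 + Suc j) v)\<lparr>received := take T0 (received (knows s' N (T0 + Suc j) v))\<rparr> =
                     ?K\<lparr>received := take T0 (received ?K)\<rparr>"
        using knows_truncate[of T0 "T0 + Suc j" s' N v] knows_truncate[of T0 "T0 + j" s' N v] by simp
      ultimately have "local_exec T0 dec pr (knows s' N (T0 + Suc j) v) = local_step (pr ! j) ?ms (local_exec T0 dec pr ?K)"
        by (simp add: local_exec_def)
      also have "local_exec T0 dec pr ?K = view N (exec N (take j pr) (\<sigma> N)) v" using Suc by simp
      also have "local_step (pr ! j) ?ms \<dots> = view N (run_step N (pr ! j) (exec N (take j pr) (\<sigma> N))) v"
      proof (rule local_step_view)
        fix i assume i: "i < deg N v"
        then show "decode (?ms ! i) = msg (pr ! j) (view N (exec N (take j pr) (\<sigma> N)) (nbr N v i)) (port_to N (nbr N v i) v)"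
          using Suc link_props(6)[of v i] by (simp add: s'_late)
      qed (use Suc in simp)
      finally show ?case using Suc.prems by (simp add: take_Suc_conv_app_nth exec_def)
    qed
    have "real (length (s' (knows s' N t v) i)) \<le> max C (real c + 1) * log 2 (real (num_nodes N))"
      if i: "i < deg N v" for t i
    proof -
      have n2: "2 \<le> num_nodes N" using two_nodes[OF v0 i] .
      then have lg: "0 \<le> log 2 (real (num_nodes N))" by simp
      show ?thesis
      proof (cases "t < T0")
        case True
        then have "s' (knows s' N t v) i = s (knows s N t v) i" 
            using s'_early[OF True, of v i] unfolding s_eq[OF less_imp_le[OF True]] by simp
        then show ?thesis using s[OF N v0 i, of t] lg
          by (simp add: order_trans[OF _ mult_right_mono[OF max.cobounded1]])
      next
        case False
        define j where "j = t - T0"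
        have t: "t = T0 + j" using False by (simp add: j_def)
        show ?thesis
        proof (cases "j < length pr")
          case True
          let ?L = "view N (exec N (take j pr) (\<sigma> N)) v"
          have eq: "s' (knows s' N t v) i = encode (msg (pr ! j) ?L i)"
            using True main[of j v] v0 by (simp add: s'_late t)
          have "small_step c (num_nodes N) (max_deg N) (pr ! j)"
            using small[OF n2, of "max_deg N"] max_deg_less v0 True by (fastforce simp: pr_def)
          then have "msg (pr ! j) ?L i \<le> num_nodes N ^ c"
            unfolding small_step_def using i n2 deg_le_max[OF v0] max_deg_less v0 by (fastforce simp: view_def)
          then have "real (length (encode (msg (pr ! j) ?L i))) \<le> (real c + 1) * log 2 (real (num_nodes N))"
            by (rule encode_length_log[OF n2])
          then show ?thesis unfolding eq using lg
            by (rule order_trans[OF _ mult_right_mono[OF max.cobounded2]])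
        next
          case False
          then show ?thesis using lg by (simp add: s'_end t max_def)
        qed
      qed
    qed
    then show ?thesis using main[of "length pr" v] v0 by (simp add: T'_def Let_def flip: T0_def pr_def)
  qed
  then show ?thesis
    unfolding computable_def T'_def Let_def
    by (intro exI[of _ s'] exI[of _ "\<lambda>K. local_exec (TK K) dec (PK K) K"] exI[of _ "max C (real c + 1)"]) blast
qed

lemma computable_map:
  assumes "computable p T \<sigma>"
  shows "computable p T (\<lambda>N e. f (num_nodes N) (max_deg N) (\<sigma> N e))"
proof -
  obtain s dec C where s: "\<And>N v. valid_network p N \<Longrightarrow> v \<in> nodes N \<Longrightarrow>
       (\<forall>t. \<forall>i<deg N v. real (length (s (knows s N t v) i)) \<le> C * log 2 (real (num_nodes N))) \<and>
       dec (knows s N (T (num_nodes N) (max_deg N)) v) = view N (\<sigma> N) v"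
    using assms unfolding computable_def by metis
  show ?thesis
    unfolding computable_def
    by (rule exI[of _ s], rule exI[of _ "\<lambda>K. map (map_prod id (f (size_n K) (delta K))) (dec K)"], rule exI[of _ C])
      (use s in \<open>auto simp: view_def\<close>)
qed

text \<open>After one exchange of identifiers both ends of a link know which of them is the lower
  one; this makes the sides in the views available to all later programs.\<close>

lemma computable_idents: "computable p (\<lambda>_ _. 1) (\<lambda>N e b. ident N (endp N e b))"
proof -
  obtain c where c: "\<And>n. 2 \<le> n \<Longrightarrow> poly p n \<le> n ^ c" using poly_nat_bound by blast
  define s where "s K i = encode (own_id K)" for K :: knowledge and i :: nat
  define dec where "dec K = map (\<lambda>i. let a = own_id K; a' = decode (received K ! 0 ! i); b = a' < a in
     (b, \<lambda>b'. if b' = b then a else a')) [0..<ports K]" for K :: knowledge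
  have "real (length (s (knows s N t v) i)) \<le> (real c + 1) * log 2 (real (num_nodes N))"
    if "valid_network p N" "v \<in> nodes N" "i < deg N v" for N v t i
  proof -
    interpret net p N by unfold_locales fact
    have n: "2 \<le> num_nodes N" using two_nodes that by blast
    have "ident N v \<le> poly p (num_nodes N)" using valid that(2) by (auto simp: valid_network_def)
    then have "ident N v \<le> num_nodes N ^ c" using c[OF n] by linarith
    then show ?thesis unfolding s_def using encode_length_log[OF n] by simp
  qed
  moreover have "dec (knows s N 1 v) = view N (\<lambda>e b. ident N (endp N e b)) v" if "valid_network p N" "v \<in> nodes N" for N v
  proof -
    interpret net p N by unfold_locales fact
    show ?thesis
    proof (rule nth_equalityI)
      fix i assume "i < length (dec (knows s N 1 v))"
      then have i: "i < deg N v" by (simp add: dec_def)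
      have "(\<lambda>b. ident N (endp N (link N v i) b)) = (\<lambda>b'. if b' = side N v i then ident N v else ident N (nbr N v i))"
      proof
        fix b
        show "ident N (endp N (link N v i) b) = (if b = side N v i then ident N v else ident N (nbr N v i))"
        proof (cases "b = side N v i")
          case True then show ?thesis using link_props(2)[OF that(2) i] by simp
        next
          case False
          then have "b = (\<not> side N v i)" by auto
          then show ?thesis using link_props(3)[OF that(2) i] by simp
        qed
      qed
      then show "dec (knows s N 1 v) ! i = view N (\<lambda>e b. ident N (endp N e b)) v ! i"
        using i by (simp add: dec_def view_def received_knows_Suc received_knows_0 s_def side_def Let_def cong: if_cong)
    qed (simp add: dec_def view_def)
  qed
  ultimately show ?thesis unfolding computable_def by blast
qed

section \<open>A token game\<close>

lemma card_filter_Un: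
  assumes "finite A" "finite B" "A \<inter> B = {}"
  shows "card {e \<in> A \<union> B. Q e} = card {e \<in> A. Q e} + card {e \<in> B. Q e}"
proof -
  have "{e \<in> A \<union> B. Q e} = {e \<in> A. Q e} \<union> {e \<in> B. Q e}" by auto
  then show ?thesis using assms by (simp add: card_Un_disjoint disjoint_iff)
qed

text \<open>A charging scheme: every element of \<open>I\<close> is paid for by \<open>m\<close>
  private elements of \<open>B\<close>.\<close>

lemma mult_card_le_disjoint:
  fixes S :: "nat \<Rightarrow> 'e set"
  assumes "finite I" "\<And>p. p \<in> I \<Longrightarrow> finite (S p)" "\<And>p. p \<in> I \<Longrightarrow> m \<le> card (S p)"
    and "\<And>p q. p \<in> I \<Longrightarrow> q \<in> I \<Longrightarrow> p \<noteq> q \<Longrightarrow> S p \<inter> S q = {}"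
    and "(\<Union>p\<in>I. S p) \<subseteq> B" "finite B"
  shows "m * card I \<le> card B"
proof -
  have "m * card I = (\<Sum>p\<in>I. m)" by simp
  also have "\<dots> \<le> (\<Sum>p\<in>I. card (S p))" by (rule sum_mono) (use assms in auto)
  also have "\<dots> = card (\<Union>p\<in>I. S p)" by (rule card_UN_disjoint[symmetric]) (use assms in auto)
  also have "\<dots> \<le> card B" by (rule card_mono) (use assms in auto)
  finally show ?thesis .
qed

text \<open>
  A full node retires \<open>d\<close> of its tokens in each phase, so that \<open>\<tau> p w - d * c p w\<close> tokens of
  \<open>w\<close> are still active before phase \<open>p\<close>. Every full node proposes to move up to \<open>a\<close>
  tokens along unused edges to nodes that are not full, and these accept up to \<open>a\<close> proposals each. If an edge
  remains unused, then almost every phase that retires tokens at its source also retires tokens at its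
  destination; this bounds the difference of their final numbers of tokens.
\<close>

locale token_moves =
  fixes H :: "'e set" and src dst :: "'e \<Rightarrow> 'v" and P :: nat
    and U Prp :: "nat \<Rightarrow> 'e set" and full :: "nat \<Rightarrow> 'v \<Rightarrow> bool"
  assumes finH: "finite H"
    and U0: "U 0 = {}"
    and Prp: "\<And>p. p < P \<Longrightarrow> Prp p \<subseteq> {e \<in> H - U p. full p (src e) \<and> \<not> full p (dst e)}"
    and U_Suc: "\<And>p. p < P \<Longrightarrow> U p \<subseteq> U (Suc p) \<and> U (Suc p) - U p \<subseteq> Prp p"
begin

lemma U_sub: "p \<le> P \<Longrightarrow> U p \<subseteq> H"
proof (induction p)
  case 0 then show ?case using U0 by simp
next
  case (Suc p)
  then have "U p \<subseteq> H" "U (Suc p) - U p \<subseteq> Prp p" "Prp p \<subseteq> H" using U_Suc[of p] Prp[of p] by auto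
  then show ?case by blast
qed

lemma U_mono: "p \<le> q \<Longrightarrow> q \<le> P \<Longrightarrow> U p \<subseteq> U q"
proof (induction q)
  case (Suc q)
  then show ?case using U_Suc[of q] by (cases "p = Suc q") auto
qed auto

lemma finU: "p \<le> P \<Longrightarrow> finite (U p)"
  using U_sub finH finite_subset by blast

lemma finPrp: "p < P \<Longrightarrow> finite (Prp p)"
  by (rule finite_subset[OF _ finH]) (use Prp in auto)

end

text \<open>Here \<open>k\<close> bounds the initial tokens, \<open>a\<close> the moves of a node
  per phase, and \<open>d\<close> is the number retired per full phase. The condition
  \<open>d_small\<close> is tailored to \<open>final_diff\<close>.\<close>

locale token_game = token_moves H src dst P U Prp full
  for H :: "'e set" and src dst :: "'e \<Rightarrow> 'v" and P :: nat
    and U Prp :: "nat \<Rightarrow> 'e set" and full :: "nat \<Rightarrow> 'v \<Rightarrow> bool" +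
  fixes D k a d :: nat and \<tau>0 :: "'v \<Rightarrow> nat" and c :: "nat \<Rightarrow> 'v \<Rightarrow> nat" and \<tau> :: "nat \<Rightarrow> 'v \<Rightarrow> int"
  assumes degsrc: "\<And>w. card {e \<in> H. src e = w} \<le> D"
    and degdst: "\<And>w. card {e \<in> H. dst e = w} \<le> D"
    and \<tau>0_le: "\<And>w. \<tau>0 w \<le> k"
    and Prp_le: "\<And>p w. p < P \<Longrightarrow> card {e \<in> Prp p. src e = w} \<le> a"
    and Prp_max: "\<And>p e. p < P \<Longrightarrow> e \<in> H - U p \<Longrightarrow> full p (src e) \<Longrightarrow> \<not> full p (dst e) \<Longrightarrow> e \<notin> Prp p \<Longrightarrow>
                    a \<le> card {e' \<in> Prp p. src e' = src e}"
    and Acc_le: "\<And>p w. p < P \<Longrightarrow> card {e \<in> U (Suc p) - U p. dst e = w} \<le> a"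
    and Acc_max: "\<And>p e. p < P \<Longrightarrow> e \<in> Prp p - U (Suc p) \<Longrightarrow>
                    a \<le> card {e' \<in> U (Suc p) - U p. dst e' = dst e}"
    and \<tau>_def: "\<And>p w. \<tau> p w = int (\<tau>0 w) + int (card {e \<in> U p. dst e = w}) - int (card {e \<in> U p. src e = w})"
    and c0: "\<And>w. c 0 w = 0"
    and c_Suc: "\<And>p w. p < P \<Longrightarrow> c (Suc p) w = c p w + of_bool (full p w)"
    and full: "\<And>p w. p < P \<Longrightarrow> full p w \<longleftrightarrow> \<tau> p w \<ge> int (d * c p w + a + d)"
    and a_pos: "0 < a" and a_le: "a \<le> D" and d_small: "3 * d * D^2 \<le> a^3" and d_le: "d \<le> a" and P_big: "k \<le> P * d"
begin

lemma \<tau>_Suc: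
  assumes "p < P"
  shows "\<tau> (Suc p) w = \<tau> p w + int (card {e \<in> U (Suc p) - U p. dst e = w}) - int (card {e \<in> U (Suc p) - U p. src e = w})"
proof -
  have eq: "U p \<union> (U (Suc p) - U p) = U (Suc p)" using U_Suc[OF assms] by auto
  have "card {e \<in> U (Suc p). Q e} = card {e \<in> U p. Q e} + card {e \<in> U (Suc p) - U p. Q e}" for Q
    using card_filter_Un[of "U p" "U (Suc p) - U p" Q] finU[of p] finU[of "Suc p"] assms
    unfolding eq by simp
  from this[of "\<lambda>e. dst e = w"] this[of "\<lambda>e. src e = w"] show ?thesis unfolding \<tau>_def by linarith
qed

text \<open>A full node receives nothing, and its \<open>a + d\<close> active tokens pay for at most
  \<open>a\<close> departures and the \<open>d\<close> retirements, so its stock stays nonnegative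
  and falls by at least \<open>d\<close>. A node that is not full sends nothing, starts below
  \<open>a + d\<close> and gains at most \<open>a\<close>. Both cases preserve the maximum.\<close>

lemma active_bound:
  assumes "p \<le> P"
  shows "0 \<le> \<tau> p w - int (d * c p w) \<and>
         \<tau> p w - int (d * c p w) \<le> max (int k - int (p * d)) (int (2 * a + d) - 1)"
  using assms
proof (induction p)
  case 0
  then show ?case using \<tau>0_le[of w] by (simp add: \<tau>_def U0 c0)
next
  case (Suc p)
  then have p: "p < P" by simp
  let ?A = "U (Suc p) - U p"
  note IH = Suc.IH[OF less_imp_le[OF p]]
  have fA: "finite ?A" using finU[of "Suc p"] p by auto
  have AP: "?A \<subseteq> Prp p" and PE: "Prp p \<subseteq> {e \<in> H - U p. full p (src e) \<and> \<not> full p (dst e)}"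
    using U_Suc[OF p] Prp[OF p] by auto
  show ?case
  proof (cases "full p w")
    case True
    have "{e \<in> ?A. dst e = w} = {}" using AP PE True by auto
    then have "card {e \<in> ?A. dst e = w} = 0" by (simp only: card.empty)
    moreover have "card {e \<in> ?A. src e = w} \<le> card {e \<in> Prp p. src e = w}"
      by (rule card_mono) (use AP finPrp[OF p] in auto)
    ultimately have "\<tau> (Suc p) w \<le> \<tau> p w" "\<tau> p w - int a \<le> \<tau> (Suc p) w"
      using \<tau>_Suc[OF p, of w] Prp_le[OF p, of w] by linarith+
    then show ?thesis
      using True full[OF p, of w] IH c_Suc[OF p, of w] by (auto simp: algebra_simps)
  next
    case False
    have "{e \<in> ?A. src e = w} = {}" using AP PE False by auto
    then have "card {e \<in> ?A. src e = w} = 0" by (simp only: card.empty)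
    then have "\<tau> p w \<le> \<tau> (Suc p) w" "\<tau> (Suc p) w \<le> \<tau> p w + int a"
      using \<tau>_Suc[OF p, of w] Acc_le[OF p, of w] by linarith+
    then show ?thesis
      using False full[OF p, of w] IH c_Suc[OF p, of w] by (auto simp: algebra_simps)
  qed
qed

lemma c_le: "p \<le> P \<Longrightarrow> c p w \<le> p"
proof (induction p)
  case (Suc p) then show ?case using c_Suc[of p w] by (auto simp: of_bool_def)
qed (simp add: c0)

lemma final_tokens_le: "\<tau> P w \<le> int (2 * a + d + d * P)"
proof -
  have "d * c P w \<le> d * P" using c_le[of P w] by simp
  then have "int (d * c P w) \<le> int (d * P)" by (simp only: of_nat_le_iff)
  moreover have "int k - int (P * d) \<le> 0" using P_big by (simp flip: of_nat_mult)
  ultimately show ?thesis using active_bound[of P w] a_pos by auto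
qed

lemma final_tokens_ge: "0 \<le> \<tau> P w"
  using active_bound[of P w] by (smt (verit) of_nat_0_le_iff order_refl)

text \<open>Only phases in which \<open>v\<close> is full and \<open>w\<close> is not can widen the
  gap.\<close>

lemma c_diff:
  assumes "p \<le> P"
  shows "int (c p v) - int (c p w) \<le> int (card {q. q < p \<and> full q v \<and> \<not> full q w})"
  using assms
proof (induction p)
  case (Suc p)
  let ?X = "\<lambda>p. {q. q < p \<and> full q v \<and> \<not> full q w}"
  have "?X (Suc p) = (if full p v \<and> \<not> full p w then insert p (?X p) else ?X p)"
    by (auto simp: less_Suc_eq)
  then have "card (?X (Suc p)) = card (?X p) + of_bool (full p v \<and> \<not> full p w)"
    by auto
  then show ?case using Suc c_Suc[of p v] c_Suc[of p w] by (auto simp: of_bool_def)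
qed (simp add: c0)

text \<open>Every rejection saturates the receiver, and the tokens it accepts then use up distinct edges.\<close>

lemma rejections_le:
  assumes "e \<in> H"
  shows "a * card {p. p < P \<and> e \<in> Prp p - U (Suc p)} \<le> D"
proof -
  let ?X = "{p. p < P \<and> e \<in> Prp p - U (Suc p)}"
  let ?S = "\<lambda>p. {e' \<in> U (Suc p) - U p. dst e' = dst e}"
  have "a * card ?X \<le> card {e' \<in> H. dst e' = dst e}"
  proof (rule mult_card_le_disjoint[where S = ?S])
    fix p q assume pq: "p \<in> ?X" "q \<in> ?X" "p \<noteq> q"
    have S: "?S p \<inter> ?S q = {}" if "p < q" "q < P" for p q
      using U_mono[of "Suc p" q] that by auto
    show "?S p \<inter> ?S q = {}"
    proof (cases "p < q")
      case True then show ?thesis using S[of p q] pq by blast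
    next
      case False
      then have "?S q \<inter> ?S p = {}" using S[of q p] pq by auto
      then show ?thesis by (simp only: Int_commute)
    qed
  next
    show "(\<Union>p\<in>?X. ?S p) \<subseteq> {e' \<in> H. dst e' = dst e}"
    proof
      fix x assume "x \<in> (\<Union>p\<in>?X. ?S p)"
      then obtain p where "p < P" "x \<in> U (Suc p)" "dst x = dst e" by auto
      then show "x \<in> {e' \<in> H. dst e' = dst e}" using U_sub[of "Suc p"] by auto
    qed
    fix p assume p: "p \<in> ?X"
    show "finite (?S p)" using finU[of "Suc p"] p by auto
    show "a \<le> card (?S p)" using p Acc_max[of p e] by auto
  qed (use finH in auto)
  then show ?thesis using degdst[of "dst e"] by linarith
qed

text \<open>In each such phase the source proposes at least \<open>a\<close> edges. An edge is
  proposed at most \<open>1 + D / a\<close> times, once successfully and \<open>D / a\<close> times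
  in vain by \<open>rejections_le\<close>, and the source has at most \<open>D\<close> edges.
  Multiplying by \<open>a\<close> twice avoids division.\<close>

lemma unproposed_le:
  assumes "e \<in> H"
  shows "a * (a * card {p. p < P \<and> full p (src e) \<and> \<not> full p (dst e) \<and> e \<notin> U p \<and> e \<notin> Prp p}) \<le> a * D + D * D"
proof -
  let ?X = "{p. p < P \<and> full p (src e) \<and> \<not> full p (dst e) \<and> e \<notin> U p \<and> e \<notin> Prp p}"
  let ?O = "{e' \<in> H. src e' = src e}"
  let ?f = "\<lambda>p. {e' \<in> Prp p. src e' = src e}"
  have fO: "finite ?O" using finH by auto
  have "a * card ?X = (\<Sum>p\<in>?X. a)" by simp
  also have "\<dots> \<le> (\<Sum>p\<in>?X. card (?f p))"
    by (rule sum_mono) (use Prp_max assms in auto)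
  also have "\<dots> \<le> (\<Sum>p<P. card (?f p))"
    by (rule sum_mono2) auto
  also have "\<dots> = (\<Sum>p<P. \<Sum>e'\<in>?O. of_bool (e' \<in> Prp p))"
  proof (rule sum.cong[OF refl])
    fix p assume "p \<in> {..<P}"
    then have p: "p < P" by simp
    have "?f p = {e' \<in> ?O. e' \<in> Prp p}" using Prp[OF p] by auto
    then show "card (?f p) = (\<Sum>e'\<in>?O. of_bool (e' \<in> Prp p))" using fO by (simp add: Int_def)
  qed
  also have "\<dots> = (\<Sum>e'\<in>?O. \<Sum>p<P. of_bool (e' \<in> Prp p))" by (rule sum.swap)
  also have "\<dots> = (\<Sum>e'\<in>?O. card {p. p < P \<and> e' \<in> Prp p})"
    by (rule sum.cong) (auto simp: Int_def intro!: arg_cong[where f=card])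
  finally have 1: "a * card ?X \<le> (\<Sum>e'\<in>?O. card {p. p < P \<and> e' \<in> Prp p})" .
  have 2: "a * card {p. p < P \<and> e' \<in> Prp p} \<le> a + D" if "e' \<in> ?O" for e'
  proof -
    let ?R = "{p. p < P \<and> e' \<in> Prp p - U (Suc p)}" and ?A = "{p. p < P \<and> e' \<in> Prp p \<and> e' \<in> U (Suc p)}"
    have "p = q" if "p \<in> ?A" "q \<in> ?A" for p q
    proof (rule ccontr)
      assume "p \<noteq> q"
      moreover have False if "p < q" "p \<in> ?A" "q \<in> ?A" for p q
        using U_mono[of "Suc p" q] that Prp[of q] by auto
      ultimately show False using that by (meson nat_neq_iff)
    qed
    then have "card ?A \<le> Suc 0" by (subst card_le_Suc0_iff_eq) (simp, blast)
    moreover have "card {p. p < P \<and> e' \<in> Prp p} \<le> card ?R + card ?A"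
      by (rule order_trans[OF card_mono card_Un_le]) auto
    ultimately have "card {p. p < P \<and> e' \<in> Prp p} \<le> card ?R + 1" by simp
    then have "a * card {p. p < P \<and> e' \<in> Prp p} \<le> a * (card ?R + 1)" by (rule mult_le_mono2)
    then show ?thesis using rejections_le[of e'] that by simp
  qed
  have "a * (a * card ?X) \<le> (\<Sum>e'\<in>?O. a * card {p. p < P \<and> e' \<in> Prp p})"
    using mult_le_mono2[OF 1, of a] by (simp add: sum_distrib_left)
  also have "\<dots> \<le> (\<Sum>e'\<in>?O. a + D)" by (rule sum_mono) (use 2 in auto)
  also have "\<dots> \<le> D * (a + D)" using degsrc[of "src e"] by simp
  finally show ?thesis by (simp add: algebra_simps)
qed

text \<open>In a phase where the source is full and the destination is not, the edge is either
  rejected or not proposed. The two counts bound \<open>a ^ 2\<close> times the number of these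
  phases by \<open>3 * D ^ 2\<close>, so by \<open>d_small\<close> the retired tokens of the two
  ends differ by at most \<open>a\<close>. The active tokens differ by less than
  \<open>2 * a + d \<le> 3 * a\<close>.\<close>

lemma final_diff:
  assumes e: "e \<in> H" "e \<notin> U P"
  shows "\<tau> P (src e) - \<tau> P (dst e) \<le> int (4 * a)"
proof -
  let ?X = "{p. p < P \<and> full p (src e) \<and> \<not> full p (dst e)}"
  let ?X1 = "{p. p < P \<and> e \<in> Prp p - U (Suc p)}"
  let ?X2 = "{p. p < P \<and> full p (src e) \<and> \<not> full p (dst e) \<and> e \<notin> U p \<and> e \<notin> Prp p}"
  have nU: "e \<notin> U p" if "p \<le> P" for p using U_mono[OF that] e by auto
  have "?X \<subseteq> ?X1 \<union> ?X2" using nU by auto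
  then have "card ?X \<le> card (?X1 \<union> ?X2)" by (intro card_mono) simp
  also have "\<dots> \<le> card ?X1 + card ?X2" by (rule card_Un_le)
  finally have "a * (a * card ?X) \<le> a * (a * (card ?X1 + card ?X2))" by (intro mult_le_mono2)
  also have "\<dots> = a * (a * card ?X1) + a * (a * card ?X2)" by (simp only: distrib_left)
  also have "\<dots> \<le> a * D + (a * D + D * D)"
    using rejections_le[OF e(1)] unproposed_le[OF e(1)] by (intro add_mono mult_le_mono2)
  also have "\<dots> \<le> 3 * D^2"
    using mult_le_mono1[OF a_le, of D] unfolding power2_eq_square by linarith
  finally have "d * (a * (a * card ?X)) \<le> d * (3 * D^2)" by (rule mult_le_mono2)
  also have "\<dots> \<le> a^3" using d_small by (simp only: mult.assoc mult.left_commute)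
  finally have "(a * a) * (d * card ?X) \<le> (a * a) * a"
    by (simp only: power3_eq_cube mult.assoc mult.left_commute)
  then have X: "d * card ?X \<le> a" using a_pos by simp
  have "int d * (int (c P (src e)) - int (c P (dst e))) \<le> int d * int (card ?X)"
    by (rule mult_left_mono[OF c_diff[OF order_refl]]) simp
  also have "\<dots> \<le> int a" using X by (metis of_nat_le_iff of_nat_mult)
  finally have "int (d * c P (src e)) - int (d * c P (dst e)) \<le> int a" by (simp add: algebra_simps)
  moreover have "int k - int (P * d) \<le> 0" using P_big by (simp flip: of_nat_mult)
  ultimately show ?thesis
    using active_bound[of P "src e"] active_bound[of P "dst e"] d_le a_pos by auto
qed

end

section \<open>Balanced partial orientations of bipartite graphs\<close>

definition inc :: "'e set \<Rightarrow> ('e \<Rightarrow> bool \<Rightarrow> 'v) \<Rightarrow> 'v \<Rightarrow> nat" where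
  "inc E nd w = card {e \<in> E. \<exists>b. nd e b = w}"

text \<open>Orientations are partial: \<open>r e = Some b\<close> directs \<open>e\<close> towards
  its end \<open>nd e b\<close>, and \<open>None\<close> leaves it open.\<close>

definition indeg :: "'e set \<Rightarrow> ('e \<Rightarrow> bool \<Rightarrow> 'v) \<Rightarrow> ('e \<Rightarrow> bool option) \<Rightarrow> 'v \<Rightarrow> nat" where
  "indeg E nd r w = card {e \<in> E. \<exists>b. nd e b = w \<and> r e = Some b}"

text \<open>This is twice the indegree minus the degree, shifted by \<open>\<Delta>\<close> to keep
  it a natural number that can be sent in a message; \<open>inc_le\<close> makes the subtraction
  exact.\<close>

definition height :: "'e set \<Rightarrow> ('e \<Rightarrow> bool \<Rightarrow> 'v) \<Rightarrow> nat \<Rightarrow> ('e \<Rightarrow> bool option) \<Rightarrow> 'v \<Rightarrow> nat" where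
  "height E nd \<Delta> r w = 2 * indeg E nd r w + \<Delta> - inc E nd w"

definition balanced :: "'e set \<Rightarrow> ('e \<Rightarrow> bool \<Rightarrow> 'v) \<Rightarrow> nat \<Rightarrow> nat \<Rightarrow> ('e \<Rightarrow> bool option) \<Rightarrow> bool" where
  "balanced E nd \<Delta> X r \<longleftrightarrow>
     (\<forall>e\<in>E. \<forall>b. r e = Some b \<longrightarrow> height E nd \<Delta> r (nd e b) \<le> height E nd \<Delta> r (nd e (\<not> b)) + X)"

locale bip_graph =
  fixes E :: "'e set" and nd :: "'e \<Rightarrow> bool \<Rightarrow> 'v" and D \<Delta> :: nat
  assumes finE: "finite E"
    and side: "e \<in> E \<Longrightarrow> e' \<in> E \<Longrightarrow> nd e b = nd e' b' \<Longrightarrow> b = b'"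
    and deg_sum: "e \<in> E \<Longrightarrow> inc E nd (nd e False) + inc E nd (nd e True) \<le> D"
    and inc_le: "inc E nd w \<le> \<Delta>"
begin

lemma inc_le_D: "inc E nd w \<le> D"
proof (cases "\<exists>e\<in>E. \<exists>b. nd e b = w")
  case True
  then obtain e b where "e \<in> E" "nd e b = w" by auto
  then show ?thesis using deg_sum[of e] by (cases b) auto
next
  case False
  then have "{e \<in> E. \<exists>b. nd e b = w} = {}" by auto
  then show ?thesis unfolding inc_def by (simp only: card.empty)
qed

text \<open>An edge left over by all stages is rejected by one of its ends in each of them, and every rejecting
  end accepts \<open>k\<close> other edges for good.\<close>

lemma all_oriented:
  fixes r :: "nat \<Rightarrow> 'e \<Rightarrow> bool option" and A :: "nat \<Rightarrow> 'e set" and lw :: "nat \<Rightarrow> 'e \<Rightarrow> bool"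
  assumes A: "\<And>i. i < I \<Longrightarrow> A i \<subseteq> {e \<in> E. r i e = None}"
    and r_Suc: "\<And>i e. i < I \<Longrightarrow> e \<in> E \<Longrightarrow> r (Suc i) e = None \<longleftrightarrow> r i e = None \<and> e \<notin> A i"
    and mx: "\<And>i e. i < I \<Longrightarrow> e \<in> E \<Longrightarrow> r i e = None \<Longrightarrow> e \<notin> A i \<Longrightarrow>
              k \<le> card {e' \<in> A i. nd e' (lw i e') = nd e (lw i e)}"
    and I: "D \<le> k * I" and e: "e \<in> E"
  shows "r I e \<noteq> None"
proof
  assume rI: "r I e = None"
  have earlier: "r i x = None" if "r j x = None" "i \<le> j" "j \<le> I" "x \<in> E" for i j x
    using that(2,1,3) by (induction rule: dec_induct) (use r_Suc that(4) in \<open>auto simp: Suc_le_eq\<close>)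
  have disj: "A i \<inter> A j = {}" if "i < j" "j < I" for i j
  proof -
    have "r (Suc i) x = None" if x: "x \<in> A j" for x
      using A[OF \<open>j < I\<close>] x earlier[of j x "Suc i"] \<open>i < j\<close> \<open>j < I\<close> by auto
    then show ?thesis using r_Suc[of i] A[of i] that by fastforce
  qed
  let ?S = "\<lambda>b. {i. i < I \<and> lw i e = b}"
  \<comment> \<open>The summand 1 is the edge \<open>e\<close> itself, which no stage accepts; it
    makes the final inequality strict.\<close>
  have *: "k * card (?S b) + 1 \<le> inc E nd (nd e b)" for b
  proof -
    let ?B = "{e' \<in> E. \<exists>b'. nd e' b' = nd e b} - {e}"
    have "k * card (?S b) \<le> card ?B"
    proof (rule mult_card_le_disjoint[where S = "\<lambda>i. {e' \<in> A i. nd e' (lw i e') = nd e (lw i e)}"])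
      fix i assume i: "i \<in> ?S b"
      then have "r i e = None" "r (Suc i) e = None"
        using earlier[OF rI, of i] earlier[OF rI, of "Suc i"] e by auto
      then show "k \<le> card {e' \<in> A i. nd e' (lw i e') = nd e (lw i e)}"
        using mx[of i e] r_Suc[of i e] i e by auto
      show "finite {e' \<in> A i. nd e' (lw i e') = nd e (lw i e)}"
        by (rule finite_subset[OF _ finE]) (use A[of i] i in auto)
    next
      fix i j assume ij: "i \<in> ?S b" "j \<in> ?S b" "i \<noteq> j"
      have "A i \<inter> A j = {}"
        using disj[of i j] disj[of j i] ij by (cases "i < j") auto
      then show "{e' \<in> A i. nd e' (lw i e') = nd e (lw i e)} \<inter> {e' \<in> A j. nd e' (lw j e') = nd e (lw j e)} = {}"
        by blast
    next
      show "(\<Union>i\<in>?S b. {e' \<in> A i. nd e' (lw i e') = nd e (lw i e)}) \<subseteq> ?B"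
      proof
        fix x assume "x \<in> (\<Union>i\<in>?S b. {e' \<in> A i. nd e' (lw i e') = nd e (lw i e)})"
        then obtain i where i: "i < I" "lw i e = b" "x \<in> A i" "nd x (lw i x) = nd e b" by auto
        then have "x \<in> E" using A by auto
        moreover have "x \<noteq> e"
          using r_Suc[of i e] earlier[OF rI, of "Suc i"] e i by auto
        ultimately show "x \<in> ?B" using i by auto
      qed
    qed (use finE in auto)
    moreover have "inc E nd (nd e b) = card ?B + 1"
      unfolding inc_def using finE e by (subst card.remove[of _ e]) auto
    ultimately show ?thesis by simp
  qed
  have "card {i. i < I} = card (?S True \<union> ?S False)" by (rule arg_cong[where f = card]) auto
  also have "\<dots> = card (?S True) + card (?S False)" by (rule card_Un_disjoint) auto
  finally have "I = card (?S True) + card (?S False)" by simp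
  from arg_cong[OF this, of "(*) k"]
  have "k * I = k * card (?S True) + k * card (?S False)" unfolding distrib_left .
  then show False using *[of True] *[of False] deg_sum[OF e] I by linarith
qed

lemma int_height: "int (height E nd \<Delta> r w) = 2 * int (indeg E nd r w) + int \<Delta> - int (inc E nd w)"
  unfolding height_def using inc_le[of w] by simp

text \<open>Let \<open>e\<close> point from x to y. At y its new class keeps the entering edges, at
  x the leaving ones, so the new degrees add up to \<open>indeg y + inc x - indeg x\<close>. Balance
  says that \<open>2 * (indeg y - indeg x)\<close> is at most \<open>inc y - inc x + X\<close>, and
  the doubled sum is at most \<open>inc x + inc y + X\<close>.\<close>

lemma split_degree:
  fixes nd' :: "'e \<Rightarrow> bool \<Rightarrow> 'w"
  assumes tot: "\<And>e. e \<in> E \<Longrightarrow> r e \<noteq> None" and bal: "balanced E nd \<Delta> X r"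
    and nd': "\<And>e e' b b'. e \<in> E \<Longrightarrow> e' \<in> E \<Longrightarrow> nd' e b = nd' e' b' \<longleftrightarrow> nd e b = nd e' b' \<and> r e = r e'"
    and e: "e \<in> E"
  shows "inc E nd' (nd' e False) + inc E nd' (nd' e True) \<le> (D + X) div 2"
proof -
  obtain b where b: "r e = Some b" using tot[OF e] by auto
  let ?y = "nd e b" and ?x = "nd e (\<not> b)"
  have "{e' \<in> E. \<exists>b'. nd' e' b' = nd' e b} = {e' \<in> E. \<exists>b'. nd e' b' = ?y \<and> r e' = Some b'}"
  proof (rule Collect_cong, rule conj_cong[OF refl])
    fix e' assume e': "e' \<in> E"
    have "(\<exists>b'. nd' e' b' = nd' e b) \<longleftrightarrow> nd e' b = ?y \<and> r e' = Some b"
      unfolding nd'[OF e' e] b using side[OF e' e] by blast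
    also have "\<dots> \<longleftrightarrow> (\<exists>b'. nd e' b' = ?y \<and> r e' = Some b')"
      using side[OF e' e] by blast
    finally show "(\<exists>b'. nd' e' b' = nd' e b) \<longleftrightarrow> (\<exists>b'. nd e' b' = ?y \<and> r e' = Some b')" .
  qed
  then have y: "inc E nd' (nd' e b) = indeg E nd r ?y" unfolding inc_def indeg_def by simp
  have "{e' \<in> E. \<exists>b'. nd' e' b' = nd' e (\<not> b)} = {e' \<in> E. \<exists>b'. nd e' b' = ?x} - {e' \<in> E. \<exists>b'. nd e' b' = ?x \<and> r e' = Some b'}"
  proof (rule set_eqI)
    fix e'
    have "(\<exists>b'. nd' e' b' = nd' e (\<not> b)) \<longleftrightarrow> nd e' (\<not> b) = ?x \<and> r e' = Some b" if "e' \<in> E"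
      unfolding nd'[OF that e] b using side[OF that e] by blast
    moreover have "(\<exists>b'. nd e' b' = ?x) \<longleftrightarrow> nd e' (\<not> b) = ?x" if "e' \<in> E"
      using side[OF that e] by blast
    moreover have "(\<exists>b'. nd e' b' = ?x \<and> r e' = Some b') \<longleftrightarrow> nd e' (\<not> b) = ?x \<and> r e' \<noteq> Some b" if e': "e' \<in> E"
    proof -
      obtain b' where "r e' = Some b'" using tot[OF e'] by auto
      then show ?thesis using side[OF e' e, of _ "\<not> b"] by (cases "b' = b") auto
    qed
    ultimately show "e' \<in> {e' \<in> E. \<exists>b'. nd' e' b' = nd' e (\<not> b)} \<longleftrightarrow>
      e' \<in> {e' \<in> E. \<exists>b'. nd e' b' = ?x} - {e' \<in> E. \<exists>b'. nd e' b' = ?x \<and> r e' = Some b'}"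
      by blast
  qed
  then have x: "inc E nd' (nd' e (\<not> b)) + indeg E nd r ?x = inc E nd ?x"
  proof -
    let ?S = "{e' \<in> E. \<exists>b'. nd e' b' = ?x}" and ?T = "{e' \<in> E. \<exists>b'. nd e' b' = ?x \<and> r e' = Some b'}"
    assume "{e' \<in> E. \<exists>b'. nd' e' b' = nd' e (\<not> b)} = ?S - ?T"
    then have "inc E nd' (nd' e (\<not> b)) = card (?S - ?T)" by (simp only: inc_def)
    moreover have "?T \<subseteq> ?S" by blast
    moreover have "finite ?S" "finite ?T" using finE by auto
    ultimately show ?thesis
      unfolding inc_def indeg_def using card_Diff_subset[of ?T ?S] card_mono[of ?S ?T] by linarith
  qed
  have "int (height E nd \<Delta> r ?y) \<le> int (height E nd \<Delta> r ?x + X)"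
    using bal e b unfolding balanced_def by (simp del: of_nat_add)
  then have "2 * (inc E nd' (nd' e b) + inc E nd' (nd' e (\<not> b))) \<le> inc E nd ?x + inc E nd ?y + X"
    using x y by (simp add: int_height)
  also have "\<dots> \<le> D + X" using deg_sum[OF e] by (cases b) auto
  finally show ?thesis by (cases b) auto
qed

end

text \<open>
  The tokens of a node are the edges of \<open>A\<close> that it accepts. Moving a token flips an edge of \<open>H\<close>,
  and the heights of its ends before the stage differ so much that the flipped edge is balanced in any case.
\<close>

locale orient_stage = bip_graph E nd D \<Delta>
  for E :: "'e set" and nd :: "'e \<Rightarrow> bool \<Rightarrow> 'v" and D \<Delta> :: nat +
  fixes r0 :: "'e \<Rightarrow> bool option" and A :: "'e set" and k a d P :: nat
    and U Prp :: "nat \<Rightarrow> 'e set" and full :: "nat \<Rightarrow> 'v \<Rightarrow> bool" and c :: "nat \<Rightarrow> 'v \<Rightarrow> nat"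
    and h :: "'v \<Rightarrow> nat" and low :: "'e \<Rightarrow> bool" and r1 :: "'e \<Rightarrow> bool option" and ori :: "nat \<Rightarrow> 'e \<Rightarrow> bool option"
    and H :: "'e set"
  assumes h_def: "h = height E nd \<Delta> r0"
    and low_def: "\<And>e. e \<in> E \<Longrightarrow> low e \<longleftrightarrow> h (nd e True) \<le> h (nd e False)"
    and r1_def: "\<And>e. e \<in> E \<Longrightarrow> r1 e = (if e \<in> A then Some (low e) else r0 e)"
    and H_def: "H = {e \<in> E. \<exists>b. r1 e = Some b \<and> h (nd e (\<not> b)) + 2 * (k + 4 * a) \<le> h (nd e b)}"
    and ori_def: "\<And>p e. e \<in> E \<Longrightarrow> ori p e = (if e \<in> U p then map_option Not (r1 e) else r1 e)"
    and A: "A \<subseteq> {e \<in> E. r0 e = None}"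
    and A_le: "\<And>w. card {e \<in> A. nd e (low e) = w} \<le> k"
    and U0: "U 0 = {}"
    and Prp: "\<And>p. p < P \<Longrightarrow> Prp p \<subseteq> {e \<in> H - U p. full p (nd e (the (r1 e))) \<and> \<not> full p (nd e (\<not> the (r1 e)))}"
    and Prp_le: "\<And>p w. p < P \<Longrightarrow> card {e \<in> Prp p. nd e (the (r1 e)) = w} \<le> a"
    and Prp_max: "\<And>p e. p < P \<Longrightarrow> e \<in> H - U p \<Longrightarrow> full p (nd e (the (r1 e))) \<Longrightarrow> \<not> full p (nd e (\<not> the (r1 e))) \<Longrightarrow>
                    e \<notin> Prp p \<Longrightarrow> a \<le> card {e' \<in> Prp p. nd e' (the (r1 e')) = nd e (the (r1 e))}"
    and U_Suc: "\<And>p. p < P \<Longrightarrow> U p \<subseteq> U (Suc p) \<and> U (Suc p) - U p \<subseteq> Prp p"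
    and Acc_le: "\<And>p w. p < P \<Longrightarrow> card {e \<in> U (Suc p) - U p. nd e (\<not> the (r1 e)) = w} \<le> a"
    and Acc_max: "\<And>p e. p < P \<Longrightarrow> e \<in> Prp p - U (Suc p) \<Longrightarrow>
                    a \<le> card {e' \<in> U (Suc p) - U p. nd e' (\<not> the (r1 e')) = nd e (\<not> the (r1 e))}"
    and c0: "\<And>w. c 0 w = 0"
    and c_Suc: "\<And>p w. p < P \<Longrightarrow> c (Suc p) w = c p w + of_bool (full p w)"
    and full: "\<And>p w. p < P \<Longrightarrow> full p w \<longleftrightarrow> h w + 2 * (d * c p w + a + d) \<le> height E nd \<Delta> (ori p) w"
    and a_pos: "0 < a" and a_le: "a \<le> D" and d_small: "3 * d * D^2 \<le> a^3" and d_le: "d \<le> a"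
    and P_big: "k \<le> P * d" and P_small: "P * d \<le> k + d"
begin

abbreviation src where "src e \<equiv> nd e (the (r1 e))"
abbreviation dst where "dst e \<equiv> nd e (\<not> the (r1 e))"

text \<open>Fullness is given here in terms of heights. Turning it into a condition on tokens needs
  \<open>height_ori\<close>, which rests only on this weaker part of the game.\<close>

sublocale moves: token_moves H src dst P U Prp full
  by unfold_locales (use finE H_def U0 Prp U_Suc in auto)

definition \<tau> :: "nat \<Rightarrow> 'v \<Rightarrow> int" where
  "\<tau> p w = int (card {e \<in> A. nd e (low e) = w}) + int (card {e \<in> U p. dst e = w}) - int (card {e \<in> U p. src e = w})"

lemma indeg_r1: "indeg E nd r1 w = indeg E nd r0 w + card {e \<in> A. nd e (low e) = w}"
proof -
  have "{e \<in> E. \<exists>b. nd e b = w \<and> r1 e = Some b} =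
        {e \<in> E. \<exists>b. nd e b = w \<and> r0 e = Some b} \<union> {e \<in> A. nd e (low e) = w}"
    using A r1_def by (auto split: if_splits)
  moreover have "{e \<in> E. \<exists>b. nd e b = w \<and> r0 e = Some b} \<inter> {e \<in> A. nd e (low e) = w} = {}"
    using A by auto
  moreover have "finite A" by (rule finite_subset[OF A]) (use finE in auto)
  ultimately show ?thesis unfolding indeg_def using finE by (simp add: card_Un_disjoint)
qed

lemma indeg_ori:
  assumes "p \<le> P"
  shows "int (indeg E nd (ori p) w) = int (indeg E nd r0 w) + \<tau> p w"
proof -
  have UH: "U p \<subseteq> H" and UE: "U p \<subseteq> E" using moves.U_sub[OF assms] H_def by auto
  have fin: "finite (U p)" using moves.finU[OF assms] .
  let ?I = "{e \<in> E. \<exists>b. nd e b = w \<and> r1 e = Some b}"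
  let ?S = "{e \<in> U p. src e = w}" and ?T = "{e \<in> U p. dst e = w}"
  have U1: "\<exists>b. r1 e = Some b" if "e \<in> U p" for e using UH that H_def by auto
  have S: "?S \<subseteq> ?I" using UE U1 by fastforce
  have T: "?I \<inter> ?T = {}"
  proof -
    have False if "e \<in> ?I" "e \<in> ?T" for e using that side[of e e "the (r1 e)" "\<not> the (r1 e)"] by auto
    then show ?thesis by blast
  qed
  have "{e \<in> E. \<exists>b. nd e b = w \<and> ori p e = Some b} = (?I - ?S) \<union> ?T"
  proof (rule set_eqI)
    fix e
    show "e \<in> {e \<in> E. \<exists>b. nd e b = w \<and> ori p e = Some b} \<longleftrightarrow> e \<in> (?I - ?S) \<union> ?T"
    proof (cases "e \<in> U p")
      case True
      then obtain b where "r1 e = Some b" "e \<in> E" using U1 UE by auto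
      then show ?thesis using True ori_def[of e p] by auto
    next
      case False
      then show ?thesis using ori_def[of e p] by auto
    qed
  qed
  then have "indeg E nd (ori p) w = card (?I - ?S) + card ?T"
    unfolding indeg_def using finE fin T by (simp only:, subst card_Un_disjoint) auto
  moreover have "card (?I - ?S) = card ?I - card ?S" "card ?S \<le> card ?I"
    using S finE by (auto intro: card_Diff_subset finite_subset card_mono)
  ultimately have "int (indeg E nd (ori p) w) = int (indeg E nd r1 w) + int (card ?T) - int (card ?S)"
    unfolding indeg_def by simp
  then show ?thesis unfolding \<tau>_def by (simp add: indeg_r1)
qed

text \<open>A token is one unit of indegree gained in the stage, hence two units of height.\<close>

lemma height_ori: "p \<le> P \<Longrightarrow> int (height E nd \<Delta> (ori p) w) = int (h w) + 2 * \<tau> p w"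
  unfolding h_def int_height indeg_ori by simp

lemma card_ends_le_D:
  shows "card {e \<in> H. nd e (f e) = w} \<le> D"
proof -
  have "card {e \<in> H. nd e (f e) = w} \<le> inc E nd w"
    unfolding inc_def by (rule card_mono) (use finE H_def in auto)
  then show ?thesis using inc_le_D[of w] by linarith
qed

sublocale game: token_game H src dst P U Prp full D k a d "\<lambda>w. card {e \<in> A. nd e (low e) = w}" c \<tau>
proof unfold_locales
  fix p w assume "p < P"
  define x where "x = d * c p w + a + d"
  have "full p w \<longleftrightarrow> int x \<le> \<tau> p w"
    using full[OF \<open>p < P\<close>, of w, folded x_def] height_ori[of p w] \<open>p < P\<close> by auto
  then show "full p w \<longleftrightarrow> int (d * c p w + a + d) \<le> \<tau> p w" by (simp only: x_def)
qed (fact card_ends_le_D A_le Prp_le Prp_max Acc_le Acc_max \<tau>_def c0 c_Suc a_pos a_le d_small d_le P_big)+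

text \<open>During the stage every height grows by an amount between 0 and
  \<open>2 * (k + 4 * a)\<close>. A flipped edge had at least that much descent to its new head. An
  edge of \<open>H\<close> that was not flipped is not new, because new edges point to their lower
  end; so it had slack \<open>X\<close> and loses at most \<open>2 * (4 * a)\<close> by
  \<open>final_diff\<close>. Any other oriented edge starts with slack below
  \<open>2 * (k + 4 * a)\<close> and can lose that much again.\<close>

lemma balanced_ori:
  assumes "balanced E nd \<Delta> X r0"
  shows "balanced E nd \<Delta> (max (4 * (k + 4 * a)) (X + 8 * a)) (ori P)"
  unfolding balanced_def
proof (intro ballI allI impI)
  fix e b assume e: "e \<in> E" and b: "ori P e = Some b"
  have ge: "0 \<le> \<tau> P w" for w by (rule game.final_tokens_ge)
  have le: "\<tau> P w \<le> int (k + 4 * a)" for w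
  proof -
    have "2 * a + d + d * P \<le> k + 4 * a" using P_small d_le by (simp add: mult.commute)
    then show ?thesis using game.final_tokens_le[of w] by linarith
  qed
  have "int (height E nd \<Delta> (ori P) (nd e b)) \<le> int (height E nd \<Delta> (ori P) (nd e (\<not> b))) + int (max (4 * (k + 4 * a)) (X + 8 * a))"
  proof (cases "e \<in> U P")
    case True
    then have "r1 e = Some (\<not> b)" "e \<in> H" using b ori_def[OF e] moves.U_sub[of P] by auto
    then have "h (nd e b) + 2 * (k + 4 * a) \<le> h (nd e (\<not> b))" using H_def by auto
    then show ?thesis using ge[of "nd e (\<not> b)"] le[of "nd e b"] by (simp add: height_ori)
  next
    case False
    then have r1: "r1 e = Some b" using b ori_def[OF e] by auto
    show ?thesis
    proof (cases "e \<in> H")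
      case True
      then have hb: "h (nd e (\<not> b)) + 2 * (k + 4 * a) \<le> h (nd e b)" using H_def r1 by auto
      have "e \<notin> A"
      proof
        assume "e \<in> A"
        then have "low e = b" using r1 r1_def[OF e] by auto
        then have "h (nd e b) \<le> h (nd e (\<not> b))" using low_def[OF e] by (cases b) auto
        then show False using hb a_pos by auto
      qed
      then have "r0 e = Some b" using r1 r1_def[OF e] by auto
      then have "h (nd e b) \<le> h (nd e (\<not> b)) + X" using assms e unfolding balanced_def h_def by auto
      moreover have "\<tau> P (nd e b) - \<tau> P (nd e (\<not> b)) \<le> int (4 * a)"
        using game.final_diff[OF True False] r1 by simp
      ultimately show ?thesis by (simp add: height_ori)
    next
      case False
      then have "h (nd e b) < h (nd e (\<not> b)) + 2 * (k + 4 * a)" using H_def r1 e by auto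
      then show ?thesis using ge[of "nd e (\<not> b)"] le[of "nd e b"] by (simp add: height_ori)
    qed
  qed
  then show "height E nd \<Delta> (ori P) (nd e b) \<le> height E nd \<Delta> (ori P) (nd e (\<not> b)) + max (4 * (k + 4 * a)) (X + 8 * a)"
    by (simp only: of_nat_le_iff flip: of_nat_add)
qed

lemma ori_None: "e \<in> E \<Longrightarrow> ori P e = None \<longleftrightarrow> r0 e = None \<and> e \<notin> A"
  using ori_def[of e P] r1_def[of e] by auto

end

section \<open>Splitting edge classes\<close>

text \<open>Counting smaller elements maps \<open>S\<close> bijectively onto an initial segment of
  the naturals, and \<open>C\<close> is the preimage of its first \<open>k\<close> numbers.\<close>

lemma card_initial_segment:
  fixes S :: "nat set" and k :: nat
  assumes "finite S"
  defines "C \<equiv> {i \<in> S. card {j \<in> S. j < i} < k}"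
  shows "card C \<le> k" and "x \<in> S \<Longrightarrow> x \<notin> C \<Longrightarrow> k \<le> card C"
proof -
  let ?r = "\<lambda>i. card {j \<in> S. j < i}"
  have mono: "?r i < ?r i'" if "i \<in> S" "i < i'" for i i'
    by (rule psubset_card_mono) (use assms that in auto)
  have inj: "inj_on ?r S"
  proof (rule inj_onI)
    fix i i' assume "i \<in> S" "i' \<in> S" "?r i = ?r i'"
    then show "i = i'" using mono[of i i'] mono[of i' i] by (metis less_irrefl nat_neq_iff)
  qed
  have less: "?r ` S \<subseteq> {..<card S}"
  proof (rule image_subsetI)
    fix i assume "i \<in> S"
    then have "{j \<in> S. j < i} \<subset> S" by auto
    then show "?r i \<in> {..<card S}" using assms(1) by (simp add: psubset_card_mono)
  qed
  have surj: "?r ` S = {..<card S}"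
    by (rule card_subset_eq[OF _ less]) (simp_all add: card_image[OF inj])
  have injC: "inj_on ?r C" by (rule inj_on_subset[OF inj]) (auto simp: C_def)
  have "?r ` C \<subseteq> {..<k}" by (auto simp: C_def)
  then have "card (?r ` C) \<le> card {..<k}" by (rule card_mono[rotated]) simp
  then show "card C \<le> k" by (simp add: card_image[OF injC])
  assume x: "x \<in> S" "x \<notin> C"
  then have "k \<le> ?r x" by (simp add: C_def)
  moreover have "?r x < card S" using less x by auto
  ultimately have "{..<k} \<subseteq> ?r ` S" unfolding surj by auto
  then have "{..<k} \<subseteq> ?r ` C" by (auto simp: C_def)
  then have "card {..<k} \<le> card (?r ` C)" by (rule card_mono[rotated]) (use assms in \<open>simp add: C_def\<close>)
  then show "k \<le> card C" by (simp add: card_image[OF injC])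
qed

text \<open>A node selects alone and in port order, at most \<open>k\<close> ports for each
  combination of side and key. With the class as key, its half-nodes select independently of each
  other.\<close>

definition pick :: "nat \<Rightarrow> ('s \<Rightarrow> 'c) \<Rightarrow> (bool \<times> 's \<Rightarrow> bool) \<Rightarrow> 's port_view \<Rightarrow> nat \<Rightarrow> bool" where
  "pick k g Q L i \<longleftrightarrow> Q (L ! i) \<and>
     card {j. j < i \<and> Q (L ! j) \<and> fst (L ! j) = fst (L ! i) \<and> g (snd (L ! j)) = g (snd (L ! i))} < k"

definition picked :: "network \<Rightarrow> nat \<Rightarrow> ('s \<Rightarrow> 'c) \<Rightarrow> (bool \<times> 's \<Rightarrow> bool) \<Rightarrow> (nat set \<Rightarrow> 's) \<Rightarrow> nat set \<Rightarrow> bool \<Rightarrow> bool" where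
  "picked N k g Q \<sigma> e b = pick k g Q (view N \<sigma> (endp N e b)) (port N e b)"

text \<open>The class is part of the half-node, so all classes together form one bipartite graph on
  the whole edge set and are split simultaneously.\<close>

definition halfnode :: "network \<Rightarrow> (nat set \<Rightarrow> 'c) \<Rightarrow> nat set \<Rightarrow> bool \<Rightarrow> nat \<times> bool \<times> 'c" where
  "halfnode N \<kappa> e b = (endp N e b, b, \<kappa> e)"

context net
begin

lemma card_ports:
  assumes "v \<in> nodes N"
  shows "card {i. i < deg N v \<and> side N v i = b \<and> R (link N v i)} = card {e \<in> E. endp N e b = v \<and> R e}"
proof (rule bij_betw_same_card[where f = "link N v"], rule bij_betw_byWitness[where f' = "\<lambda>e. port N e b"])
  show "\<forall>i\<in>{i. i < deg N v \<and> side N v i = b \<and> R (link N v i)}. port N (link N v i) b = i"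
    using link_props(4)[OF assms] by auto
  show "\<forall>e\<in>{e \<in> E. endp N e b = v \<and> R e}. link N v (port N e b) = e"
    using port_props(3) by auto
  show "link N v ` {i. i < deg N v \<and> side N v i = b \<and> R (link N v i)} \<subseteq> {e \<in> E. endp N e b = v \<and> R e}"
    using link_props(1,2)[OF assms] by auto
  show "(\<lambda>e. port N e b) ` {e \<in> E. endp N e b = v \<and> R e} \<subseteq> {i. i < deg N v \<and> side N v i = b \<and> R (link N v i)}"
    using port_props by auto
qed

text \<open>These are the two facts that the stages need of a selection: no node exceeds its quota,
  and a node that refuses an eligible edge has exhausted it.\<close>

lemma picked_props:
  shows picked_sat: "picked N k g Q \<sigma> e b \<Longrightarrow> e \<in> E \<Longrightarrow> Q (b, \<sigma> e)"
    and card_picked_le: "card {e \<in> E. endp N e b = v \<and> g (\<sigma> e) = c \<and> picked N k g Q \<sigma> e b} \<le> k"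
    and card_picked_ge: "e \<in> E \<Longrightarrow> Q (b, \<sigma> e) \<Longrightarrow> \<not> picked N k g Q \<sigma> e b \<Longrightarrow>
      k \<le> card {e' \<in> E. endp N e' b = endp N e b \<and> g (\<sigma> e') = g (\<sigma> e) \<and> picked N k g Q \<sigma> e' b}"
proof -
  show "Q (b, \<sigma> e)" if "picked N k g Q \<sigma> e b" "e \<in> E" for e
    using that port_props[OF that(2)] unfolding picked_def pick_def by simp
  define S where "S v c = {i. i < deg N v \<and> side N v i = b \<and> g (\<sigma> (link N v i)) = c \<and> Q (b, \<sigma> (link N v i))}" for v c
  have pick_iff: "pick k g Q (view N \<sigma> v) i \<longleftrightarrow> i \<in> S v c \<and> card {j \<in> S v c. j < i} < k"
    if "i < deg N v" "side N v i = b" "g (\<sigma> (link N v i)) = c" for v i c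
  proof -
    have "{j. j < i \<and> Q (view N \<sigma> v ! j) \<and> fst (view N \<sigma> v ! j) = fst (view N \<sigma> v ! i) \<and>
            g (snd (view N \<sigma> v ! j)) = g (snd (view N \<sigma> v ! i))} = {j \<in> S v c. j < i}"
      using that by (auto simp: S_def)
    then show ?thesis using that unfolding pick_def by (auto simp: S_def)
  qed
  have eq: "card {e \<in> E. endp N e b = v \<and> g (\<sigma> e) = c \<and> picked N k g Q \<sigma> e b} =
            card {i \<in> S v c. card {j \<in> S v c. j < i} < k}" if v: "v \<in> nodes N" for v c
  proof -
    have "card {e \<in> E. endp N e b = v \<and> g (\<sigma> e) = c \<and> picked N k g Q \<sigma> e b} =
      card {i. i < deg N v \<and> side N v i = b \<and> g (\<sigma> (link N v i)) = c \<and> picked N k g Q \<sigma> (link N v i) b}"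
      by (rule card_ports[OF v, symmetric])
    also have "{i. i < deg N v \<and> side N v i = b \<and> g (\<sigma> (link N v i)) = c \<and> picked N k g Q \<sigma> (link N v i) b} =
      {i \<in> S v c. card {j \<in> S v c. j < i} < k}"
    proof (rule set_eqI)
      fix i
      show "i \<in> {i. i < deg N v \<and> side N v i = b \<and> g (\<sigma> (link N v i)) = c \<and> picked N k g Q \<sigma> (link N v i) b} \<longleftrightarrow>
            i \<in> {i \<in> S v c. card {j \<in> S v c. j < i} < k}"
      proof (cases "i < deg N v \<and> side N v i = b \<and> g (\<sigma> (link N v i)) = c")
        case True
        then have "picked N k g Q \<sigma> (link N v i) b \<longleftrightarrow> pick k g Q (view N \<sigma> v) i"
          using link_props[OF v, of i] unfolding picked_def by auto
        then show ?thesis using True pick_iff[of i v c] by auto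
      next
        case False
        then show ?thesis by (auto simp: S_def)
      qed
    qed
    finally show ?thesis .
  qed
  have finS: "finite (S v c)" for v c by (simp add: S_def)
  show "card {e \<in> E. endp N e b = v \<and> g (\<sigma> e) = c \<and> picked N k g Q \<sigma> e b} \<le> k"
  proof (cases "v \<in> nodes N")
    case True
    then show ?thesis using card_initial_segment(1)[OF finS] by (simp add: eq)
  next
    case False
    then have "{e \<in> E. endp N e b = v \<and> g (\<sigma> e) = c \<and> picked N k g Q \<sigma> e b} = {}" using endp_node by auto
    then show ?thesis by (simp only: card.empty)
  qed
  assume e: "e \<in> E" and Q: "Q (b, \<sigma> e)" and np: "\<not> picked N k g Q \<sigma> e b"
  let ?v = "endp N e b" and ?i = "port N e b" and ?c = "g (\<sigma> e)"
  have "?i \<in> S ?v ?c" using port_props[OF e] Q by (simp add: S_def)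
  moreover have "?i \<notin> {i \<in> S ?v ?c. card {j \<in> S ?v ?c. j < i} < k}"
    using np pick_iff[of ?i ?v ?c] port_props[OF e, of b] unfolding picked_def by auto
  ultimately show "k \<le> card {e' \<in> E. endp N e' b = ?v \<and> g (\<sigma> e') = ?c \<and> picked N k g Q \<sigma> e' b}"
    unfolding eq[OF endp_node[OF e]] by (rule card_initial_segment(2)[OF finS])
qed

lemma halfnode_eq: "(\<exists>b'. halfnode N \<kappa> e b' = (v, b, c) \<and> R b') \<longleftrightarrow> endp N e b = v \<and> \<kappa> e = c \<and> R b"
  by (auto simp: halfnode_def)

lemma inc_halfnode: "inc E (halfnode N \<kappa>) (v, b, c) = card {e \<in> E. endp N e b = v \<and> \<kappa> e = c}"
  unfolding inc_def by (rule arg_cong[where f = card]) (auto simp: halfnode_def)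

lemma indeg_halfnode: "indeg E (halfnode N \<kappa>) r (v, b, c) =
    card {e \<in> E. endp N e b = v \<and> \<kappa> e = c \<and> r e = Some b}"
  unfolding indeg_def halfnode_eq ..

lemma inc_halfnode_le: "inc E (halfnode N \<kappa>) w \<le> \<Delta>"
proof -
  obtain v b c where w: "w = (v, b, c)" by (metis prod.collapse)
  show ?thesis
  proof (cases "v \<in> nodes N")
    case True
    have "inc E (halfnode N \<kappa>) w = card {i. i < deg N v \<and> side N v i = b \<and> \<kappa> (link N v i) = c}"
      unfolding w inc_halfnode by (rule card_ports[OF True, symmetric])
    also have "\<dots> \<le> card {..<deg N v}" by (rule card_mono) auto
    finally show ?thesis using deg_le_max[OF True] by simp
  next
    case False
    then have "{e \<in> E. endp N e b = v \<and> \<kappa> e = c} = {}" using endp_node by auto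
    then show ?thesis unfolding w inc_halfnode by (simp only: card.empty)
  qed
qed

lemma bip_graph_halfnode:
  assumes "\<And>e. e \<in> E \<Longrightarrow> inc E (halfnode N \<kappa>) (halfnode N \<kappa> e False) +
    inc E (halfnode N \<kappa>) (halfnode N \<kappa> e True) \<le> D"
  shows "bip_graph E (halfnode N \<kappa>) D \<Delta>"
  by unfold_locales (use finite_edges assms inc_halfnode_le in \<open>auto simp: halfnode_def\<close>)

end

section \<open>The program that splits all classes\<close>

text \<open>
  \<open>hgt\<close> holds the heights of both ends at the beginning of the stage, \<open>cnt\<close> the numbers of phases in
  which they have been full since then; \<open>used\<close> marks the edges flipped in the stage, \<open>prp\<close> those
  proposed in the phase. All that a node needs to remember can be read off its edges.
\<close>

record estate =
  ids :: "bool \<Rightarrow> nat"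
  cls :: "bool list"
  ori :: "bool option"
  hgt :: "bool \<Rightarrow> nat"
  cnt :: "bool \<Rightarrow> nat"
  used :: bool
  ful :: "bool \<Rightarrow> bool"
  prp :: bool

definition height_msg :: "nat \<Rightarrow> estate port_view \<Rightarrow> nat \<Rightarrow> nat" where
  "height_msg \<Delta> L i =
     2 * card {j. j < length L \<and> fst (L ! j) = fst (L ! i) \<and> cls (snd (L ! j)) = cls (snd (L ! i)) \<and>
                  ori (snd (L ! j)) = Some (fst (L ! i))} + \<Delta> -
     card {j. j < length L \<and> fst (L ! j) = fst (L ! i) \<and> cls (snd (L ! j)) = cls (snd (L ! i))}"

text \<open>Ties go to the upper end. Both heights belong to the shared edge state, so both ends
  decide alike.\<close>

definition low :: "estate \<Rightarrow> bool" where
  "low s \<longleftrightarrow> hgt s True \<le> hgt s False"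

definition height_step :: "nat \<Rightarrow> estate step" where
  "height_step \<Delta> = \<lparr>msg = height_msg \<Delta>, upd = \<lambda>s m. s\<lparr>hgt := m, cnt := \<lambda>_. 0, used := False\<rparr>\<rparr>"

definition accept_step :: "nat \<Rightarrow> estate step" where
  "accept_step k =
     \<lparr>msg = \<lambda>L i. of_bool (pick k cls (\<lambda>(b, s). ori s = None \<and> low s = b) L i),
      upd = \<lambda>s m. if 0 < m False \<or> 0 < m True then s\<lparr>ori := Some (low s)\<rparr> else s\<rparr>"

definition full_step :: "nat \<Rightarrow> nat \<Rightarrow> nat \<Rightarrow> estate step" where
  "full_step \<Delta> a d =
     \<lparr>msg = \<lambda>L i. case L ! i of (b, s) \<Rightarrow> of_bool (hgt s b + 2 * (d * cnt s b + a + d) \<le> height_msg \<Delta> L i),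
      upd = \<lambda>s m. s\<lparr>ful := \<lambda>b. 0 < m b, cnt := \<lambda>b. cnt s b + m b\<rparr>\<rparr>"

definition movable :: "nat \<Rightarrow> nat \<Rightarrow> bool \<times> estate \<Rightarrow> bool" where
  "movable k a = (\<lambda>(b, s). ori s = Some b \<and> \<not> used s \<and> hgt s (\<not> b) + 2 * (k + 4 * a) \<le> hgt s b \<and> ful s b \<and> \<not> ful s (\<not> b))"

definition propose_step :: "nat \<Rightarrow> nat \<Rightarrow> estate step" where
  "propose_step k a =
     \<lparr>msg = \<lambda>L i. of_bool (pick a cls (movable k a) L i), upd = \<lambda>s m. s\<lparr>prp := 0 < m False \<or> 0 < m True\<rparr>\<rparr>"

text \<open>Acceptance is decided by the tail of the edge, which becomes its new head.\<close>

definition move_step :: "nat \<Rightarrow> estate step" where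
  "move_step a =
     \<lparr>msg = \<lambda>L i. of_bool (pick a cls (\<lambda>(b, s). prp s \<and> ori s = Some (\<not> b)) L i),
      upd = \<lambda>s m. if 0 < m False \<or> 0 < m True then s\<lparr>ori := map_option Not (ori s), used := True\<rparr> else s\<rparr>"

text \<open>Extending the class name by the orientation separates the edges that enter a half-node
  from those that leave it.\<close>

definition close_step :: "estate step" where
  "close_step = \<lparr>msg = \<lambda>_ _. 0, upd = \<lambda>s _. s\<lparr>cls := cls s @ [the (ori s)], ori := None\<rparr>\<rparr>"

definition game_steps :: "nat \<Rightarrow> nat \<Rightarrow> nat \<Rightarrow> nat \<Rightarrow> estate step list" where
  "game_steps \<Delta> k a d = [full_step \<Delta> a d, propose_step k a, move_step a]"

definition stage_steps :: "nat \<Rightarrow> nat \<Rightarrow> nat \<Rightarrow> nat \<Rightarrow> nat \<Rightarrow> estate step list" where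
  "stage_steps \<Delta> k a d P = [height_step \<Delta>, accept_step k] @ concat (replicate P (game_steps \<Delta> k a d))"

definition level_steps :: "nat \<Rightarrow> nat \<Rightarrow> nat \<Rightarrow> nat \<Rightarrow> nat \<Rightarrow> nat \<Rightarrow> estate step list" where
  "level_steps \<Delta> k a d P I = concat (replicate I (stage_steps \<Delta> k a d P)) @ [close_step]"

lemma exec_append: "exec N (xs @ ys) \<sigma> = exec N ys (exec N xs \<sigma>)"
  by (simp add: exec_def)

lemma exec_Cons: "exec N (x # xs) \<sigma> = exec N xs (run_step N x \<sigma>)"
  by (simp add: exec_def)

lemma exec_Nil: "exec N [] \<sigma> = \<sigma>"
  by (simp add: exec_def)

lemma exec_replicate_Suc: "exec N (concat (replicate (Suc i) xs)) \<sigma> = exec N xs (exec N (concat (replicate i xs)) \<sigma>)"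
  by (induction i arbitrary: \<sigma>) (simp_all add: exec_append exec_Nil)

context net
begin

abbreviation "nd \<sigma> \<equiv> halfnode N (\<lambda>e. cls (\<sigma> e))"

lemma sent_height:
  assumes "e \<in> E"
  shows "height_msg \<Delta> (view N \<sigma> (endp N e b)) (port N e b) = height E (nd \<sigma>) \<Delta> (\<lambda>e. ori (\<sigma> e)) (nd \<sigma> e b)"
proof -
  let ?v = "endp N e b" and ?i = "port N e b"
  let ?L = "view N \<sigma> ?v"
  note v = endp_node[OF assms, of b]
  have i: "?L ! ?i = (b, \<sigma> e)" using port_props[OF assms, of b] by simp
  have nd: "nd \<sigma> e b = (?v, b, cls (\<sigma> e))" by (simp add: halfnode_def)
  have "{j. j < length ?L \<and> fst (?L ! j) = fst (?L ! ?i) \<and> cls (snd (?L ! j)) = cls (snd (?L ! ?i)) \<and> ori (snd (?L ! j)) = Some (fst (?L ! ?i))}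
    = {j. j < deg N ?v \<and> side N ?v j = b \<and> (cls (\<sigma> (link N ?v j)) = cls (\<sigma> e) \<and> ori (\<sigma> (link N ?v j)) = Some b)}"
    unfolding i by auto
  then have 1: "card {j. j < length ?L \<and> fst (?L ! j) = fst (?L ! ?i) \<and> cls (snd (?L ! j)) = cls (snd (?L ! ?i)) \<and> ori (snd (?L ! j)) = Some (fst (?L ! ?i))}
    = indeg E (nd \<sigma>) (\<lambda>e. ori (\<sigma> e)) (nd \<sigma> e b)"
    unfolding nd indeg_halfnode card_ports[OF v, symmetric] by (rule arg_cong)
  have "{j. j < length ?L \<and> fst (?L ! j) = fst (?L ! ?i) \<and> cls (snd (?L ! j)) = cls (snd (?L ! ?i))}
    = {j. j < deg N ?v \<and> side N ?v j = b \<and> cls (\<sigma> (link N ?v j)) = cls (\<sigma> e)}"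
    unfolding i by auto
  then have 2: "card {j. j < length ?L \<and> fst (?L ! j) = fst (?L ! ?i) \<and> cls (snd (?L ! j)) = cls (snd (?L ! ?i))}
    = inc E (nd \<sigma>) (nd \<sigma> e b)"
    unfolding nd inc_halfnode card_ports[OF v, symmetric] by (rule arg_cong)
  show ?thesis unfolding height_msg_def height_def 1 2 ..
qed

lemma inc_cong: "(\<And>e. e \<in> E \<Longrightarrow> \<kappa> e = \<kappa>' e) \<Longrightarrow> inc E (halfnode N \<kappa>) w = inc E (halfnode N \<kappa>') w"
  unfolding inc_def halfnode_def by (rule arg_cong[where f = card]) auto

lemma height_cong: "(\<And>e. e \<in> E \<Longrightarrow> \<kappa> e = \<kappa>' e) \<Longrightarrow> (\<And>e. e \<in> E \<Longrightarrow> r e = r' e) \<Longrightarrow>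
    height E (halfnode N \<kappa>) \<Delta> r w = height E (halfnode N \<kappa>') \<Delta> r' w"
proof -
  assume *: "\<And>e. e \<in> E \<Longrightarrow> \<kappa> e = \<kappa>' e" "\<And>e. e \<in> E \<Longrightarrow> r e = r' e"
  have "indeg E (halfnode N \<kappa>) r w = indeg E (halfnode N \<kappa>') r' w"
    unfolding indeg_def halfnode_def by (rule arg_cong[where f = card]) (use * in auto)
  then show ?thesis unfolding height_def using inc_cong[of \<kappa> \<kappa>' w] * by simp
qed

lemma halfnode_cong: "\<kappa> e = \<kappa>' e \<Longrightarrow> halfnode N \<kappa> e b = halfnode N \<kappa>' e b"
  by (simp add: halfnode_def)

lemma balanced_cong:
  assumes "\<And>e. e \<in> E \<Longrightarrow> \<kappa> e = \<kappa>' e"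
  shows "balanced E (halfnode N \<kappa>) \<Delta> X r \<longleftrightarrow> balanced E (halfnode N \<kappa>') \<Delta> X r"
proof -
  have "height E (halfnode N \<kappa>) \<Delta> r w = height E (halfnode N \<kappa>') \<Delta> r w" for w
    by (rule height_cong) (use assms in auto)
  moreover have "halfnode N \<kappa> e b = halfnode N \<kappa>' e b" if "e \<in> E" for e b
    by (rule halfnode_cong) (use assms that in auto)
  ultimately show ?thesis unfolding balanced_def by simp
qed

lemma bip_graph_cong:
  assumes "bip_graph E (halfnode N \<kappa>) D \<Delta>" "\<And>e. e \<in> E \<Longrightarrow> \<kappa> e = \<kappa>' e"
  shows "bip_graph E (halfnode N \<kappa>') D \<Delta>"
proof (rule bip_graph_halfnode)
  fix e assume e: "e \<in> E"
  have "inc E (halfnode N \<kappa>') w = inc E (halfnode N \<kappa>) w" for w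
    by (rule inc_cong) (use assms in auto)
  moreover have "halfnode N \<kappa>' e b = halfnode N \<kappa> e b" for b
    by (rule halfnode_cong) (use assms e in auto)
  ultimately show "inc E (halfnode N \<kappa>') (halfnode N \<kappa>' e False) +
      inc E (halfnode N \<kappa>') (halfnode N \<kappa>' e True) \<le> D"
    using bip_graph.deg_sum[OF assms(1) e] by simp
qed

end

section \<open>One stage of the program as an instance of the abstract stage\<close>

locale split_stage = net q N for q N +
  fixes \<sigma> :: "nat set \<Rightarrow> estate" and D k a d P :: nat
  assumes bip: "bip_graph (edges N) (nd \<sigma>) D (max_deg N)"
    and a_pos: "0 < a" and a_le: "a \<le> D" and d_small: "3 * d * D^2 \<le> a^3" and d_le: "d \<le> a"
    and P_big: "k \<le> P * d" and P_small: "P * d \<le> k + d"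
begin

abbreviation "hn \<equiv> nd \<sigma>"
abbreviation "acceptable \<equiv> \<lambda>(b, s). ori s = None \<and> low s = b"
abbreviation "receivable \<equiv> \<lambda>(b, s). prp s \<and> ori s = Some (\<not> b)"

definition "h = height E hn \<Delta> (\<lambda>e. ori (\<sigma> e))"
definition "S1 = run_step N (height_step \<Delta>) \<sigma>"
definition "S2 = run_step N (accept_step k) S1"
definition "S p = exec N (concat (replicate p (game_steps \<Delta> k a d))) S2"
definition "F p = run_step N (full_step \<Delta> a d) (S p)"
definition "R p = run_step N (propose_step k a) (F p)"
definition "lw e = low (S1 e)"
definition "A = {e \<in> E. \<exists>b. picked N k cls acceptable S1 e b}"
definition "r1 e = ori (S2 e)"
definition "U p = {e \<in> E. used (S p e)}"
definition "Prp p = {e \<in> E. prp (R p e)}"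
definition "H = {e \<in> E. \<exists>b. r1 e = Some b \<and> h (hn e (\<not> b)) + 2 * (k + 4 * a) \<le> h (hn e b)}"

text \<open>The counters are defined on all half-nodes and not read off the edge states, because the
  abstract stage speaks about every node.\<close>

primrec c :: "nat \<Rightarrow> nat \<times> bool \<times> bool list \<Rightarrow> nat" where
  "c 0 w = 0"
| "c (Suc p) w = c p w + of_bool (h w + 2 * (d * c p w + a + d) \<le> height E hn \<Delta> (\<lambda>e. ori (S p e)) w)"

definition "full p w \<longleftrightarrow> h w + 2 * (d * c p w + a + d) \<le> height E hn \<Delta> (\<lambda>e. ori (S p e)) w"

lemma S_0: "S 0 = S2"
  by (simp add: S_def exec_Nil)

lemma S_Suc: "S (Suc p) = run_step N (move_step a) (R p)"
  unfolding S_def R_def F_def exec_replicate_Suc by (simp add: game_steps_def exec_Cons exec_Nil)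

lemma S1_simps:
  "cls (S1 e) = cls (\<sigma> e)" "ori (S1 e) = ori (\<sigma> e)" "used (S1 e) = False" "cnt (S1 e) b = 0"
  "e \<in> E \<Longrightarrow> hgt (S1 e) b = h (hn e b)"
  using sent_height[of e \<sigma> b] by (simp_all add: S1_def run_step_def height_step_def sent_def h_def)

lemma lw: "e \<in> E \<Longrightarrow> lw e \<longleftrightarrow> h (hn e True) \<le> h (hn e False)"
  by (simp add: lw_def low_def S1_simps)

lemma picked_accept: "e \<in> E \<Longrightarrow> picked N k cls acceptable S1 e b \<Longrightarrow> ori (\<sigma> e) = None \<and> lw e = b"
  using picked_sat[of k cls acceptable S1 e b] by (auto simp: S1_simps lw_def)

lemma S2_simps:
  assumes "e \<in> E"
  shows "cls (S2 e) = cls (\<sigma> e)" "used (S2 e) = False" "cnt (S2 e) b = 0" "hgt (S2 e) b = h (hn e b)"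
    "r1 e = (if e \<in> A then Some (lw e) else ori (\<sigma> e))"
  using S1_simps assms
  by (auto simp: S2_def run_step_def accept_step_def sent_def picked_def[symmetric] r1_def A_def lw_def all_bool_eq ex_bool_eq)

lemma A_sub: "A \<subseteq> {e \<in> E. ori (\<sigma> e) = None}"
  using picked_accept by (auto simp: A_def)

lemma card_A: "card {e \<in> A. hn e (lw e) = w} \<le> k"
proof -
  obtain v b \<kappa> where w: "w = (v, b, \<kappa>)" by (metis prod.collapse)
  have "{e \<in> A. hn e (lw e) = w} \<subseteq> {e \<in> E. endp N e b = v \<and> cls (S1 e) = \<kappa> \<and> picked N k cls acceptable S1 e b}"
    using picked_accept by (auto simp: A_def w halfnode_def S1_simps)
  then have "card {e \<in> A. hn e (lw e) = w} \<le> card {e \<in> E. endp N e b = v \<and> cls (S1 e) = \<kappa> \<and> picked N k cls acceptable S1 e b}"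
    by (rule card_mono[rotated]) (simp add: finite_edges)
  then show ?thesis using card_picked_le[of b v cls S1 \<kappa> k acceptable] by linarith
qed

lemma A_max:
  assumes "e \<in> E" "ori (\<sigma> e) = None" "e \<notin> A"
  shows "k \<le> card {e' \<in> A. hn e' (lw e') = hn e (lw e)}"
proof -
  have "k \<le> card {e' \<in> E. endp N e' (lw e) = endp N e (lw e) \<and> cls (S1 e') = cls (S1 e) \<and> picked N k cls acceptable S1 e' (lw e)}"
    by (rule card_picked_ge) (use assms in \<open>auto simp: A_def S1_simps lw_def\<close>)
  also have "\<dots> \<le> card {e' \<in> A. hn e' (lw e') = hn e (lw e)}"
    by (rule card_mono) (use finite_edges picked_accept in \<open>auto simp: A_def halfnode_def S1_simps\<close>)
  finally show ?thesis .
qed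

lemma F_simps:
  "cls (F p e) = cls (S p e)" "ori (F p e) = ori (S p e)" "used (F p e) = used (S p e)" "hgt (F p e) = hgt (S p e)"
  by (simp_all add: F_def run_step_def full_step_def)

lemma R_simps:
  "cls (R p e) = cls (S p e)" "ori (R p e) = ori (S p e)" "used (R p e) = used (S p e)" "hgt (R p e) = hgt (S p e)"
  "cnt (R p e) = cnt (F p e)" "prp (R p e) \<longleftrightarrow> (\<exists>b. picked N a cls (movable k a) (F p) e b)"
  by (simp_all add: R_def F_simps run_step_def propose_step_def sent_def picked_def[symmetric] ex_bool_eq disj_commute)

lemma S_Suc_eq: "S (Suc p) e = (if \<exists>b. picked N a cls receivable (R p) e b
    then (R p e)\<lparr>ori := map_option Not (ori (R p e)), used := True\<rparr> else R p e)"
  by (simp add: S_Suc run_step_def move_step_def sent_def picked_def[symmetric] ex_bool_eq disj_commute)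

lemma cls_S: "e \<in> E \<Longrightarrow> cls (S p e) = cls (\<sigma> e)"
  by (induction p) (simp_all add: S_0 S2_simps S_Suc_eq R_simps)

lemma full_step_eq:
  assumes "e \<in> E" and inv: "\<And>b. hgt (S p e) b = h (hn e b) \<and> cnt (S p e) b = c p (hn e b)"
  shows "ful (F p e) b = full p (hn e b) \<and> cnt (F p e) b = c (Suc p) (hn e b)"
proof -
  have "height_msg \<Delta> (view N (S p) (endp N e b)) (port N e b) = height E hn \<Delta> (\<lambda>e. ori (S p e)) (nd (S p) e b)"
    unfolding sent_height[OF assms(1)] by (rule height_cong) (auto simp: cls_S)
  also have "nd (S p) e b = hn e b" using cls_S[OF assms(1)] by (simp add: halfnode_def)
  finally have eqH: "height_msg \<Delta> (view N (S p) (endp N e b)) (port N e b) = height E hn \<Delta> (\<lambda>e. ori (S p e)) (hn e b)" .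
  have vp: "view N (S p) (endp N e b) ! port N e b = (b, S p e)"
    using port_props[OF assms(1), of b] by simp
  have "sent N (full_step \<Delta> a d) (S p) e b = of_bool (full p (hn e b))"
    unfolding sent_def full_step_def full_def by (simp only: step.select_convs vp prod.case eqH inv)
  then show ?thesis using inv[of b]
    by (simp add: F_def run_step_def full_step_def full_def)
qed

text \<open>An edge moves only if it was proposed, and it is proposed only if it was not yet used.
  Each edge thus flips at most once, and its orientation is determined by \<open>r1\<close> and
  membership in \<open>U p\<close>.\<close>

lemma invariant:
  assumes "e \<in> E"
  shows "(\<forall>b. hgt (S p e) b = h (hn e b) \<and> cnt (S p e) b = c p (hn e b)) \<and>
    ori (S p e) = (if e \<in> U p then map_option Not (r1 e) else r1 e)"
proof (induction p)
  case 0
  then show ?case using S2_simps[OF assms] by (simp add: S_0 U_def r1_def)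
next
  case (Suc p)
  then have IH: "\<And>b. hgt (S p e) b = h (hn e b) \<and> cnt (S p e) b = c p (hn e b)" 
    "ori (S p e) = (if e \<in> U p then map_option Not (r1 e) else r1 e)" by auto
  note full = full_step_eq[OF assms IH(1)]
  show ?case
  proof (cases "\<exists>b. picked N a cls receivable (R p) e b")
    case True
    then obtain b0 where b0: "picked N a cls receivable (R p) e b0" by blast
    then have "prp (R p e)" using picked_sat[of a cls receivable "R p" e b0] assms by auto
    then obtain b where "picked N a cls (movable k a) (F p) e b" unfolding R_simps by blast
    then have "\<not> used (S p e)" using picked_sat[of a cls "movable k a" "F p" e b] assms by (auto simp: movable_def F_simps)
    then have "e \<notin> U p" by (simp add: U_def)
    moreover have "S (Suc p) e = (R p e)\<lparr>ori := map_option Not (ori (R p e)), used := True\<rparr>"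
      unfolding S_Suc_eq using True by (simp only: if_True)
    moreover from this have "e \<in> U (Suc p)" using assms by (simp add: U_def)
    ultimately show ?thesis using IH full by (simp add: R_simps del: c.simps)
  next
    case False
    then have eq: "S (Suc p) e = R p e" unfolding S_Suc_eq by (simp only: if_False)
    then have "e \<in> U (Suc p) \<longleftrightarrow> e \<in> U p" by (simp add: U_def R_simps)
    then show ?thesis using IH full by (simp add: eq R_simps del: c.simps)
  qed
qed

lemma ful_F: "e \<in> E \<Longrightarrow> ful (F p e) b = full p (hn e b)"
  using full_step_eq invariant by blast

lemma movable_iff: "e \<in> E \<Longrightarrow> movable k a (b, F p e) \<longleftrightarrow>
    e \<in> H - U p \<and> r1 e = Some b \<and> full p (hn e b) \<and> \<not> full p (hn e (\<not> b))"
  using invariant[of e p] ful_F[of e p] by (auto simp: movable_def F_simps H_def U_def)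

lemma PrpD:
  assumes "e \<in> Prp p"
  shows "e \<in> H - U p" "e \<in> E" "full p (hn e (the (r1 e)))" "\<not> full p (hn e (\<not> the (r1 e)))"
    "picked N a cls (movable k a) (F p) e (the (r1 e))" "ori (R p e) = r1 e" "r1 e \<noteq> None"
proof -
  show e: "e \<in> E" using assms by (simp add: Prp_def)
  obtain b where b: "picked N a cls (movable k a) (F p) e b" using assms by (auto simp: Prp_def R_simps)
  then have "movable k a (b, F p e)" using picked_sat[of a cls "movable k a" "F p" e b] e by simp
  then have *: "e \<in> H - U p \<and> r1 e = Some b \<and> full p (hn e b) \<and> \<not> full p (hn e (\<not> b))"
    unfolding movable_iff[OF e] .
  then show "e \<in> H - U p" "full p (hn e (the (r1 e)))" "\<not> full p (hn e (\<not> the (r1 e)))"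
    "picked N a cls (movable k a) (F p) e (the (r1 e))" "r1 e \<noteq> None" using b by auto
  show "ori (R p e) = r1 e" using invariant[OF e, of p] * by (auto simp: R_simps)
qed

lemma U_Suc_iff: "e \<in> U (Suc p) \<longleftrightarrow> e \<in> U p \<or> e \<in> E \<and> (\<exists>b. picked N a cls receivable (R p) e b)"
  by (auto simp: U_def S_Suc_eq R_simps)

lemma picked_move:
  assumes "e \<in> E" "picked N a cls receivable (R p) e b"
  shows "e \<in> Prp p" "b = (\<not> the (r1 e))"
proof -
  have "prp (R p e) \<and> ori (R p e) = Some (\<not> b)" using picked_sat[of a cls receivable "R p" e b] assms by auto
  then show 1: "e \<in> Prp p" using assms by (simp add: Prp_def)
  then have "r1 e = Some (\<not> b)" using PrpD(6)[of e p] \<open>prp (R p e) \<and> ori (R p e) = Some (\<not> b)\<close> by simp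
  then show "b = (\<not> the (r1 e))" by simp
qed

lemma moved_iff: "e \<in> U (Suc p) - U p \<longleftrightarrow> e \<in> E \<and> (\<exists>b. picked N a cls receivable (R p) e b)"
  using picked_move(1)[of e] PrpD(1)[of e p] U_Suc_iff[of e p] by blast

text \<open>A movable edge is picked at the end it points to; this turns the quota per side and
  class into a quota per source half-node. The lemma after it does the same for
  destinations.\<close>

lemma cls_picked:
  "{e \<in> E. endp N e b = v \<and> cls (F p e) = \<kappa> \<and> picked N a cls (movable k a) (F p) e b} =
   {e \<in> Prp p. hn e (the (r1 e)) = (v, b, \<kappa>)}"
proof (intro Collect_cong iffI)
  fix e assume e: "e \<in> E \<and> endp N e b = v \<and> cls (F p e) = \<kappa> \<and> picked N a cls (movable k a) (F p) e b"
  then have "movable k a (b, F p e)" using picked_sat[of a cls "movable k a" "F p" e b] by blast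
  then have "r1 e = Some b" using movable_iff[of e b p] e by blast
  moreover have "prp (R p e)" unfolding R_simps using e by blast
  ultimately show "e \<in> Prp p \<and> hn e (the (r1 e)) = (v, b, \<kappa>)"
    using e cls_S[of e p] by (simp add: Prp_def halfnode_def F_simps)
next
  fix e assume e: "e \<in> Prp p \<and> hn e (the (r1 e)) = (v, b, \<kappa>)"
  then have "e \<in> E" "picked N a cls (movable k a) (F p) e (the (r1 e))" "b = the (r1 e)"
    using PrpD(2,5)[of e p] by (auto simp: halfnode_def)
  then show "e \<in> E \<and> endp N e b = v \<and> cls (F p e) = \<kappa> \<and> picked N a cls (movable k a) (F p) e b"
    using e cls_S[of e p] by (simp add: halfnode_def F_simps)
qed

lemma cls_moved:
  "{e \<in> E. endp N e b = v \<and> cls (R p e) = \<kappa> \<and> picked N a cls receivable (R p) e b} =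
   {e \<in> U (Suc p) - U p. hn e (\<not> the (r1 e)) = (v, b, \<kappa>)}"
proof (intro Collect_cong iffI)
  fix e assume e: "e \<in> E \<and> endp N e b = v \<and> cls (R p e) = \<kappa> \<and> picked N a cls receivable (R p) e b"
  then have "b = (\<not> the (r1 e))" using picked_move(2) by blast
  moreover have "e \<in> U (Suc p) - U p" unfolding moved_iff using e by blast
  ultimately show "e \<in> U (Suc p) - U p \<and> hn e (\<not> the (r1 e)) = (v, b, \<kappa>)"
    using e cls_S[of e p] by (simp add: halfnode_def R_simps)
next
  fix e assume e: "e \<in> U (Suc p) - U p \<and> hn e (\<not> the (r1 e)) = (v, b, \<kappa>)"
  then obtain b' where b': "e \<in> E" "picked N a cls receivable (R p) e b'" unfolding moved_iff by blast
  then have "b' = b" using picked_move(2)[OF b'] e by (simp add: halfnode_def)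
  then show "e \<in> E \<and> endp N e b = v \<and> cls (R p e) = \<kappa> \<and> picked N a cls receivable (R p) e b"
    using e b' cls_S[of e p] by (auto simp: halfnode_def R_simps)
qed

sublocale orient: orient_stage E hn D \<Delta> "\<lambda>e. ori (\<sigma> e)" A k a d P U Prp full c h lw r1 "\<lambda>p e. ori (S p e)" H
proof -
  interpret bip_graph E hn D \<Delta> by (rule bip)
  show "orient_stage E hn D \<Delta> (\<lambda>e. ori (\<sigma> e)) A k a d P U Prp full c h lw r1 (\<lambda>p e. ori (S p e)) H"
  proof unfold_locales
    show "h = height E hn \<Delta> (\<lambda>e. ori (\<sigma> e))" by (simp add: h_def)
    show "lw e = (h (hn e True) \<le> h (hn e False))" if "e \<in> E" for e using lw that by simp
    show "r1 e = (if e \<in> A then Some (lw e) else ori (\<sigma> e))" if "e \<in> E" for e using S2_simps(5)[OF that] by simp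
    show "ori (S p e) = (if e \<in> U p then map_option Not (r1 e) else r1 e)" if "e \<in> E" for p e using invariant[OF that] by blast
    show "A \<subseteq> {e \<in> E. ori (\<sigma> e) = None}" using A_sub by simp
    show "U 0 = {}" using S2_simps by (auto simp: U_def S_0)
    show "Prp p \<subseteq> {e \<in> H - U p. full p (hn e (the (r1 e))) \<and> \<not> full p (hn e (\<not> the (r1 e)))}" for p
      using PrpD by blast
    show "card {e \<in> Prp p. hn e (the (r1 e)) = w} \<le> a" for p w
      using card_picked_le[of "fst (snd w)" "fst w" cls "F p" "snd (snd w)" a "movable k a"] unfolding cls_picked by simp
    show "a \<le> card {e' \<in> Prp p. hn e' (the (r1 e')) = hn e (the (r1 e))}"
      if e: "e \<in> H - U p" "full p (hn e (the (r1 e)))" "\<not> full p (hn e (\<not> the (r1 e)))" "e \<notin> Prp p" for p e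
    proof -
      have eE: "e \<in> E" and "r1 e = Some (the (r1 e))" using e by (auto simp: H_def)
      then have "movable k a (the (r1 e), F p e)" using e movable_iff[OF eE, of "the (r1 e)" p] by auto
      moreover have "\<not> picked N a cls (movable k a) (F p) e (the (r1 e))" using e eE by (auto simp: Prp_def R_simps)
      ultimately show ?thesis
        using card_picked_ge[OF eE, of "movable k a" "the (r1 e)" "F p" a cls] unfolding cls_picked
        by (simp add: halfnode_def F_simps cls_S eE)
    qed
    show "U p \<subseteq> U (Suc p) \<and> U (Suc p) - U p \<subseteq> Prp p" for p
    proof
      show "U p \<subseteq> U (Suc p)" using U_Suc_iff by blast
      show "U (Suc p) - U p \<subseteq> Prp p"
      proof
        fix e assume "e \<in> U (Suc p) - U p"
        then show "e \<in> Prp p" unfolding moved_iff using picked_move(1) by blast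
      qed
    qed
    show "card {e \<in> U (Suc p) - U p. hn e (\<not> the (r1 e)) = w} \<le> a" for p w
      using card_picked_le[of "fst (snd w)" "fst w" cls "R p" "snd (snd w)" a receivable] unfolding cls_moved by simp
    show "a \<le> card {e' \<in> U (Suc p) - U p. hn e' (\<not> the (r1 e')) = hn e (\<not> the (r1 e))}"
      if e: "e \<in> Prp p - U (Suc p)" for p e
    proof -
      have eE: "e \<in> E" using e PrpD by blast
      have "receivable (\<not> the (r1 e), R p e)" using e PrpD(6,7)[of e p] by (auto simp: Prp_def)
      moreover have "\<not> picked N a cls receivable (R p) e (\<not> the (r1 e))" using e eE U_Suc_iff by blast
      ultimately show ?thesis
        using card_picked_ge[OF eE, of receivable "\<not> the (r1 e)" "R p" a cls] unfolding cls_moved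
        by (simp add: halfnode_def R_simps cls_S eE)
    qed
  qed (simp_all add: H_def card_A full_def a_pos a_le d_small d_le P_big P_small)
qed

lemma stage_eq: "exec N (stage_steps \<Delta> k a d P) \<sigma> = S P"
  by (simp add: stage_steps_def exec_Cons S_def S1_def S2_def)

lemma stage_result:
  defines "\<sigma>' \<equiv> exec N (stage_steps \<Delta> k a d P) \<sigma>"
  shows "\<exists>A lw. A \<subseteq> {e \<in> E. ori (\<sigma> e) = None} \<and>
     (\<forall>e\<in>E. ori (\<sigma>' e) = None \<longleftrightarrow> ori (\<sigma> e) = None \<and> e \<notin> A) \<and>
     (\<forall>e\<in>E. ori (\<sigma> e) = None \<longrightarrow> e \<notin> A \<longrightarrow> k \<le> card {e' \<in> A. hn e' (lw e') = hn e (lw e)})"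
    and "balanced E hn \<Delta> X (\<lambda>e. ori (\<sigma> e)) \<Longrightarrow> balanced E hn \<Delta> (max (4 * (k + 4 * a)) (X + 8 * a)) (\<lambda>e. ori (\<sigma>' e))"
    and "e \<in> E \<Longrightarrow> cls (\<sigma>' e) = cls (\<sigma> e)"
  unfolding \<sigma>'_def stage_eq
  using A_sub A_max orient.ori_None orient.balanced_ori[of X] cls_S[of e P] by blast+

end

section \<open>One level: all stages and the resulting halving of degrees\<close>

context net
begin

lemma split_level:
  fixes \<sigma> :: "nat set \<Rightarrow> estate"
  assumes bip: "bip_graph E (nd \<sigma>) D \<Delta>"
    and a_pos: "0 < a" and a_le: "a \<le> D" and d_small: "3 * d * D^2 \<le> a^3" and d_le: "d \<le> a"
    and P: "k \<le> P * d" "P * d \<le> k + d" and I: "D \<le> k * I"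
    and none: "\<And>e. e \<in> E \<Longrightarrow> ori (\<sigma> e) = None"
  defines "\<sigma>' \<equiv> exec N (level_steps \<Delta> k a d P I) \<sigma>"
  shows "bip_graph E (nd \<sigma>') ((D + (4 * (k + 4 * a) + 8 * a * I)) div 2) \<Delta>"
    and "e \<in> E \<Longrightarrow> ori (\<sigma>' e) = None"
    and "e \<in> E \<Longrightarrow> length (cls (\<sigma>' e)) = Suc (length (cls (\<sigma> e)))"
proof -
  define T where "T i = exec N (concat (replicate i (stage_steps \<Delta> k a d P))) \<sigma>" for i
  have T0: "T 0 = \<sigma>" by (simp add: T_def exec_Nil)
  have T_Suc: "T (Suc i) = exec N (stage_steps \<Delta> k a d P) (T i)" for i
    unfolding T_def by (rule exec_replicate_Suc)
  have split: "split_stage p N (T i) D k a d P" if "\<And>e. e \<in> E \<Longrightarrow> cls (T i e) = cls (\<sigma> e)" for i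
  proof (intro split_stage.intro split_stage_axioms.intro)
    show "net p N" by (rule net_axioms)
    show "bip_graph E (nd (T i)) D \<Delta>"
      by (rule bip_graph_cong[OF bip]) (use that in auto)
  qed (use a_pos a_le d_small d_le P in auto)
  have cls: "\<And>e. e \<in> E \<Longrightarrow> cls (T i e) = cls (\<sigma> e)" for i
  proof (induction i)
    case (Suc i)
    then show ?case using split_stage.stage_result(3)[OF split] by (simp add: T_Suc)
  qed (simp add: T0)
  note st = split[OF cls]
  have hn: "nd (T i) e b = nd \<sigma> e b" if "e \<in> E" for i e b
    by (rule halfnode_cong) (use cls that in auto)
  define Q where "Q i A lw \<longleftrightarrow> A \<subseteq> {e \<in> E. ori (T i e) = None} \<and>
     (\<forall>e\<in>E. ori (T (Suc i) e) = None \<longleftrightarrow> ori (T i e) = None \<and> e \<notin> A) \<and>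
     (\<forall>e\<in>E. ori (T i e) = None \<longrightarrow> e \<notin> A \<longrightarrow> k \<le> card {e' \<in> A. nd \<sigma> e' (lw e') = nd \<sigma> e (lw e)})" for i A lw
  have "\<forall>i. \<exists>A lw. Q i A lw"
  proof
    fix i
    obtain A lw where A: "A \<subseteq> {e \<in> E. ori (T i e) = None}"
      "\<forall>e\<in>E. ori (T (Suc i) e) = None \<longleftrightarrow> ori (T i e) = None \<and> e \<notin> A"
      "\<forall>e\<in>E. ori (T i e) = None \<longrightarrow> e \<notin> A \<longrightarrow> k \<le> card {e' \<in> A. nd (T i) e' (lw e') = nd (T i) e (lw e)}"
      using split_stage.stage_result(1)[OF st, of i] unfolding T_Suc by auto
    have "{e' \<in> A. nd (T i) e' (lw e') = nd (T i) e (lw e)} = {e' \<in> A. nd \<sigma> e' (lw e') = nd \<sigma> e (lw e)}"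
      if "e \<in> E" for e
      by (rule Collect_cong) (use A(1) hn that in auto)
    then have "\<forall>e\<in>E. ori (T i e) = None \<longrightarrow> e \<notin> A \<longrightarrow> k \<le> card {e' \<in> A. nd \<sigma> e' (lw e') = nd \<sigma> e (lw e)}"
      using A(3) by simp
    then show "\<exists>A lw. Q i A lw"
      unfolding Q_def using A(1,2) by blast
  qed
  \<comment> \<open>The counting in \<open>all_oriented\<close> compares different stages, so the
    witnesses of the single stages must become sequences.\<close>
  then have "\<exists>A. \<forall>i. \<exists>lw. Q i (A i) lw" by (rule choice)
  then obtain A where "\<forall>i. \<exists>lw. Q i (A i) lw" ..
  then have "\<exists>lw. \<forall>i. Q i (A i) (lw i)" by (rule choice)
  then obtain lw where "\<forall>i. Q i (A i) (lw i)" ..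
  then have A: "\<And>i. A i \<subseteq> {e \<in> E. ori (T i e) = None}"
      "\<And>i e. e \<in> E \<Longrightarrow> ori (T (Suc i) e) = None \<longleftrightarrow> ori (T i e) = None \<and> e \<notin> A i"
      "\<And>i e. e \<in> E \<Longrightarrow> ori (T i e) = None \<Longrightarrow> e \<notin> A i \<Longrightarrow> k \<le> card {e' \<in> A i. nd \<sigma> e' (lw i e') = nd \<sigma> e (lw i e)}"
    unfolding Q_def by blast+
  have tot: "ori (T I e) \<noteq> None" if "e \<in> E" for e
    by (rule bip_graph.all_oriented[OF bip, of I A "\<lambda>i e. ori (T i e)" k lw]) (use A I that in auto)
  \<comment> \<open>Starting from \<open>4 * (k + 4 * a)\<close>, which is vacuous without oriented
    edges, makes the second term of each maximum win, so a stage costs exactly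
    \<open>8 * a\<close>.\<close>
  have bal: "balanced E (nd \<sigma>) \<Delta> (4 * (k + 4 * a) + 8 * a * i) (\<lambda>e. ori (T i e))" for i
  proof (induction i)
    case 0
    then show ?case using none by (simp add: balanced_def T0)
  next
    case (Suc i)
    have eq: "balanced E (nd (T i)) \<Delta> X r \<longleftrightarrow> balanced E (nd \<sigma>) \<Delta> X r" for X r
      by (rule balanced_cong) (use cls in auto)
    have mx: "max (4 * (k + 4 * a)) (4 * (k + 4 * a) + 8 * a * i + 8 * a) = 4 * (k + 4 * a) + 8 * a * Suc i"
      by simp
    show ?case
      using split_stage.stage_result(2)[OF st, of i "4 * (k + 4 * a) + 8 * a * i", unfolded eq mx] Suc
      by (simp only: T_Suc)
  qed
  have \<sigma>': "\<sigma>' e = (T I e)\<lparr>cls := cls (T I e) @ [the (ori (T I e))], ori := None\<rparr>" for e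
    by (simp add: \<sigma>'_def level_steps_def exec_append exec_Cons exec_Nil T_def run_step_def close_step_def)
  show "ori (\<sigma>' e) = None" if "e \<in> E" by (simp add: \<sigma>')
  show "length (cls (\<sigma>' e)) = Suc (length (cls (\<sigma> e)))" if "e \<in> E" using cls[OF that] by (simp add: \<sigma>')
  show "bip_graph E (nd \<sigma>') ((D + (4 * (k + 4 * a) + 8 * a * I)) div 2) \<Delta>"
  proof (rule bip_graph_halfnode)
    fix e assume e: "e \<in> E"
    show "inc E (nd \<sigma>') (nd \<sigma>' e False) + inc E (nd \<sigma>') (nd \<sigma>' e True) \<le>
         (D + (4 * (k + 4 * a) + 8 * a * I)) div 2"
    proof (rule bip_graph.split_degree[OF bip tot bal _ e])
      fix e e' b b' assume "e \<in> E" "e' \<in> E"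
      then show "nd \<sigma>' e b = nd \<sigma>' e' b' \<longleftrightarrow> nd \<sigma> e b = nd \<sigma> e' b' \<and> ori (T I e) = ori (T I e')"
        using tot[of e] tot[of e'] cls by (auto simp: halfnode_def \<sigma>')
    qed
  qed
qed

end

section \<open>Message sizes and length of the splitting program\<close>

lemma card_ports_le: "card {j. j < length L \<and> Q j} \<le> length L"
  using card_mono[of "{..<length L}" "{j. j < length L \<and> Q j}"] by auto

lemma small_height_step: "small_step 3 n \<Delta> (height_step \<Delta>')" if "\<Delta>' \<le> n"
proof -
  have "height_msg \<Delta>' L i \<le> n ^ 3" if "length L \<le> n" "2 \<le> n" for L i
  proof -
    have "height_msg \<Delta>' L i \<le> 2 * length L + \<Delta>'"
      unfolding height_msg_def using card_ports_le[of L] by (meson add_le_mono1 diff_le_self le_trans mult_le_mono2)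
    also have "\<dots> \<le> 4 * n" using that \<open>\<Delta>' \<le> n\<close> by simp
    also have "\<dots> \<le> n ^ 2 * n" using power_mono[of 2 n 2] that by simp
    finally show ?thesis by (simp add: power3_eq_cube power2_eq_square)
  qed
  then show ?thesis by (auto simp: small_step_def height_step_def)
qed

lemma small_bit_step: "(\<And>L i. msg st L i \<le> 1) \<Longrightarrow> small_step c n \<Delta> st"
  unfolding small_step_def by (meson le_trans one_le_power order_trans one_le_numeral)

lemma set_level_steps:
  "set (level_steps \<Delta> k a d P I) \<subseteq> {height_step \<Delta>, accept_step k, full_step \<Delta> a d, propose_step k a, move_step a, close_step}"
  by (auto simp: level_steps_def stage_steps_def game_steps_def set_replicate_conv_if split: if_splits)

lemma small_level_steps:
  assumes "st \<in> set (level_steps \<Delta> k a d P I)" "\<Delta> \<le> n"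
  shows "small_step 3 n \<Delta> st"
proof -
  have "st \<in> {height_step \<Delta>, accept_step k, full_step \<Delta> a d, propose_step k a, move_step a, close_step}"
    using assms(1) set_level_steps by blast
  then have "st = height_step \<Delta> \<or> (\<forall>L i. msg st L i \<le> 1)"
    by (auto simp: accept_step_def full_step_def propose_step_def move_step_def close_step_def split: prod.split)
  then show ?thesis using small_height_step small_bit_step assms by blast
qed

lemma length_level_steps: "length (level_steps \<Delta> k a d P I) = I * (2 + P * 3) + 1"
  by (simp add: level_steps_def stage_steps_def game_steps_def length_concat sum_list_replicate)

section \<open>Colour reduction by greedy codes\<close>

text \<open>With twice as many letters as positions, \<open>X ^ m * (2 * X) ^ (X - m)\<close> is the
  fraction \<open>1 / 2 ^ m\<close> of all words.\<close>

definition words :: "nat \<Rightarrow> (nat \<Rightarrow> nat) set" where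
  "words X = (PiE {..<X} (\<lambda>_. {..<2 * X}))"

text \<open>Agreement in at least \<open>m\<close> places contains agreement on some set of exactly
  \<open>m\<close> places; the bound is the union over these sets.\<close>

lemma card_ball_le:
  assumes "f \<in> words X" "m \<le> X"
  shows "card {g \<in> words X. m \<le> card {x. x < X \<and> f x = g x}} \<le> X ^ m * (2 * X) ^ (X - m)"
proof -
  let ?S = "{S. S \<subseteq> {..<X} \<and> card S = m}"
  let ?B = "\<lambda>S. PiE {..<X} (\<lambda>x. if x \<in> S then {f x} else {..<2 * X})"
  have finS: "finite ?S" by simp
  have fw: "finite (words X)" by (simp add: words_def finite_PiE)
  have fx: "f x < 2 * X" if "x < X" for x using assms(1) that by (auto simp: words_def PiE_iff)
  have B: "?B S \<subseteq> words X" if "S \<in> ?S" for S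
    using that fx unfolding words_def by (intro PiE_mono) auto
  have "{g \<in> words X. m \<le> card {x. x < X \<and> f x = g x}} \<subseteq> (\<Union>S\<in>?S. ?B S)"
  proof
    fix g assume g: "g \<in> {g \<in> words X. m \<le> card {x. x < X \<and> f x = g x}}"
    then obtain S where S: "S \<subseteq> {x. x < X \<and> f x = g x}" "card S = m"
      using obtain_subset_with_card_n[of m "{x. x < X \<and> f x = g x}"] by auto
    then have "S \<in> ?S" by auto
    moreover have "g \<in> ?B S" using S g by (auto simp: words_def PiE_iff)
    ultimately show "g \<in> (\<Union>S\<in>?S. ?B S)" by blast
  qed
  then have "card {g \<in> words X. m \<le> card {x. x < X \<and> f x = g x}} \<le> card (\<Union>S\<in>?S. ?B S)"
    by (rule card_mono[rotated]) (rule finite_subset[OF _ fw], use B in blast)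
  also have "\<dots> \<le> (\<Sum>S\<in>?S. card (?B S))" by (rule card_UN_le[OF finS])
  also have "\<dots> = (\<Sum>S\<in>?S. (2 * X) ^ (X - m))"
  proof (rule sum.cong[OF refl])
    fix S assume S: "S \<in> ?S"
    have "card (?B S) = (\<Prod>x\<in>{..<X}. if x \<in> S then 1 else 2 * X)"
      by (subst card_PiE) (auto intro!: prod.cong)
    also have "\<dots> = (2 * X) ^ card ({..<X} - S)" by (simp add: prod.If_cases Diff_eq)
    also have "card ({..<X} - S) = X - m" using S by (auto simp: card_Diff_subset finite_subset[of S "{..<X}"])
    finally show "card (?B S) = (2 * X) ^ (X - m)" .
  qed
  also have "\<dots> = (X choose m) * (2 * X) ^ (X - m)" by (simp add: n_subsets)
  also have "\<dots> \<le> X ^ m * (2 * X) ^ (X - m)"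
    using binomial_le_pow[OF assms(2)] by (rule mult_le_mono1)
  finally show ?thesis .
qed

text \<open>The Gilbert-Varshamov argument: fewer than \<open>2 ^ m\<close> balls cannot cover all
  words, so the code can be extended by a word outside of them.\<close>

lemma greedy_code:
  assumes "0 < X" "m \<le> X" "j \<le> 2 ^ m"
  shows "\<exists>S\<subseteq>words X. card S = j \<and> (\<forall>f\<in>S. \<forall>g\<in>S. f \<noteq> g \<longrightarrow> card {x. x < X \<and> f x = g x} < m)"
  using assms(3)
proof (induction j)
  case 0 then show ?case by (intro exI[of _ "{}"]) simp
next
  case (Suc j)
  then obtain S where S: "S \<subseteq> words X" "card S = j"
    "\<And>f g. f \<in> S \<Longrightarrow> g \<in> S \<Longrightarrow> f \<noteq> g \<Longrightarrow> card {x. x < X \<and> f x = g x} < m" by auto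
  have fw: "finite (words X)" by (simp add: words_def finite_PiE)
  then have fS: "finite S" using S finite_subset by blast
  let ?ball = "\<lambda>f. {g \<in> words X. m \<le> card {x. x < X \<and> f x = g x}}"
  have "card (\<Union>f\<in>S. ?ball f) \<le> (\<Sum>f\<in>S. card (?ball f))" by (rule card_UN_le[OF fS])
  also have "\<dots> \<le> (\<Sum>f\<in>S. X ^ m * (2 * X) ^ (X - m))"
    by (rule sum_mono) (use card_ball_le S assms in blast)
  also have "\<dots> = j * (X ^ m * (2 * X) ^ (X - m))" using S by simp
  also have "\<dots> < 2 ^ m * (X ^ m * (2 * X) ^ (X - m))" using Suc.prems assms by simp
  also have "\<dots> = (2 * X) ^ m * (2 * X) ^ (X - m)" by (simp add: power_mult_distrib)
  also have "\<dots> = (2 * X) ^ X" unfolding power_add[symmetric] using assms by simp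
  also have "\<dots> = card (words X)" by (simp add: words_def card_PiE)
  finally have "(\<Union>f\<in>S. ?ball f) \<noteq> words X" by auto
  then obtain g where g: "g \<in> words X" "g \<notin> (\<Union>f\<in>S. ?ball f)" by blast
  have far: "card {x. x < X \<and> f x = g x} < m" if "f \<in> S" for f using g that by auto
  have "g \<notin> S"
  proof
    assume "g \<in> S"
    then have "card {x. x < X \<and> g x = g x} < m" by (rule far)
    then show False using assms by simp
  qed
  then have "card (insert g S) = Suc j" using S fS by simp
  moreover have "{x. x < X \<and> g x = f x} = {x. x < X \<and> f x = g x}" for f by auto
  ultimately show ?case using S g far by (intro exI[of _ "insert g S"]) auto
qed

lemma code_exists:
  assumes "0 < X" "m \<le> X"
  shows "\<exists>F. (\<forall>a<(2::nat) ^ m. \<forall>x<X. F a x < 2 * X) \<and>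
     (\<forall>a<2 ^ m. \<forall>b<2 ^ m. a \<noteq> b \<longrightarrow> card {x. x < X \<and> F a x = (F b x :: nat)} < m)"
proof -
  obtain S where S: "S \<subseteq> words X" "card S = 2 ^ m"
    "\<And>f g. f \<in> S \<Longrightarrow> g \<in> S \<Longrightarrow> f \<noteq> g \<Longrightarrow> card {x. x < X \<and> f x = g x} < m"
    using greedy_code[OF assms order_refl] by auto
  have "finite S" by (rule finite_subset[OF S(1)]) (simp add: words_def finite_PiE)
  then obtain F where F: "bij_betw F {0..<2 ^ m :: nat} S" using ex_bij_betw_nat_finite S(2) by metis
  show ?thesis
  proof (intro exI[of _ F] conjI allI impI)
    fix a x :: nat assume "a < 2 ^ m" "x < X"
    then have "F a \<in> words X" using F S by (auto simp: bij_betw_def)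
    then show "F a x < 2 * X" using \<open>x < X\<close> by (auto simp: words_def PiE_iff)
  next
    fix a b :: nat assume "a < 2 ^ m" "b < 2 ^ m" "a \<noteq> b"
    then show "card {x. x < X \<and> F a x = F b x} < m"
      using F by (intro S(3)) (auto simp: bij_betw_def inj_on_def)
  qed
qed

definition bits :: "nat \<Rightarrow> nat" where
  "bits m = (LEAST b. m \<le> 2 ^ b)"

lemma le_bits: "m \<le> 2 ^ bits m"
  unfolding bits_def by (rule LeastI[of _ m]) simp

lemma bits_le: "1 \<le> m \<Longrightarrow> 2 ^ bits m \<le> 2 * m"
proof (cases "bits m")
  case (Suc b)
  then have "\<not> m \<le> 2 ^ b" using not_less_Least[of b "\<lambda>b. m \<le> 2 ^ b"] by (simp add: bits_def)
  then show ?thesis using Suc by simp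
qed simp

lemma bits_le_log: "1 \<le> m \<Longrightarrow> real (bits m) \<le> log 2 (real m) + 1"
proof -
  assume m: "1 \<le> m"
  have "real (2 ^ bits m) \<le> real (2 * m)" using bits_le[OF m] by (simp only: of_nat_le_iff)
  then have "log 2 (2 ^ bits m) \<le> log 2 (2 * real m)" using m by (subst log_le_cancel_iff) auto
  then show ?thesis using m by (simp add: log_mult log_nat_power)
qed

text \<open>The choice depends on \<open>m\<close> and \<open>X\<close> only, so all nodes use the
  same code without communicating.\<close>

definition code :: "nat \<Rightarrow> nat \<Rightarrow> nat \<Rightarrow> nat \<Rightarrow> nat" where
  "code m X = (SOME F. (\<forall>a<(2::nat) ^ m. \<forall>x<X. F a x < 2 * X) \<and>
     (\<forall>a<2 ^ m. \<forall>b<2 ^ m. a \<noteq> b \<longrightarrow> card {x. x < X \<and> F a x = F b x} < m))"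

lemma code_props:
  assumes "0 < X" "m \<le> X"
  shows "a < 2 ^ m \<Longrightarrow> x < X \<Longrightarrow> code m X a x < 2 * X"
    and "a < 2 ^ m \<Longrightarrow> b < 2 ^ m \<Longrightarrow> a \<noteq> b \<Longrightarrow> card {x. x < X \<and> code m X a x = code m X b x} < m"
  using someI_ex[OF code_exists[OF assms]] unfolding code_def[symmetric] by blast+

text \<open>A node of colour \<open>a\<close> whose neighbours have the colours \<open>B\<close>
  takes a position that separates its codeword from theirs, together with its letter there. The pair
  is packed into one number with the position as remainder modulo \<open>X\<close>.\<close>

definition recolour :: "nat \<Rightarrow> nat \<Rightarrow> nat \<Rightarrow> nat set \<Rightarrow> nat" where
  "recolour d m a B = (let X = d * m; x = (LEAST x. x < X \<and> (\<forall>b\<in>B. code m X a x \<noteq> code m X b x)) in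
     x + X * code m X a x)"

definition next_bits :: "nat \<Rightarrow> nat \<Rightarrow> nat" where
  "next_bits d m = 1 + 2 * (bits d + bits m)"

text \<open>Each of the at most \<open>d\<close> other codewords spoils at most \<open>m - 1\<close>
  of the \<open>d * m\<close> positions.\<close>

lemma recolour_point:
  assumes "1 \<le> d" "1 \<le> m" "a < 2 ^ m" "B \<subseteq> {..<2 ^ m}" "a \<notin> B" "card B \<le> d"
  obtains x where "x < d * m" "\<And>b. b \<in> B \<Longrightarrow> code m (d * m) a x \<noteq> code m (d * m) b x"
    "recolour d m a B = x + d * m * code m (d * m) a x"
proof -
  let ?X = "d * m"
  have X: "0 < ?X" "m \<le> ?X" using assms by auto
  have finB: "finite B" using assms(4) finite_subset by blast
  let ?bad = "\<lambda>b. {x. x < ?X \<and> code m ?X a x = code m ?X b x}"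
  have "card (\<Union>b\<in>B. ?bad b) \<le> (\<Sum>b\<in>B. card (?bad b))" by (rule card_UN_le[OF finB])
  also have "\<dots> \<le> (\<Sum>b\<in>B. m - 1)"
  proof (rule sum_mono)
    fix b assume b: "b \<in> B"
    then have "card (?bad b) < m" using code_props(2)[OF X, of a b] assms by auto
    then show "card (?bad b) \<le> m - 1" by simp
  qed
  also have "\<dots> \<le> d * (m - 1)" using assms by simp
  also have "\<dots> < card {..<?X}" using assms by (cases m) auto
  finally have "(\<Union>b\<in>B. ?bad b) \<noteq> {..<?X}" by auto
  then obtain y where "y < ?X" "y \<notin> (\<Union>b\<in>B. ?bad b)" by blast
  then have ex: "\<exists>x. x < ?X \<and> (\<forall>b\<in>B. code m ?X a x \<noteq> code m ?X b x)" by auto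
  define x where "x = (LEAST x. x < ?X \<and> (\<forall>b\<in>B. code m ?X a x \<noteq> code m ?X b x))"
  have "x < ?X \<and> (\<forall>b\<in>B. code m ?X a x \<noteq> code m ?X b x)" unfolding x_def by (rule LeastI_ex[OF ex])
  then show ?thesis by (intro that[of x]) (auto simp: recolour_def x_def Let_def)
qed

lemma recolour_less:
  assumes "1 \<le> d" "1 \<le> m" "a < 2 ^ m" "B \<subseteq> {..<2 ^ m}" "a \<notin> B" "card B \<le> d"
  shows "recolour d m a B < 2 ^ next_bits d m"
proof -
  obtain x where x: "x < d * m" "recolour d m a B = x + d * m * code m (d * m) a x"
    using recolour_point[OF assms] by metis
  have "code m (d * m) a x < 2 * (d * m)" using code_props(1)[of "d * m" m a x] assms x by auto
  then have "Suc (code m (d * m) a x) \<le> 2 * (d * m)" by simp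
  then have "d * m * Suc (code m (d * m) a x) \<le> d * m * (2 * (d * m))" by (rule mult_le_mono2)
  then have "recolour d m a B < d * m * (2 * (d * m))" using x by simp
  also have "\<dots> = 2 * (d * m) ^ 2" by (simp add: power2_eq_square)
  also have "\<dots> \<le> 2 * (2 ^ bits d * 2 ^ bits m) ^ 2"
    by (intro mult_le_mono2 power_mono mult_le_mono le_bits) simp
  also have "\<dots> = 2 ^ next_bits d m" 
    unfolding next_bits_def power_add[symmetric] power_mult[symmetric] by (simp add: mult.commute)
  finally show ?thesis .
qed

text \<open>Equal new colours mean the same position and the same letter there, but the position
  chosen for \<open>a\<close> separates it from \<open>b\<close>.\<close>

lemma recolour_neq:
  assumes "1 \<le> d" "1 \<le> m" and a: "a < 2 ^ m" "B \<subseteq> {..<2 ^ m}" "a \<notin> B" "card B \<le> d"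
    and b: "b < 2 ^ m" "B' \<subseteq> {..<2 ^ m}" "b \<notin> B'" "card B' \<le> d" and "b \<in> B"
  shows "recolour d m a B \<noteq> recolour d m b B'"
proof
  assume eq: "recolour d m a B = recolour d m b B'"
  obtain x where x: "x < d * m" "code m (d * m) a x \<noteq> code m (d * m) b x"
    "recolour d m a B = x + d * m * code m (d * m) a x" using recolour_point[OF assms(1,2) a] \<open>b \<in> B\<close> by metis
  obtain y where y: "y < d * m" "recolour d m b B' = y + d * m * code m (d * m) b y"
    using recolour_point[OF assms(1,2) b] by metis
  have "x = recolour d m a B mod (d * m)" using x by simp
  also have "\<dots> = y" using y eq by simp
  finally have "x = y" .
  then have "code m (d * m) a x = code m (d * m) b x" using x(1,3) y eq by auto
  then show False using x(2) by simp
qed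

section \<open>Iterated logarithms and the number of rounds of the colour reduction\<close>

fun colour_bits :: "nat \<Rightarrow> nat \<Rightarrow> nat \<Rightarrow> nat" where
  "colour_bits d m 0 = m"
| "colour_bits d m (Suc i) = next_bits d (colour_bits d m i)"

lemma log2_le:
  fixes x :: real
  assumes "1 \<le> x"
  shows "log 2 x \<le> 2 * (x - 1)"
proof -
  have "ln (1 / 2) \<le> 1 / 2 - (1 :: real)" by (intro ln_le_minus_one) auto
  then have l2: "1 / 2 \<le> ln (2 :: real)" by (simp add: ln_div)
  have "ln x \<le> x - 1" using assms by (intro ln_le_minus_one) auto
  also have "\<dots> \<le> (2 * (x - 1)) * ln 2"
    using mult_left_mono[OF l2, of "2 * (x - 1)"] assms by simp
  finally show ?thesis unfolding log_def by (simp add: divide_le_eq)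
qed

lemma log2_le': "0 < x \<Longrightarrow> log 2 x \<le> 2 * x" for x :: real
proof (cases "1 \<le> x")
  case True
  then show "0 < x \<Longrightarrow> ?thesis" using log2_le[of x] by simp
next
  case False
  assume "0 < x"
  then have "log 2 x \<le> 0" using False by (simp add: log_le_zero_cancel_iff)
  then show ?thesis using \<open>0 < x\<close> by linarith
qed

text \<open>The \<open>LEAST\<close> in \<open>log_star\<close> is attained: above 2 the logarithm
  lowers its argument by at least 1, since
  \<open>log 2 x = 1 + log 2 (x / 2) \<le> x - 1\<close>.\<close>

lemma iterated_log_le_1: "\<exists>i. (log 2 ^^ i) x \<le> 1" for x :: real
proof -
  have "\<exists>i. (log 2 ^^ i) x \<le> 1" if "x \<le> real k" for k x
    using that
  proof (induction k arbitrary: x)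
    case 0
    then show ?case by (intro exI[of _ 0]) simp
  next
    case (Suc k)
    show ?case
    proof (cases "x \<le> 2")
      case True
      have "log 2 x \<le> log 2 2" if "1 < x" using that True by (subst log_le_cancel_iff) auto
      then have "(log 2 ^^ (if x \<le> 1 then 0 else 1)) x \<le> 1" by auto
      then show ?thesis by blast
    next
      case False
      then have "log 2 x = 1 + log 2 (x / 2)" by (simp add: log_divide)
      also have "\<dots> \<le> 1 + 2 * (x / 2 - 1)" using log2_le[of "x / 2"] False by simp
      finally have "log 2 x \<le> real k" using Suc.prems by simp
      then obtain i where "(log 2 ^^ i) (log 2 x) \<le> 1" using Suc.IH by blast
      then have "(log 2 ^^ Suc i) x \<le> 1" by (simp add: funpow_swap1)
      then show ?thesis by blast
    qed
  qed
  then show ?thesis using real_nat_ceiling_ge by blast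
qed

lemma log_star_le_1: "(log 2 ^^ log_star n) (real n) \<le> 1"
  unfolding log_star_def by (rule LeastI_ex[OF iterated_log_le_1])

lemma log_star_pos: "2 \<le> n \<Longrightarrow> 1 \<le> log_star n"
  using log_star_le_1[of n] by (cases "log_star n") auto

lemma colour_bits_pos: "1 \<le> m \<Longrightarrow> 1 \<le> colour_bits d m i"
  by (cases i) (auto simp: next_bits_def)

text \<open>A round replaces \<open>m\<close> bits by roughly \<open>2 * log 2 m\<close> plus a term
  in \<open>d\<close>. The additive constant \<open>K\<close> reproduces itself:
  \<open>2 * log 2 K \<le> 8 + K / 4\<close> leaves three quarters of \<open>K\<close> for the terms
  in \<open>d\<close> and \<open>c\<close> and for the numerals.\<close>

lemma colour_bits_bound:
  assumes "2 \<le> n" "1 \<le> c"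
  shows "real (colour_bits d (c * bits n + 1) i) \<le>
     2 * real c * max 1 ((log 2 ^^ (i + 1)) (real n)) + real (4 * bits d + 6 * c + 42)"
proof (induction i)
  case 0
  have "1 \<le> log 2 (real n)" using assms by (simp add: le_log_iff)
  then have "real (bits n) \<le> 2 * log 2 (real n)" using bits_le_log[of n] assms by linarith
  then have "real c * real (bits n) \<le> real c * (2 * max 1 (log 2 (real n)))"
    by (intro mult_left_mono) auto
  then show ?case by (simp add: algebra_simps)
next
  case (Suc i)
  define Y where "Y = max 1 ((log 2 ^^ (i + 1)) (real n))"
  define K where "K = real (4 * bits d + 6 * c + 42)"
  define M where "M = colour_bits d (c * bits n + 1) i"
  have M1: "1 \<le> M" unfolding M_def by (rule colour_bits_pos) simp
  have Y1: "1 \<le> Y" by (simp add: Y_def)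
  have K2: "42 \<le> K" by (simp add: K_def)
  have c1: "1 \<le> real c" using assms by simp
  have cY: "2 \<le> 2 * real c * Y" using mult_mono[of 1 "real c" 1 Y] c1 Y1 by simp
  have "real M \<le> 2 * real c * Y + K" using Suc unfolding M_def Y_def K_def by simp
  \<comment> \<open>For numbers that are at least 2, a sum is at most the product, whose logarithm
    splits.\<close>
  also have "\<dots> \<le> (2 * real c * Y) * K"
  proof -
    have "0 \<le> (2 * real c * Y - 1) * (K - 1) - 1"
      using mult_mono[of 1 "2 * real c * Y - 1" 1 "K - 1"] cY K2 by simp
    then show ?thesis by (simp add: algebra_simps)
  qed
  finally have "real M \<le> 2 * real c * Y * K" .
  moreover have "0 < 2 * real c * Y * K" using c1 Y1 K2 by simp
  ultimately have "log 2 (real M) \<le> log 2 (2 * real c * Y * K)" using M1 by (subst log_le_cancel_iff) auto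
  also have "\<dots> = 1 + log 2 (real c) + log 2 Y + log 2 K"
    using c1 Y1 K2 by (simp add: log_mult)
  finally have lM: "log 2 (real M) \<le> 1 + log 2 (real c) + log 2 Y + log 2 K" .
  \<comment> \<open>Dividing by 16 first lowers the slope of the linear bound to 1 / 8.\<close>
  have "log 2 K = 4 + log 2 (K / 16)" using K2 by (simp add: log_divide log_nat_power[of 2 2 4, simplified])
  also have "\<dots> \<le> 4 + K / 8" using log2_le'[of "K / 16"] K2 by simp
  finally have lK: "log 2 K \<le> 4 + K / 8" .
  have lc: "log 2 (real c) \<le> 2 * real c - 1" using log2_le[of "real c"] c1 by simp
  have "log 2 Y \<le> max 1 ((log 2 ^^ (Suc i + 1)) (real n))"
    unfolding Y_def by (cases "(log 2 ^^ (i + 1)) (real n) \<le> 1") (auto simp: max_def)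
  moreover have "\<dots> \<le> real c * max 1 ((log 2 ^^ (Suc i + 1)) (real n))"
    using mult_right_mono[OF c1, of "max 1 ((log 2 ^^ (Suc i + 1)) (real n))"] by simp
  ultimately have lY: "log 2 Y \<le> real c * max 1 ((log 2 ^^ (Suc i + 1)) (real n))" by linarith
  have "real (colour_bits d (c * bits n + 1) (Suc i)) = 1 + 2 * real (bits d) + 2 * real (bits M)"
    by (simp add: next_bits_def M_def)
  also have "\<dots> \<le> 1 + 2 * real (bits d) + 2 * (1 + log 2 (real M))" using bits_le_log[OF M1] by simp
  also have "\<dots> \<le> 2 * (real c * max 1 ((log 2 ^^ (Suc i + 1)) (real n))) + K"
  proof -
    have "1 + 2 * x + 2 * (1 + y) \<le> 2 * w + k" if "y \<le> 1 + z + u + t" "t \<le> 4 + k / 8" "u \<le> w" "z \<le> 2 * r - 1"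
      "k = 4 * x + 6 * r + 42" "0 \<le> x" "1 \<le> r" for x y z u w t k r :: real
      using that by argo
    from this[OF lM lK lY lc] show ?thesis using c1 by (simp add: K_def)
  qed
  finally show ?case unfolding K_def by (simp only: mult.assoc)
qed

text \<open>The initial colours have a number of bits of order \<open>log 2 n\<close>, which already
  accounts for one logarithm; hence the \<open>- 1\<close>.\<close>

lemma colour_bits_final:
  assumes "2 \<le> n" "1 \<le> c"
  shows "colour_bits d (c * bits n + 1) (log_star n - 1) \<le> 4 * bits d + 8 * c + 42"
proof -
  have "max 1 ((log 2 ^^ (log_star n - 1 + 1)) (real n)) = 1"
    using log_star_le_1[of n] log_star_pos[OF assms(1)] by simp
  then have "real (colour_bits d (c * bits n + 1) (log_star n - 1)) \<le> real (4 * bits d + 8 * c + 42)"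
    using colour_bits_bound[OF assms, of d "log_star n - 1"] by (simp only: mult_1_right)
  then show ?thesis by (simp only: of_nat_le_iff)
qed

section \<open>Colouring the final classes\<close>

text \<open>\<open>col\<close> and \<open>rk\<close> hold the values at both ends. A colour belongs
  to a node within a class and is shared by all its edges there; a rank belongs to the single
  edge.\<close>

record fstate =
  kl :: "bool list"
  col :: "bool \<Rightarrow> nat"
  rk :: "bool \<Rightarrow> nat"
  fin :: "nat option"

text \<open>The \<open>min\<close> only serves \<open>small_step\<close>, which ranges over
  arbitrary views; in legal states the new colour is below the cap by
  \<open>recolour_less\<close>.\<close>

definition recolour_step :: "nat \<Rightarrow> nat \<Rightarrow> fstate step" where
  "recolour_step d m = \<lparr>msg = \<lambda>L i. case L ! i of (b, s) \<Rightarrow>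
     min (2 ^ next_bits d m) (recolour d m (col s b)
       ((\<lambda>j. col (snd (L ! j)) (\<not> fst (L ! j))) ` {j. j < length L \<and> kl (snd (L ! j)) = kl s})),
     upd = \<lambda>s m. s\<lparr>col := m\<rparr>\<rparr>"

definition rank_step :: "fstate step" where
  "rank_step = \<lparr>msg = \<lambda>L i. card {j. j < i \<and> kl (snd (L ! j)) = kl (snd (L ! i))}, upd = \<lambda>s m. s\<lparr>rk := m\<rparr>\<rparr>"

definition slot :: "fstate \<Rightarrow> nat \<times> nat \<times> nat \<times> nat" where
  "slot s = (col s False, col s True, rk s False, rk s True)"

definition trial_step :: "nat \<times> nat \<times> nat \<times> nat \<Rightarrow> nat \<Rightarrow> fstate step" where
  "trial_step x j = \<lparr>msg = \<lambda>L i. of_bool (\<forall>j'<length L. kl (snd (L ! j')) = kl (snd (L ! i)) \<longrightarrow> fin (snd (L ! j')) \<noteq> Some j),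
     upd = \<lambda>s m. if slot s = x \<and> fin s = None \<and> 0 < m False \<and> 0 < m True then s\<lparr>fin := Some j\<rparr> else s\<rparr>"

definition recolour_steps :: "nat \<Rightarrow> nat \<Rightarrow> nat \<Rightarrow> fstate step list" where
  "recolour_steps d m r = map (\<lambda>i. recolour_step d (colour_bits d m i)) [0..<r]"

definition trial_steps :: "nat \<Rightarrow> (nat \<times> nat \<times> nat \<times> nat) list \<Rightarrow> fstate step list" where
  "trial_steps K xs = concat (map (\<lambda>x. map (trial_step x) [0..<K]) xs)"

definition slots :: "nat \<Rightarrow> nat \<Rightarrow> (nat \<times> nat \<times> nat \<times> nat) list" where
  "slots M d = List.product [0..<M] (List.product [0..<M] (List.product [0..<d] [0..<d]))"

lemma set_slots: "slot s \<in> set (slots M d) \<longleftrightarrow> col s False < M \<and> col s True < M \<and> rk s False < d \<and> rk s True < d"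
  by (auto simp: slots_def slot_def)

lemma length_slots: "length (slots M d) = M * (M * (d * d))"
  by (simp add: slots_def)

lemma length_trial_steps: "length (trial_steps K xs) = length xs * K"
  by (induction xs) (simp_all add: trial_steps_def)

locale class_graph = net p N for p N +
  fixes \<kappa> :: "nat set \<Rightarrow> bool list" and D :: nat
  assumes bip: "bip_graph (edges N) (halfnode N \<kappa>) D (max_deg N)"
begin

text \<open>Both halves of the node count here, so a star may have \<open>2 * D\<close>
  edges.\<close>

definition star :: "nat \<Rightarrow> bool list \<Rightarrow> nat set set" where
  "star v c = {e \<in> E. v \<in> e \<and> \<kappa> e = c}"

lemma in_edge_iff: "e \<in> E \<Longrightarrow> v \<in> e \<longleftrightarrow> (\<exists>b. endp N e b = v)"
proof -
  assume "e \<in> E"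
  then have "v \<in> e \<longleftrightarrow> v \<in> {endp N e False, endp N e (\<not> False)}"
    by (intro arg_cong[where f = "(\<in>) v"] edge_eq)
  then show ?thesis by (auto simp: ex_bool_eq)
qed

lemma endp_in: "e \<in> E \<Longrightarrow> endp N e b \<in> e"
  using in_edge_iff by blast

lemma meets_iff: "e \<in> E \<Longrightarrow> e \<inter> f \<noteq> {} \<longleftrightarrow> endp N e False \<in> f \<or> endp N e True \<in> f"
proof -
  assume e: "e \<in> E"
  have "v \<in> e \<longleftrightarrow> endp N e False = v \<or> endp N e True = v" for v
    using in_edge_iff[OF e] by (simp only: ex_bool_eq disj_commute)
  then have "(\<exists>v. v \<in> e \<and> v \<in> f) \<longleftrightarrow> endp N e False \<in> f \<or> endp N e True \<in> f" by auto
  then show ?thesis by (simp add: disjoint_iff)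
qed

lemma star_eq: "star v c = {e \<in> E. endp N e False = v \<and> \<kappa> e = c} \<union> {e \<in> E. endp N e True = v \<and> \<kappa> e = c}"
  using in_edge_iff by (auto simp: star_def ex_bool_eq)

lemma finite_star: "finite (star v c)"
  using finite_edges by (simp add: star_def)

lemma half_star_le: "card {e \<in> E. endp N e b = v \<and> \<kappa> e = c} \<le> D"
  using bip_graph.inc_le_D[OF bip, of "(v, b, c)"] by (simp add: inc_halfnode)

lemma card_star_le: "card (star v c) \<le> 2 * D"
proof -
  have "card (star v c) \<le> card {e \<in> E. endp N e False = v \<and> \<kappa> e = c} + card {e \<in> E. endp N e True = v \<and> \<kappa> e = c}"
    unfolding star_eq by (rule card_Un_le)
  then show ?thesis using half_star_le[of False v c] half_star_le[of True v c] by linarith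
qed

text \<open>The two half-stars containing \<open>e\<close> have at most \<open>D\<close> elements together.\<close>

lemma card_adjacent_le:
  assumes "e \<in> E"
  shows "card (star (endp N e False) (\<kappa> e) \<union> star (endp N e True) (\<kappa> e) - {e}) < 3 * D"
proof -
  let ?s = "\<lambda>v b. {e' \<in> E. endp N e' b = v \<and> \<kappa> e' = \<kappa> e}"
  let ?x = "endp N e False" and ?y = "endp N e True"
  let ?A = "star ?x (\<kappa> e) \<union> star ?y (\<kappa> e)"
  have "?A = (?s ?x False \<union> ?s ?y True) \<union> (?s ?x True \<union> ?s ?y False)" unfolding star_eq by blast
  then have "card ?A \<le> card (?s ?x False \<union> ?s ?y True) + card (?s ?x True \<union> ?s ?y False)"
    using card_Un_le[of "?s ?x False \<union> ?s ?y True" "?s ?x True \<union> ?s ?y False"] by (simp only:)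
  also have "\<dots> \<le> (card (?s ?x False) + card (?s ?y True)) + (card (?s ?x True) + card (?s ?y False))"
    by (intro add_mono card_Un_le)
  also have "\<dots> \<le> D + (D + D)"
  proof (intro add_mono half_star_le)
    show "card (?s ?x False) + card (?s ?y True) \<le> D"
      using bip_graph.deg_sum[OF bip assms] by (simp add: inc_halfnode halfnode_def[of N \<kappa> e])
  qed
  finally have "card ?A \<le> 3 * D" by simp
  moreover have "e \<in> ?A" using assms by (auto simp: star_eq)
  moreover have "finite ?A" using finite_star by simp
  ultimately show ?thesis using card_Diff1_less[of ?A e] by linarith
qed

lemma D_pos: "e \<in> E \<Longrightarrow> 1 \<le> D"
  using card_adjacent_le[of e] by (cases D) auto

text \<open>A proper vertex colouring of each class with \<open>m\<close>-bit colours, stored at the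
  edges; the second part says that every node has a single colour in a class.\<close>

definition legal :: "nat \<Rightarrow> (nat set \<Rightarrow> fstate) \<Rightarrow> bool" where
  "legal m \<sigma> \<longleftrightarrow> (\<forall>e\<in>E. kl (\<sigma> e) = \<kappa> e \<and> col (\<sigma> e) False \<noteq> col (\<sigma> e) True \<and> (\<forall>b. col (\<sigma> e) b < 2 ^ m)) \<and>
     (\<forall>e\<in>E. \<forall>e'\<in>E. \<forall>b b'. endp N e b = endp N e' b' \<longrightarrow> \<kappa> e = \<kappa> e' \<longrightarrow> col (\<sigma> e) b = col (\<sigma> e') b')"

definition opposite :: "(nat set \<Rightarrow> fstate) \<Rightarrow> nat \<Rightarrow> bool list \<Rightarrow> nat set" where
  "opposite \<sigma> v c = (\<Union>b. (\<lambda>e. col (\<sigma> e) (\<not> b)) ` {e \<in> E. endp N e b = v \<and> \<kappa> e = c})"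

lemma oppositeI: "e \<in> E \<Longrightarrow> col (\<sigma> e) (\<not> b) \<in> opposite \<sigma> (endp N e b) (\<kappa> e)"
  unfolding opposite_def by blast

lemma card_opposite_le: "card (opposite \<sigma> v c) \<le> 2 * D"
proof -
  let ?f = "\<lambda>b. (\<lambda>e. col (\<sigma> e) (\<not> b)) ` {e \<in> E. endp N e b = v \<and> \<kappa> e = c}"
  have "opposite \<sigma> v c = ?f False \<union> ?f True" by (auto simp: opposite_def UNIV_bool)
  then have "card (opposite \<sigma> v c) \<le> card (?f False) + card (?f True)" by (simp only: card_Un_le)
  moreover have "card (?f b) \<le> D" for b
    using card_image_le[of "{e \<in> E. endp N e b = v \<and> \<kappa> e = c}" "\<lambda>e. col (\<sigma> e) (\<not> b)"]
      half_star_le[of b v c] finite_edges by simp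
  from this[of False] this[of True] calculation show ?thesis by linarith
qed

lemma legal_col: "legal m \<sigma> \<Longrightarrow> e \<in> E \<Longrightarrow> e' \<in> E \<Longrightarrow> endp N e b = endp N e' b' \<Longrightarrow> \<kappa> e = \<kappa> e' \<Longrightarrow>
    col (\<sigma> e) b = col (\<sigma> e') b'"
  unfolding legal_def by blast

lemma legal_kl: "legal m \<sigma> \<Longrightarrow> e \<in> E \<Longrightarrow> kl (\<sigma> e) = \<kappa> e"
  unfolding legal_def by blast

lemma legal_less: "legal m \<sigma> \<Longrightarrow> e \<in> E \<Longrightarrow> col (\<sigma> e) b < 2 ^ m"
  unfolding legal_def by blast

lemma legal_neq: "legal m \<sigma> \<Longrightarrow> e \<in> E \<Longrightarrow> col (\<sigma> e) b \<noteq> col (\<sigma> e) (\<not> b)"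
proof -
  assume "legal m \<sigma>" "e \<in> E"
  then have "col (\<sigma> e) False \<noteq> col (\<sigma> e) True" unfolding legal_def by blast
  then show ?thesis by (cases b) auto
qed

lemma legal_cong:
  assumes "\<And>e. kl (\<sigma>' e) = kl (\<sigma> e)" "\<And>e. col (\<sigma>' e) = col (\<sigma> e)"
  shows "legal m \<sigma>' = legal m \<sigma>"
  unfolding legal_def assms ..

abbreviation "new_col m \<sigma> e b \<equiv> recolour (2 * D) m (col (\<sigma> e) b) (opposite \<sigma> (endp N e b) (\<kappa> e))"

abbreviation "recoloured m \<sigma> \<equiv> run_step N (recolour_step (2 * D) m) \<sigma>"

lemma run_recolour:
  assumes leg: "legal m \<sigma>" and e: "e \<in> E" and m: "1 \<le> m"
  shows "recoloured m \<sigma> e =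
      (\<sigma> e)\<lparr>col := \<lambda>b. new_col m \<sigma> e b\<rparr>"
    and "new_col m \<sigma> e b < 2 ^ next_bits (2 * D) m"
    and "new_col m \<sigma> e False \<noteq>
      new_col m \<sigma> e True"
proof -
  have kl: "kl (\<sigma> e') = \<kappa> e'" if "e' \<in> E" for e' using legal_kl[OF leg that] .
  have d1: "1 \<le> 2 * D" using D_pos[OF e] by simp
  have a: "col (\<sigma> e) b < 2 ^ m" for b using legal_less[OF leg e] .
  have B: "opposite \<sigma> v c \<subseteq> {..<2 ^ m}" for v c using legal_less[OF leg] by (auto simp: opposite_def)
  have nin: "col (\<sigma> e) b \<notin> opposite \<sigma> (endp N e b) (\<kappa> e)" for b
  proof
    assume "col (\<sigma> e) b \<in> opposite \<sigma> (endp N e b) (\<kappa> e)"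
    then obtain e' b' where e': "e' \<in> E" "endp N e' b' = endp N e b" "\<kappa> e' = \<kappa> e" "col (\<sigma> e) b = col (\<sigma> e') (\<not> b')"
      by (auto simp: opposite_def)
    then have "col (\<sigma> e') b' = col (\<sigma> e') (\<not> b')" using legal_col[OF leg e'(1) e e'(2,3)] by simp
    then show False using legal_neq[OF leg e'(1)] by simp
  qed
  show less: "new_col m \<sigma> e b < 2 ^ next_bits (2 * D) m" for b
    by (rule recolour_less[OF d1 m a B nin card_opposite_le])
  have "col (\<sigma> e) True \<in> opposite \<sigma> (endp N e False) (\<kappa> e)" using oppositeI[OF e, of \<sigma> False] by simp
  then show "new_col m \<sigma> e False \<noteq>
      new_col m \<sigma> e True"
    by (rule recolour_neq[OF d1 m a B nin card_opposite_le a B nin card_opposite_le])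
  have "sent N (recolour_step (2 * D) m) \<sigma> e b = new_col m \<sigma> e b" for b
  proof -
    let ?v = "endp N e b"
    let ?L = "view N \<sigma> ?v"
    note v = endp_node[OF e, of b]
    have i: "?L ! port N e b = (b, \<sigma> e)" using port_props[OF e, of b] by simp
    have "(\<lambda>j. col (snd (?L ! j)) (\<not> fst (?L ! j))) ` {j. j < length ?L \<and> kl (snd (?L ! j)) = kl (\<sigma> e)} =
      opposite \<sigma> ?v (\<kappa> e)" (is "?l = ?r")
    proof
      show "?l \<subseteq> ?r"
      proof
        fix x assume "x \<in> ?l"
        then obtain j where j: "j < deg N ?v" "kl (\<sigma> (link N ?v j)) = kl (\<sigma> e)" "x = col (\<sigma> (link N ?v j)) (\<not> side N ?v j)"
          by auto
        then show "x \<in> ?r" using link_props(1,2)[OF v j(1)] kl e unfolding opposite_def by auto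
      qed
      show "?r \<subseteq> ?l"
      proof
        fix x assume "x \<in> ?r"
        then obtain e' b' where e': "e' \<in> E" "endp N e' b' = ?v" "\<kappa> e' = \<kappa> e" "x = col (\<sigma> e') (\<not> b')"
          unfolding opposite_def by auto
        then show "x \<in> ?l" using port_props[OF e'(1), of b'] kl e
          by (intro image_eqI[of _ _ "port N e' b'"]) auto
      qed
    qed
    then show ?thesis using less[of b] by (simp add: sent_def recolour_step_def i)
  qed
  then show "recoloured m \<sigma> e =
      (\<sigma> e)\<lparr>col := \<lambda>b. new_col m \<sigma> e b\<rparr>"
    by (simp add: run_step_def recolour_step_def[THEN arg_cong[where f = upd]] fun_eq_iff)
qed

lemma legal_recolour:
  assumes "legal m \<sigma>" "1 \<le> m"
  shows "legal (next_bits (2 * D) m) (recoloured m \<sigma>)"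
  unfolding legal_def
proof (intro conjI ballI allI impI)
  fix e b assume e: "e \<in> E"
  note R = run_recolour[OF assms(1) e assms(2)]
  show "kl (recoloured m \<sigma> e) = \<kappa> e" using R(1) legal_kl[OF assms(1) e] by simp
  show "col (recoloured m \<sigma> e) b < 2 ^ next_bits (2 * D) m" using R(1,2) by simp
  show "col (recoloured m \<sigma> e) False \<noteq> col (recoloured m \<sigma> e) True"
    using R(1,3) by simp
next
  fix e e' b b' assume e: "e \<in> E" "e' \<in> E" "endp N e b = endp N e' b'" "\<kappa> e = \<kappa> e'"
  then have "col (\<sigma> e) b = col (\<sigma> e') b'" using legal_col[OF assms(1)] by blast
  then show "col (recoloured m \<sigma> e) b = col (recoloured m \<sigma> e') b'"
    using run_recolour(1)[OF assms(1) e(1) assms(2)] run_recolour(1)[OF assms(1) e(2) assms(2)] e by simp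
qed

lemma fin_recolour: "fin (run_step N (recolour_step d m) \<sigma> e) = fin (\<sigma> e)"
  by (simp add: run_step_def recolour_step_def)

lemma legal_recolour_steps:
  assumes "legal m \<sigma>" "1 \<le> m"
  shows "legal (colour_bits (2 * D) m r) (exec N (recolour_steps (2 * D) m r) \<sigma>) \<and>
     fin (exec N (recolour_steps (2 * D) m r) \<sigma> e) = fin (\<sigma> e)"
proof (induction r)
  case 0
  then show ?case using assms by (simp add: recolour_steps_def exec_Nil)
next
  case (Suc r)
  have "exec N (recolour_steps (2 * D) m (Suc r)) \<sigma> =
      run_step N (recolour_step (2 * D) (colour_bits (2 * D) m r)) (exec N (recolour_steps (2 * D) m r) \<sigma>)"
    by (simp add: recolour_steps_def exec_append exec_Cons exec_Nil)
  then show ?case using Suc legal_recolour colour_bits_pos[OF assms(2)] by (simp add: fin_recolour)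
qed

text \<open>Only edges that meet with equal sides are compared; those that meet with opposite sides
  are separated by the vertex colours.\<close>

definition ranked :: "(nat set \<Rightarrow> fstate) \<Rightarrow> bool" where
  "ranked \<sigma> \<longleftrightarrow> (\<forall>e\<in>E. \<forall>b. rk (\<sigma> e) b < 2 * D) \<and>
     (\<forall>e\<in>E. \<forall>e'\<in>E. \<forall>b. e \<noteq> e' \<longrightarrow> endp N e b = endp N e' b \<longrightarrow> \<kappa> e = \<kappa> e' \<longrightarrow> rk (\<sigma> e) b \<noteq> rk (\<sigma> e') b)"

text \<open>The rank counts the smaller ports of the same class and is therefore strictly increasing
  along the ports of a class.\<close>

lemma ranked_rank_step:
  assumes leg: "legal m \<sigma>"
  defines "\<sigma>' \<equiv> run_step N rank_step \<sigma>"
  shows "ranked \<sigma>'" "legal m \<sigma>'" "fin (\<sigma>' e) = fin (\<sigma> e)"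
proof -
  have kl: "kl (\<sigma> e) = \<kappa> e" if "e \<in> E" for e using legal_kl[OF leg that] .
  let ?J = "\<lambda>v c i. {j. j < i \<and> \<kappa> (link N v j) = c}"
  have rk: "rk (\<sigma>' e) b = card (?J (endp N e b) (\<kappa> e) (port N e b))" if e: "e \<in> E" for e b
  proof -
    let ?v = "endp N e b"
    have i: "view N \<sigma> ?v ! port N e b = (b, \<sigma> e)" using port_props[OF e, of b] by simp
    have "{j. j < port N e b \<and> kl (snd (view N \<sigma> ?v ! j)) = kl (\<sigma> e)} = ?J ?v (\<kappa> e) (port N e b)"
      using port_props(1)[OF e, of b] kl e link_props(1)[OF endp_node[OF e]] by (auto simp: less_trans)
    then show ?thesis by (simp add: \<sigma>'_def run_step_def rank_step_def sent_def i)
  qed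
  have mono: "card (?J v c i) < card (?J v c i')" if "\<kappa> (link N v i) = c" "i < i'" for v c i i'
    by (rule psubset_card_mono) (use that in auto)
  have "legal m \<sigma>' = legal m \<sigma>"
    by (rule legal_cong) (simp_all add: \<sigma>'_def run_step_def rank_step_def)
  then show "legal m \<sigma>'" using leg by simp
  show "fin (\<sigma>' e) = fin (\<sigma> e)" by (simp add: \<sigma>'_def run_step_def rank_step_def)
  show "ranked \<sigma>'"
    unfolding ranked_def
  proof (intro conjI ballI allI impI)
    fix e b assume e: "e \<in> E"
    let ?v = "endp N e b"
    note v = endp_node[OF e, of b]
    have "rk (\<sigma>' e) b < card (?J ?v (\<kappa> e) (deg N ?v))"
      unfolding rk[OF e] using port_props[OF e, of b] by (intro mono) auto
    also have "card (?J ?v (\<kappa> e) (deg N ?v)) \<le> card (star ?v (\<kappa> e))"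
    proof (rule card_inj_on_le[where f = "link N ?v"])
      show "inj_on (link N ?v) (?J ?v (\<kappa> e) (deg N ?v))"
        using bij_link[OF v] by (auto simp: bij_betw_def intro: inj_on_subset)
      show "link N ?v ` ?J ?v (\<kappa> e) (deg N ?v) \<subseteq> star ?v (\<kappa> e)"
        using link_props(1)[OF v] by (auto simp: star_def link_def)
    qed (rule finite_star)
    finally show "rk (\<sigma>' e) b < 2 * D" using card_star_le[of ?v "\<kappa> e"] by linarith
  next
    fix e e' b assume e: "e \<in> E" "e' \<in> E" "e \<noteq> e'" "endp N e b = endp N e' b" "\<kappa> e = \<kappa> e'"
    have "port N e b \<noteq> port N e' b" using port_props(3)[OF e(1), of b] port_props(3)[OF e(2), of b] e by metis
    moreover have "\<kappa> (link N (endp N e b) (port N e b)) = \<kappa> e" "\<kappa> (link N (endp N e b) (port N e' b)) = \<kappa> e"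
      using port_props(3)[OF e(1), of b] port_props(3)[OF e(2), of b] e by simp_all
    ultimately show "rk (\<sigma>' e) b \<noteq> rk (\<sigma>' e') b"
      using mono[of "endp N e b" "port N e b" "\<kappa> e" "port N e' b"] mono[of "endp N e b" "port N e' b" "\<kappa> e" "port N e b"] e
      unfolding rk[OF e(1)] rk[OF e(2)] by (cases "port N e b < port N e' b") auto
  qed
qed

lemma ranked_less: "ranked \<sigma> \<Longrightarrow> e \<in> E \<Longrightarrow> rk (\<sigma> e) b < 2 * D"
  unfolding ranked_def by blast

lemma ranked_neq: "ranked \<sigma> \<Longrightarrow> e \<in> E \<Longrightarrow> e' \<in> E \<Longrightarrow> e \<noteq> e' \<Longrightarrow> endp N e b = endp N e' b \<Longrightarrow> \<kappa> e = \<kappa> e' \<Longrightarrow>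
    rk (\<sigma> e) b \<noteq> rk (\<sigma> e') b"
  unfolding ranked_def by blast

definition adj :: "nat set \<Rightarrow> nat set \<Rightarrow> bool" where
  "adj e f \<longleftrightarrow> f \<in> E \<and> f \<noteq> e \<and> e \<inter> f \<noteq> {} \<and> \<kappa> f = \<kappa> e"

lemma adj_star: "e \<in> E \<Longrightarrow> {f. adj e f} = star (endp N e False) (\<kappa> e) \<union> star (endp N e True) (\<kappa> e) - {e}"
  using meets_iff[of e] by (auto simp: adj_def star_def)

text \<open>If the common node is on the same side of both edges, its ranks differ. Otherwise it is
  end \<open>b\<close> of \<open>e\<close> and end \<open>\<not> b\<close> of \<open>f\<close>;
  equal slots would then give both ends of \<open>f\<close> the same colour.\<close>

lemma slot_neq:
  assumes "legal m \<sigma>" "ranked \<sigma>" "e \<in> E" "adj e f"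
  shows "slot (\<sigma> e) \<noteq> slot (\<sigma> f)"
proof
  assume eq: "slot (\<sigma> e) = slot (\<sigma> f)"
  then have c: "col (\<sigma> e) b = col (\<sigma> f) b" and r: "rk (\<sigma> e) b = rk (\<sigma> f) b" for b
    by (cases b; simp add: slot_def)+
  have f: "f \<in> E" "e \<noteq> f" "\<kappa> e = \<kappa> f" using assms by (auto simp: adj_def)
  obtain v where "v \<in> e" "v \<in> f" using assms by (auto simp: adj_def)
  then obtain b b' where b: "endp N e b = v" "endp N f b' = v" using in_edge_iff assms(3) f by metis
  show False
  proof (cases "b = b'")
    case True
    then have "rk (\<sigma> e) b \<noteq> rk (\<sigma> f) b" using ranked_neq[OF assms(2,3) f(1,2) _ f(3)] b True by simp
    then show False using r by simp
  next
    case False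
    then have "b' = (\<not> b)" by auto
    then have "col (\<sigma> e) b = col (\<sigma> f) (\<not> b)" using legal_col[OF assms(1,3) f(1), of b b'] f b by simp
    then have "col (\<sigma> f) b = col (\<sigma> f) (\<not> b)" using c by simp
    then show False using legal_neq[OF assms(1) f(1)] by simp
  qed
qed

section \<open>Greedy trials along the schedule\<close>

definition good :: "nat \<Rightarrow> (nat set \<Rightarrow> fstate) \<Rightarrow> bool" where
  "good K \<sigma> \<longleftrightarrow> (\<forall>e\<in>E. \<forall>j. fin (\<sigma> e) = Some j \<longrightarrow> j < K \<and> (\<forall>f. adj e f \<longrightarrow> fin (\<sigma> f) \<noteq> Some j))"

definition same_slots :: "(nat set \<Rightarrow> fstate) \<Rightarrow> (nat set \<Rightarrow> fstate) \<Rightarrow> bool" where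
  "same_slots \<sigma> \<sigma>' \<longleftrightarrow> (\<forall>e. slot (\<sigma>' e) = slot (\<sigma> e) \<and> kl (\<sigma>' e) = kl (\<sigma> e) \<and>
     (\<forall>j. fin (\<sigma> e) = Some j \<longrightarrow> fin (\<sigma>' e) = Some j))"

lemma same_slots_trans: "same_slots \<sigma> \<sigma>' \<Longrightarrow> same_slots \<sigma>' \<sigma>'' \<Longrightarrow> same_slots \<sigma> \<sigma>''"
  by (simp add: same_slots_def)

definition ready :: "(nat set \<Rightarrow> fstate) \<Rightarrow> bool" where
  "ready \<sigma> \<longleftrightarrow> (\<forall>e\<in>E. kl (\<sigma> e) = \<kappa> e \<and> (\<forall>f. adj e f \<longrightarrow> slot (\<sigma> e) \<noteq> slot (\<sigma> f)))"

lemma ready_same_slots: "ready \<sigma> \<Longrightarrow> same_slots \<sigma> \<sigma>' \<Longrightarrow> ready \<sigma>'"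
  by (simp add: ready_def same_slots_def)

text \<open>A new colour has been checked at both ends of its edge, and two adjacent edges never
  receive one in the same step because their slots differ.\<close>

lemma trial:
  fixes x :: "nat \<times> nat \<times> nat \<times> nat"
  assumes ready: "ready \<sigma>"
    and g: "good K \<sigma>" and j: "j < K"
  defines "\<sigma>' \<equiv> run_step N (trial_step x j) \<sigma>"
  shows "same_slots \<sigma> \<sigma>'" "good K \<sigma>'"
    "e \<in> E \<Longrightarrow> slot (\<sigma> e) = x \<Longrightarrow> fin (\<sigma>' e) = None \<Longrightarrow> \<exists>f. adj e f \<and> fin (\<sigma> f) = Some j"
proof -
  have kl: "kl (\<sigma> e) = \<kappa> e" if "e \<in> E" for e using ready that by (simp add: ready_def)
  have sl: "slot (\<sigma> e) \<noteq> slot (\<sigma> f)" if "e \<in> E" "adj e f" for e f using ready that by (simp add: ready_def)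
  have sent: "0 < sent N (trial_step x j) \<sigma> e b \<longleftrightarrow> (\<forall>f\<in>E. endp N e b \<in> f \<longrightarrow> \<kappa> f = \<kappa> e \<longrightarrow> fin (\<sigma> f) \<noteq> Some j)"
    if e: "e \<in> E" for e b
  proof -
    let ?v = "endp N e b"
    note v = endp_node[OF e, of b]
    have i: "view N \<sigma> ?v ! port N e b = (b, \<sigma> e)" using port_props[OF e, of b] by simp
    have "(\<forall>i<deg N ?v. kl (\<sigma> (link N ?v i)) = kl (\<sigma> e) \<longrightarrow> fin (\<sigma> (link N ?v i)) \<noteq> Some j) \<longleftrightarrow>
      (\<forall>f\<in>link N ?v ` {..<deg N ?v}. kl (\<sigma> f) = kl (\<sigma> e) \<longrightarrow> fin (\<sigma> f) \<noteq> Some j)" by auto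
    also have "link N ?v ` {..<deg N ?v} = {f \<in> E. ?v \<in> f}" using bij_link[OF v] by (simp add: bij_betw_def)
    finally show ?thesis using kl e by (auto simp: sent_def trial_step_def i)
  qed
  have eq: "\<sigma>' e = (if slot (\<sigma> e) = x \<and> fin (\<sigma> e) = None \<and> 0 < sent N (trial_step x j) \<sigma> e False \<and> 0 < sent N (trial_step x j) \<sigma> e True
      then (\<sigma> e)\<lparr>fin := Some j\<rparr> else \<sigma> e)" for e
    by (simp add: \<sigma>'_def run_step_def) (simp add: trial_step_def)
  show ss: "same_slots \<sigma> \<sigma>'" by (auto simp: same_slots_def eq slot_def)
  have new: "slot (\<sigma> e) = x \<and> i = j \<and> (\<forall>f. adj e f \<longrightarrow> fin (\<sigma> f) \<noteq> Some j)"
    if e: "e \<in> E" "fin (\<sigma>' e) = Some i" "fin (\<sigma> e) \<noteq> Some i" for e i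
  proof -
    have *: "slot (\<sigma> e) = x" "i = j" "0 < sent N (trial_step x j) \<sigma> e False" "0 < sent N (trial_step x j) \<sigma> e True"
      using e by (auto simp: eq split: if_splits)
    have "fin (\<sigma> f) \<noteq> Some j" if "adj e f" for f
    proof -
      have f: "f \<in> E" "\<kappa> f = \<kappa> e" using that by (auto simp: adj_def)
      have "endp N e False \<in> f \<or> endp N e True \<in> f" using that meets_iff[OF e(1), of f] by (simp add: adj_def)
      then show ?thesis using *(3,4) f unfolding sent[OF e(1)] by blast
    qed
    then show ?thesis using * by blast
  qed
  show "good K \<sigma>'"
    unfolding good_def
  proof (intro ballI allI impI conjI)
    fix e i assume e: "e \<in> E" and i: "fin (\<sigma>' e) = Some i"
    show "i < K" using new[OF e i] g j e unfolding good_def by (cases "fin (\<sigma> e) = Some i") auto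
    fix f assume f: "adj e f"
    then have fE: "f \<in> E" "adj f e" using e by (auto simp: adj_def)
    show "fin (\<sigma>' f) \<noteq> Some i"
    proof
      assume i': "fin (\<sigma>' f) = Some i"
      consider "fin (\<sigma> e) = Some i" "fin (\<sigma> f) = Some i" | "fin (\<sigma> e) = Some i" "fin (\<sigma> f) \<noteq> Some i"
        | "fin (\<sigma> e) \<noteq> Some i" "fin (\<sigma> f) = Some i" | "fin (\<sigma> e) \<noteq> Some i" "fin (\<sigma> f) \<noteq> Some i" by blast
      then show False
      proof cases
        case 1 then show False using g e f unfolding good_def by blast
      next
        case 2 then show False using new[OF fE(1) i'] fE by blast
      next
        case 3 then show False using new[OF e i] f by blast
      next
        case 4 then show False using new[OF fE(1) i'] new[OF e i] sl[OF e f] by metis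
      qed
    qed
  qed
  show "\<exists>f. adj e f \<and> fin (\<sigma> f) = Some j" if e: "e \<in> E" "slot (\<sigma> e) = x" "fin (\<sigma>' e) = None"
  proof -
    have none: "fin (\<sigma> e) = None" using e(3) by (auto simp: eq split: if_splits)
    then have "\<exists>b. \<not> 0 < sent N (trial_step x j) \<sigma> e b" using e by (auto simp: eq split: if_splits)
    then obtain b f where "f \<in> E" "endp N e b \<in> f" "\<kappa> f = \<kappa> e" "fin (\<sigma> f) = Some j"
      unfolding sent[OF e(1)] by blast
    moreover have "endp N e b \<in> e" using endp_in[OF e(1)] .
    ultimately show ?thesis using none unfolding adj_def by auto
  qed
qed

text \<open>Final colours are never withdrawn, so an edge that blocked a colour still blocks it at
  the end of the block.\<close>

lemma trial_block:
  fixes x :: "nat \<times> nat \<times> nat \<times> nat"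
  assumes ready: "ready \<sigma>"
    and g: "good K \<sigma>" and J: "J \<le> K"
  defines "\<sigma>' \<equiv> exec N (map (trial_step x) [0..<J]) \<sigma>"
  shows "same_slots \<sigma> \<sigma>' \<and> good K \<sigma>' \<and>
    (\<forall>e\<in>E. slot (\<sigma> e) = x \<longrightarrow> fin (\<sigma>' e) = None \<longrightarrow> (\<forall>j<J. \<exists>f. adj e f \<and> fin (\<sigma>' f) = Some j))"
  using J unfolding \<sigma>'_def
proof (induction J)
  case 0
  then show ?case using g by (simp add: exec_Nil same_slots_def)
next
  case (Suc J)
  define \<sigma>1 where "\<sigma>1 = exec N (map (trial_step x) [0..<J]) \<sigma>"
  define \<sigma>2 where "\<sigma>2 = run_step N (trial_step x J) \<sigma>1"
  have \<sigma>2: "exec N (map (trial_step x) [0..<Suc J]) \<sigma> = \<sigma>2"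
    by (simp add: \<sigma>2_def \<sigma>1_def exec_append exec_Cons exec_Nil)
  have IH: "same_slots \<sigma> \<sigma>1" "good K \<sigma>1"
    "\<And>e j. e \<in> E \<Longrightarrow> slot (\<sigma> e) = x \<Longrightarrow> fin (\<sigma>1 e) = None \<Longrightarrow> j < J \<Longrightarrow> \<exists>f. adj e f \<and> fin (\<sigma>1 f) = Some j"
    using Suc unfolding \<sigma>1_def by auto
  note ready1 = ready_same_slots[OF ready IH(1)]
  note tr = trial[OF ready1 IH(2), where x = x and j = J, folded \<sigma>2_def]
  have ss: "same_slots \<sigma>1 \<sigma>2" and g2: "good K \<sigma>2" using tr(1,2) Suc.prems by auto
  have "\<exists>f. adj e f \<and> fin (\<sigma>2 f) = Some j" if e: "e \<in> E" "slot (\<sigma> e) = x" "fin (\<sigma>2 e) = None" "j < Suc J" for e j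
  proof (cases "j = J")
    case True
    have "slot (\<sigma>1 e) = x" using e IH(1) by (simp add: same_slots_def)
    then obtain f where "adj e f" "fin (\<sigma>1 f) = Some J" using tr(3)[of e] e Suc.prems by auto
    then show ?thesis using ss True unfolding same_slots_def by blast
  next
    case False
    have "fin (\<sigma>1 e) = None" using e(3) ss unfolding same_slots_def by (metis not_Some_eq)
    then obtain f where "adj e f" "fin (\<sigma>1 f) = Some j" using IH(3)[of e j] e False by auto
    then show ?thesis using ss unfolding same_slots_def by blast
  qed
  then show ?case unfolding \<sigma>2 using same_slots_trans[OF IH(1) ss] g2 by blast
qed

text \<open>Pigeonhole: fewer than \<open>3 * D\<close> adjacent edges cannot block all
  \<open>3 * D\<close> colours.\<close>

lemma trial_block_done:
  assumes ready: "ready \<sigma>"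
    and g: "good (3 * D) \<sigma>" and e: "e \<in> E"
  shows "fin (exec N (map (trial_step (slot (\<sigma> e))) [0..<3 * D]) \<sigma> e) \<noteq> None"
proof
  let ?\<sigma> = "exec N (map (trial_step (slot (\<sigma> e))) [0..<3 * D]) \<sigma>"
  assume "fin (?\<sigma> e) = None"
  then have "\<forall>j<3 * D. \<exists>f. adj e f \<and> fin (?\<sigma> f) = Some j"
    using trial_block[OF ready g order_refl, of "slot (\<sigma> e)"] e by blast
  then have "{..<3 * D} \<subseteq> (\<lambda>f. the (fin (?\<sigma> f))) ` {f. adj e f}" by force
  then have "card {..<3 * D} \<le> card {f. adj e f}"
    by (intro surj_card_le) (use finite_star adj_star[OF e] in simp_all)
  then show False using card_adjacent_le[OF e] adj_star[OF e] by simp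
qed

lemma trial_steps_done:
  fixes xs :: "(nat \<times> nat \<times> nat \<times> nat) list"
  assumes ready: "ready \<sigma>"
    and g: "good (3 * D) \<sigma>"
  defines "\<sigma>' \<equiv> exec N (trial_steps (3 * D) xs) \<sigma>"
  shows "same_slots \<sigma> \<sigma>' \<and> good (3 * D) \<sigma>' \<and> (\<forall>e\<in>E. slot (\<sigma> e) \<in> set xs \<longrightarrow> fin (\<sigma>' e) \<noteq> None)"
  unfolding \<sigma>'_def
proof (induction xs rule: rev_induct)
  case Nil
  then show ?case using g by (simp add: trial_steps_def exec_Nil same_slots_def)
next
  case (snoc x xs)
  define \<sigma>1 where "\<sigma>1 = exec N (trial_steps (3 * D) xs) \<sigma>"
  define \<sigma>2 where "\<sigma>2 = exec N (map (trial_step x) [0..<3 * D]) \<sigma>1"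
  have \<sigma>2: "exec N (trial_steps (3 * D) (xs @ [x])) \<sigma> = \<sigma>2"
    by (simp add: \<sigma>2_def \<sigma>1_def trial_steps_def exec_append)
  have IH: "same_slots \<sigma> \<sigma>1" "good (3 * D) \<sigma>1" "\<And>e. e \<in> E \<Longrightarrow> slot (\<sigma> e) \<in> set xs \<Longrightarrow> fin (\<sigma>1 e) \<noteq> None"
    using snoc unfolding \<sigma>1_def by auto
  note ready1 = ready_same_slots[OF ready IH(1)]
  have ss: "same_slots \<sigma>1 \<sigma>2" and g2: "good (3 * D) \<sigma>2"
    using trial_block[OF ready1 IH(2) order_refl, of x] unfolding \<sigma>2_def by auto
  have "fin (\<sigma>2 e) \<noteq> None" if e: "e \<in> E" "slot (\<sigma> e) \<in> set (xs @ [x])" for e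
  proof (cases "slot (\<sigma> e) \<in> set xs")
    case True
    then show ?thesis using IH(3)[OF e(1)] ss unfolding same_slots_def by fastforce
  next
    case False
    then have "x = slot (\<sigma>1 e)" using e IH(1) by (simp add: same_slots_def)
    then show ?thesis using trial_block_done[OF ready1 IH(2) e(1)] unfolding \<sigma>2_def by simp
  qed
  then show ?case unfolding \<sigma>2 using same_slots_trans[OF IH(1) ss] g2 by blast
qed

lemma class_colouring:
  assumes leg: "legal m \<sigma>" "1 \<le> m" and none: "\<And>e. e \<in> E \<Longrightarrow> fin (\<sigma> e) = None"
    and M: "2 ^ colour_bits (2 * D) m r \<le> M"
  defines "\<sigma>' \<equiv> exec N (recolour_steps (2 * D) m r @ [rank_step] @ trial_steps (3 * D) (slots M (2 * D))) \<sigma>"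
  assumes e: "e \<in> E"
  shows "kl (\<sigma>' e) = \<kappa> e" "the (fin (\<sigma>' e)) < 3 * D" "adj e f \<Longrightarrow> the (fin (\<sigma>' e)) \<noteq> the (fin (\<sigma>' f))"
proof -
  define \<sigma>1 where "\<sigma>1 = exec N (recolour_steps (2 * D) m r) \<sigma>"
  define \<sigma>2 where "\<sigma>2 = run_step N rank_step \<sigma>1"
  have \<sigma>': "\<sigma>' = exec N (trial_steps (3 * D) (slots M (2 * D))) \<sigma>2"
    by (simp add: \<sigma>'_def \<sigma>1_def \<sigma>2_def exec_append exec_Cons)
  have l1: "legal (colour_bits (2 * D) m r) \<sigma>1" and f1: "fin (\<sigma>1 e) = fin (\<sigma> e)" for e
    using legal_recolour_steps[OF leg] unfolding \<sigma>1_def by auto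
  have l2: "legal (colour_bits (2 * D) m r) \<sigma>2" and r2: "ranked \<sigma>2" and f2: "fin (\<sigma>2 e) = fin (\<sigma> e)" for e
    using ranked_rank_step[OF l1] f1 unfolding \<sigma>2_def by auto
  have ready: "ready \<sigma>2" unfolding ready_def using legal_kl[OF l2] slot_neq[OF l2 r2] by blast
  have g: "good (3 * D) \<sigma>2" using none f2 by (simp add: good_def)
  have don: "same_slots \<sigma>2 \<sigma>'" "good (3 * D) \<sigma>'" "\<And>e. e \<in> E \<Longrightarrow> slot (\<sigma>2 e) \<in> set (slots M (2 * D)) \<Longrightarrow> fin (\<sigma>' e) \<noteq> None"
    using trial_steps_done[OF ready g, of "slots M (2 * D)"] unfolding \<sigma>' by auto
  have "slot (\<sigma>2 e) \<in> set (slots M (2 * D))" if "e \<in> E" for e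
  proof -
    have "col (\<sigma>2 e) b < M" for b using legal_less[OF l2 that] M by (meson order_less_le_trans)
    then show ?thesis using ranked_less[OF r2 that] unfolding set_slots by blast
  qed
  then have fin: "fin (\<sigma>' e) \<noteq> None" if "e \<in> E" for e using don(3) that by blast
  show "kl (\<sigma>' e) = \<kappa> e" using don(1) legal_kl[OF l2 e] by (simp add: same_slots_def)
  show "the (fin (\<sigma>' e)) < 3 * D" using fin[OF e] don(2) e unfolding good_def by auto
  show "the (fin (\<sigma>' e)) \<noteq> the (fin (\<sigma>' f))" if "adj e f"
    using fin[OF e] fin[of f] don(2) e that unfolding good_def adj_def by fastforce
qed

end

section \<open>Parameters\<close>

text \<open>The 2 gives \<open>2 ^ depth \<Delta> \<ge> 4 * \<Delta>\<close>, which exceeds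
  \<open>8 * \<Delta> / 3\<close> for positive \<open>\<Delta>\<close>; see
  \<open>levels_props\<close>.\<close>

definition depth :: "nat \<Rightarrow> nat" where "depth \<Delta> = bits \<Delta> + 2"
text \<open>Above the threshold, \<open>par_d\<close> is positive and \<open>3 * d * D\<^sup>2 \<le> a ^ 3\<close>, as the token game requires.\<close>

definition thr :: "nat \<Rightarrow> nat" where "thr l = 24 * (10000 * l ^ 2) ^ 3"
text \<open>The parameter \<open>l\<close> is the depth. The constants 32 and 10000 keep the slack
  of a level below \<open>D / (4 * l)\<close>, so that \<open>l\<close> levels increase the product
  of \<open>D\<close> and the number of classes by at most 4 / 3.\<close>

definition par_k :: "nat \<Rightarrow> nat \<Rightarrow> nat" where "par_k l D = D div (32 * l)"
definition par_a :: "nat \<Rightarrow> nat \<Rightarrow> nat" where "par_a l D = D div (10000 * l ^ 2)"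
definition par_d :: "nat \<Rightarrow> nat \<Rightarrow> nat" where "par_d l D = D div thr l"
definition par_P :: "nat \<Rightarrow> nat \<Rightarrow> nat" where "par_P l D = par_k l D div par_d l D + 1"
text \<open>Twice 32, since rounding down in \<open>par_k\<close> may lose a factor 2.\<close>

definition par_I :: "nat \<Rightarrow> nat" where "par_I l = 64 * l"
definition next_D :: "nat \<Rightarrow> nat \<Rightarrow> nat" where
  "next_D l D = (D + (4 * (par_k l D + 4 * par_a l D) + 8 * par_a l D * par_I l)) div 2"

lemma thr_pos: "1 \<le> l \<Longrightarrow> 0 < thr l"
  by (simp add: thr_def)

lemma div_bounds:
  fixes D A :: nat
  assumes "0 < A" "A \<le> D"
  shows "1 \<le> D div A" "A * (D div A) \<le> D" "D \<le> 2 * A * (D div A)"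
proof -
  show 1: "1 \<le> D div A" using assms by (simp add: Suc_leI div_greater_zero_iff)
  show "A * (D div A) \<le> D" by simp
  have "D = A * (D div A) + D mod A" by simp
  moreover have "D mod A < A" using assms by simp
  moreover have "A \<le> A * (D div A)" using 1 by simp
  ultimately show "D \<le> 2 * A * (D div A)" by linarith
qed

lemma thr_ge:
  assumes "1 \<le> l"
  shows "10000 * l ^ 2 \<le> thr l" "32 * l \<le> thr l"
proof -
  have "10000 * l ^ 2 * 1 \<le> (10000 * l ^ 2) * (10000 * l ^ 2) ^ 2"
    by (rule mult_le_mono2) (use assms in simp)
  then have A: "10000 * l ^ 2 \<le> (10000 * l ^ 2) ^ 3" by (simp only: power3_eq_cube power2_eq_square mult.assoc mult_1_right)
  also have "\<dots> \<le> thr l" unfolding thr_def by simp 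
  finally show *: "10000 * l ^ 2 \<le> thr l" .
  have "l * 1 \<le> l * l" using assms by (intro mult_le_mono2)
  then have "32 * l \<le> 10000 * l ^ 2" unfolding power2_eq_square by linarith
  then show "32 * l \<le> thr l" using * by linarith
qed

lemma params:
  assumes l: "1 \<le> l" and D: "thr l \<le> D"
  shows "0 < par_a l D" "par_a l D \<le> D" "3 * par_d l D * D^2 \<le> par_a l D ^ 3" "par_d l D \<le> par_a l D"
    "par_k l D \<le> par_P l D * par_d l D" "par_P l D * par_d l D \<le> par_k l D + par_d l D"
    "D \<le> par_k l D * par_I l" "4 * l * (4 * (par_k l D + 4 * par_a l D) + 8 * par_a l D * par_I l) \<le> D"
    "par_P l D \<le> 2 * thr l + 1"
proof -
  define A where "A = 10000 * l ^ 2"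
  have A0: "0 < A" and AD: "A \<le> D" using l thr_ge[OF l] D by (auto simp: A_def)
  note a = div_bounds[OF A0 AD, unfolded A_def, folded par_a_def, folded A_def]
  have thr: "thr l = 24 * A ^ 3" by (simp add: thr_def A_def)
  note d = div_bounds[OF thr_pos[OF l] D, folded par_d_def]
  have l32: "0 < 32 * l" "32 * l \<le> D" using l thr_ge[OF l] D by auto
  note k = div_bounds[OF l32, folded par_k_def]
  show "0 < par_a l D" using a by simp
  show "par_a l D \<le> D" by (simp add: par_a_def)
  show "par_d l D \<le> par_a l D" unfolding par_a_def par_d_def
    by (rule div_le_mono2) (use thr_ge[OF l] l in auto)
  show "3 * par_d l D * D^2 \<le> par_a l D ^ 3"
  proof -
    \<comment> \<open>The 24 in \<open>thr\<close> is 3 times 8: the 3 comes from the condition to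
      be proved, the 8 from rounding in \<open>par_a\<close>, cubed.\<close>
    have "D ^ 3 \<le> (2 * A * par_a l D) ^ 3" by (rule power_mono[OF a(3)]) simp
    also have "\<dots> = 8 * A ^ 3 * par_a l D ^ 3" by (simp add: power_mult_distrib)
    finally have 1: "D ^ 3 \<le> 8 * A ^ 3 * par_a l D ^ 3" .
    have "24 * A ^ 3 * par_d l D * D ^ 2 \<le> D * D ^ 2" using d(2) unfolding thr by (rule mult_le_mono1)
    also have "\<dots> = D ^ 3" by (simp add: power3_eq_cube power2_eq_square)
    finally have "24 * A ^ 3 * par_d l D * D ^ 2 \<le> 8 * A ^ 3 * par_a l D ^ 3" using 1 by linarith
    moreover have "(8 * A ^ 3) * (3 * par_d l D * D ^ 2) = 24 * A ^ 3 * par_d l D * D ^ 2" by (simp add: algebra_simps)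
    ultimately have "(8 * A ^ 3) * (3 * par_d l D * D ^ 2) \<le> (8 * A ^ 3) * par_a l D ^ 3" by linarith
    then show ?thesis using A0 by simp
  qed
  show "par_k l D \<le> par_P l D * par_d l D"
  proof -
    have "par_k l D = par_d l D * (par_k l D div par_d l D) + par_k l D mod par_d l D" by simp
    moreover have "par_k l D mod par_d l D \<le> par_d l D" using d(1) by (simp add: less_imp_le)
    moreover have "par_P l D * par_d l D = par_d l D * (par_k l D div par_d l D) + par_d l D"
      by (simp add: par_P_def algebra_simps)
    ultimately show ?thesis by linarith
  qed
  show "par_P l D * par_d l D \<le> par_k l D + par_d l D"
  proof -
    have "par_d l D * (par_k l D div par_d l D) \<le> par_k l D" by simp
    moreover have "par_P l D * par_d l D = par_d l D * (par_k l D div par_d l D) + par_d l D"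
      by (simp add: par_P_def algebra_simps)
    ultimately show ?thesis by linarith
  qed
  show "D \<le> par_k l D * par_I l" using k(3) by (simp add: par_I_def algebra_simps)
  have la: "l * par_a l D \<le> l ^ 2 * par_a l D" using l by (simp add: power2_eq_square)
  \<comment> \<open>In units of \<open>D\<close>, the three terms are at most 16 / 32, 64 / 10000
    and 2048 / 10000.\<close>
  have "4 * l * (4 * (par_k l D + 4 * par_a l D) + 8 * par_a l D * par_I l) =
      16 * (l * par_k l D) + 64 * (l * par_a l D) + 2048 * (l ^ 2 * par_a l D)"
    by (simp add: par_I_def algebra_simps power2_eq_square)
  moreover have "32 * (l * par_k l D) \<le> D" using k(2) by (simp add: mult.assoc)
  moreover have "10000 * (l ^ 2 * par_a l D) \<le> D" using a(2) by (simp add: A_def mult.assoc)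
  ultimately show "4 * l * (4 * (par_k l D + 4 * par_a l D) + 8 * par_a l D * par_I l) \<le> D"
    using la by linarith
  have "par_k l D \<le> D" by (simp add: par_k_def)
  then have "par_k l D div par_d l D \<le> D div par_d l D" by (rule div_le_mono)
  also have "\<dots> \<le> (2 * thr l * par_d l D) div par_d l D" using d(3) by (rule div_le_mono)
  also have "\<dots> = 2 * thr l" using d(1) by simp
  finally show "par_P l D \<le> 2 * thr l + 1" by (simp add: par_P_def)
qed

fun Dseq :: "nat \<Rightarrow> nat \<Rightarrow> nat \<Rightarrow> nat" where
  "Dseq l \<Delta> 0 = 2 * \<Delta>"
| "Dseq l \<Delta> (Suc j) = next_D l (Dseq l \<Delta> j)"

lemma next_D_le: "1 \<le> l \<Longrightarrow> thr l \<le> D \<Longrightarrow> 8 * l * next_D l D \<le> (4 * l + 1) * D"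
proof -
  assume l: "1 \<le> l" "thr l \<le> D"
  let ?X = "4 * (par_k l D + 4 * par_a l D) + 8 * par_a l D * par_I l"
  have "2 * next_D l D \<le> D + ?X" unfolding next_D_def by simp
  then have "4 * l * (2 * next_D l D) \<le> 4 * l * (D + ?X)" by (rule mult_le_mono2)
  also have "\<dots> = 4 * l * D + 4 * l * ?X" by (rule distrib_left)
  also have "\<dots> \<le> 4 * l * D + D" using params(8)[OF l] by simp
  finally show ?thesis by (simp add: algebra_simps)
qed

text \<open>With \<open>x = 1 / (4 * l)\<close> this is \<open>(1 + x) ^ j \<le> 4 / 3\<close>:
  Bernoulli gives \<open>(1 - x) ^ j \<ge> 3 / 4\<close>, and
  \<open>(1 - x ^ 2) ^ j \<le> 1\<close>.\<close>

lemma power_ratio: "1 \<le> l \<Longrightarrow> j \<le> l \<Longrightarrow> 3 * (4 * l + 1) ^ j \<le> 4 * (4 * l) ^ (j::nat)"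
proof -
  assume l: "1 \<le> l" "j \<le> l"
  define x where "x = 1 / (4 * real l)"
  have x: "0 < x" "x \<le> 1" "real j * x \<le> 1 / 4" using l by (auto simp: x_def field_simps)
  have "3 / 4 \<le> 1 + real j * (- x)" using x by simp
  also have "\<dots> \<le> (1 + (- x)) ^ j" by (rule Bernoulli_inequality) (use x in simp)
  finally have "3 / 4 * (1 + x) ^ j \<le> (1 - x) ^ j * (1 + x) ^ j" using x by (intro mult_right_mono) auto
  also have "\<dots> = (1 - x ^ 2) ^ j" by (simp add: power_mult_distrib[symmetric] algebra_simps power2_eq_square)
  also have "\<dots> \<le> 1" using x by (intro power_le_one) (auto simp: power_le_one abs_le_square_iff)
  finally have "3 * (1 + x) ^ j \<le> 4" by simp
  then have "3 * (1 + x) ^ j * (4 * real l) ^ j \<le> 4 * (4 * real l) ^ j" by (intro mult_right_mono) auto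
  then have "3 * ((1 + x) ^ j * (4 * real l) ^ j) \<le> 4 * (4 * real l) ^ j" by (simp only: mult.assoc)
  moreover have "(1 + x) * (4 * real l) = 4 * real l + 1" using l by (simp add: x_def field_simps)
  then have "(1 + x) ^ j * (4 * real l) ^ j = (4 * real l + 1) ^ j"
    unfolding power_mult_distrib[symmetric] by simp
  ultimately have "real (3 * (4 * l + 1) ^ j) \<le> real (4 * (4 * l) ^ j)"
    by (simp only: of_nat_mult of_nat_power of_nat_add of_nat_numeral of_nat_1)
  then show ?thesis by (simp only: of_nat_le_iff)
qed

lemma Dseq_le:
  assumes l: "1 \<le> l" "j \<le> l" and big: "\<And>i. i < j \<Longrightarrow> thr l \<le> Dseq l \<Delta> i"
  shows "3 * (2 ^ j * Dseq l \<Delta> j) \<le> 8 * \<Delta>"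
proof -
  have "(8 * l) ^ j * Dseq l \<Delta> j \<le> (4 * l + 1) ^ j * (2 * \<Delta>)" using big
  proof (induction j)
    case (Suc j)
    have "(8 * l) ^ Suc j * Dseq l \<Delta> (Suc j) = (8 * l) ^ j * (8 * l * next_D l (Dseq l \<Delta> j))" by simp
    also have "\<dots> \<le> (8 * l) ^ j * ((4 * l + 1) * Dseq l \<Delta> j)"
      by (rule mult_le_mono2[OF next_D_le]) (use l Suc.prems in auto)
    also have "\<dots> = (4 * l + 1) * ((8 * l) ^ j * Dseq l \<Delta> j)" by (rule mult.left_commute)
    also have "\<dots> \<le> (4 * l + 1) * ((4 * l + 1) ^ j * (2 * \<Delta>))"
      by (rule mult_le_mono2) (use Suc in auto)
    also have "\<dots> = (4 * l + 1) ^ Suc j * (2 * \<Delta>)" by (simp only: power_Suc mult.assoc)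
    finally show ?case .
  qed simp
  moreover have "(8 * l) ^ j = (4 * l) ^ j * 2 ^ j" unfolding power_mult_distrib[symmetric] by simp
  moreover have "3 * (4 * l + 1) ^ j * (2 * \<Delta>) \<le> 4 * (4 * l) ^ j * (2 * \<Delta>)"
    by (rule mult_le_mono1[OF power_ratio[OF l]])
  moreover have arith: "q * (3 * (r * x)) \<le> q * (8 * y)"
    if "u * x \<le> t * (2 * y)" "u = q * r" "3 * t * (2 * y) \<le> 4 * q * (2 * y)" for q r u t x y :: nat
  proof -
    have "q * (3 * (r * x)) = 3 * (u * x)" unfolding that(2) by (simp only: mult.assoc mult.left_commute)
    also have "\<dots> \<le> 3 * (t * (2 * y))" by (rule mult_le_mono2[OF that(1)])
    also have "\<dots> = 3 * t * (2 * y)" by (simp only: mult.assoc)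
    also note that(3)
    also have "4 * q * (2 * y) = q * (8 * y)" by simp
    finally show ?thesis .
  qed
  ultimately have "(4 * l) ^ j * (3 * (2 ^ j * Dseq l \<Delta> j)) \<le> (4 * l) ^ j * (8 * \<Delta>)" by (intro arith)
  then show ?thesis using l by simp
qed

definition levels :: "nat \<Rightarrow> nat" where
  "levels \<Delta> = (LEAST j. Dseq (depth \<Delta>) \<Delta> j < thr (depth \<Delta>))"

definition final_D :: "nat \<Rightarrow> nat" where
  "final_D \<Delta> = Dseq (depth \<Delta>) \<Delta> (levels \<Delta>)"

lemma depth_pos: "1 \<le> depth \<Delta>"
  by (simp add: depth_def)

text \<open>If \<open>D\<close> stayed above the threshold for \<open>depth \<Delta>\<close> levels,
  then \<open>D \<ge> 1\<close> and \<open>Dseq_le\<close> would give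
  \<open>3 * 2 ^ depth \<Delta> \<le> 8 * \<Delta>\<close>. As
  \<open>2 ^ depth \<Delta> \<ge> 4 * \<Delta>\<close>, this leaves \<open>\<Delta> = 0\<close>,
  where \<open>D\<close> is 0 from the start.\<close>

lemma levels_props:
  shows "levels \<Delta> \<le> depth \<Delta>" "final_D \<Delta> < thr (depth \<Delta>)" "3 * (2 ^ levels \<Delta> * final_D \<Delta>) \<le> 8 * \<Delta>"
    "i < levels \<Delta> \<Longrightarrow> thr (depth \<Delta>) \<le> Dseq (depth \<Delta>) \<Delta> i"
proof -
  let ?l = "depth \<Delta>"
  have ex: "\<exists>j\<le>?l. Dseq ?l \<Delta> j < thr ?l"
  proof (rule ccontr)
    assume "\<not> ?thesis"
    then have big: "\<And>i. i \<le> ?l \<Longrightarrow> thr ?l \<le> Dseq ?l \<Delta> i" by (auto simp: not_less)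
    have D1: "1 \<le> Dseq ?l \<Delta> ?l" using big[of ?l] thr_pos[OF depth_pos, of \<Delta>] by simp
    have "3 * (2 ^ ?l * Dseq ?l \<Delta> ?l) \<le> 8 * \<Delta>" using Dseq_le[OF depth_pos order_refl, of \<Delta> \<Delta>] big by simp
    moreover have "2 ^ ?l * 1 \<le> 2 ^ ?l * Dseq ?l \<Delta> ?l" using D1 by (rule mult_le_mono2)
    moreover have "4 * \<Delta> \<le> 2 ^ ?l" using le_bits[of \<Delta>] by (simp add: depth_def)
    ultimately have "\<Delta> = 0" by linarith
    then show False using big[of 0] thr_pos[OF depth_pos, of \<Delta>] by simp
  qed
  then obtain j where j: "j \<le> ?l" "Dseq ?l \<Delta> j < thr ?l" by blast
  show "final_D \<Delta> < thr ?l" unfolding final_D_def levels_def by (rule LeastI[of "\<lambda>j. Dseq (depth \<Delta>) \<Delta> j < thr (depth \<Delta>)", OF j(2)])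
  have "levels \<Delta> \<le> j" unfolding levels_def by (rule Least_le[of "\<lambda>j. Dseq (depth \<Delta>) \<Delta> j < thr (depth \<Delta>)", OF j(2)])
  then show le: "levels \<Delta> \<le> ?l" using j by simp
  show big: "thr ?l \<le> Dseq ?l \<Delta> i" if "i < levels \<Delta>" for i
    using not_less_Least[OF that[unfolded levels_def]] by simp
  show "3 * (2 ^ levels \<Delta> * final_D \<Delta>) \<le> 8 * \<Delta>"
    unfolding final_D_def by (rule Dseq_le[OF depth_pos le big])
qed

text \<open>A crude bound for all rounds, needed for message sizes. By
  \<open>bits m \<le> m div 4 + 3\<close>, a round halves the number of bits and adds
  \<open>7 + 2 * bits d\<close>; twice this summand is the fixed point.\<close>

lemma colour_bits_le: "colour_bits d m i \<le> m + 14 + 4 * bits d"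
proof (induction i)
  case (Suc i)
  have "bits m \<le> m div 4 + 3" for m
    unfolding bits_def
  proof (rule Least_le)
    have "m \<le> 8 * (m div 4 + 1)" by presburger
    also have "m div 4 + 1 \<le> 2 ^ (m div 4)" using less_exp[of "m div 4"] by (simp add: Suc_le_eq)
    finally show "m \<le> 2 ^ (m div 4 + 3)" by (simp add: power_add)
  qed
  from this[of "colour_bits d m i"] show ?case using Suc by (simp add: next_bits_def)
qed simp

section \<open>The complete algorithm\<close>

lemma decode_less: "decode xs < 2 ^ length xs"
  by (induction xs) (auto simp: of_bool_def)

lemma decode_inj: "length xs = length ys \<Longrightarrow> decode xs = decode ys \<Longrightarrow> xs = ys"
proof (induction xs ys rule: list_induct2)
  case (Cons x xs y ys)
  have "x = y" using arg_cong[OF Cons.prems, of even] by (auto simp: of_bool_def split: if_splits)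
  then show ?case using Cons by simp
qed simp

definition split_steps :: "nat \<Rightarrow> nat \<Rightarrow> estate step list" where
  "split_steps \<Delta> j = (let l = depth \<Delta>; D = Dseq l \<Delta> j in
     level_steps \<Delta> (par_k l D) (par_a l D) (par_d l D) (par_P l D) (par_I l))"

definition split_prog :: "nat \<Rightarrow> estate step list" where
  "split_prog \<Delta> = concat (map (split_steps \<Delta>) [0..<levels \<Delta>])"

text \<open>The exponent is the bound of \<open>colour_bits_final\<close>, so all nodes derive the
  same schedule from \<open>n\<close> and \<open>\<Delta>\<close>.\<close>

definition final_prog :: "nat \<Rightarrow> nat \<Rightarrow> nat \<Rightarrow> fstate step list" where
  "final_prog c n \<Delta> = recolour_steps (2 * final_D \<Delta>) (c * bits n + 1) (log_star n - 1) @ [rank_step] @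
     trial_steps (3 * final_D \<Delta>) (slots (2 ^ (4 * bits (2 * final_D \<Delta>) + 8 * c + 42)) (2 * final_D \<Delta>))"

lemma ids_exec:
  assumes "\<And>st s m. st \<in> set xs \<Longrightarrow> ids (upd st s m) = ids s"
  shows "ids (exec N xs \<sigma> e) = ids (\<sigma> e)"
  using assms
proof (induction xs arbitrary: \<sigma>)
  case (Cons x xs)
  then show ?case by (simp add: exec_Cons run_step_def)
qed (simp add: exec_Nil)

lemma ids_split_prog: "ids (exec N (split_prog \<Delta>) \<sigma> e) = ids (\<sigma> e)"
proof (rule ids_exec)
  fix st s m assume "st \<in> set (split_prog \<Delta>)"
  then obtain k a d P I where "st \<in> set (level_steps \<Delta> k a d P I)"
    by (auto simp: split_prog_def split_steps_def Let_def)
  then have "st \<in> {height_step \<Delta>, accept_step k, full_step \<Delta> a d, propose_step k a, move_step a, close_step}"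
    using set_level_steps by blast
  then show "ids (upd st s m) = ids s"
    by (auto simp: height_step_def accept_step_def full_step_def propose_step_def move_step_def close_step_def)
qed

lemma small_split_prog: "st \<in> set (split_prog \<Delta>) \<Longrightarrow> \<Delta> \<le> n \<Longrightarrow> small_step 3 n \<Delta> st"
  by (auto simp: split_prog_def split_steps_def Let_def intro: small_level_steps)

lemma length_concat_le: "(\<And>xs. xs \<in> set xss \<Longrightarrow> length xs \<le> B) \<Longrightarrow> length (concat xss) \<le> length xss * B"
proof (induction xss)
  case (Cons xs xss)
  then have "length xs \<le> B" "length (concat xss) \<le> length xss * B" by auto
  then show ?case by simp
qed simp

lemma length_split_prog: "length (split_prog \<Delta>) \<le> depth \<Delta> * (64 * depth \<Delta> * (5 + 6 * thr (depth \<Delta>)) + 1)"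
proof -
  have "length (split_prog \<Delta>) \<le> length (map (split_steps \<Delta>) [0..<levels \<Delta>]) * (64 * depth \<Delta> * (5 + 6 * thr (depth \<Delta>)) + 1)"
    unfolding split_prog_def
  proof (rule length_concat_le)
    fix xs assume "xs \<in> set (map (split_steps \<Delta>) [0..<levels \<Delta>])"
    then obtain j where j: "j < levels \<Delta>" "xs = split_steps \<Delta> j" by auto
    have "par_P (depth \<Delta>) (Dseq (depth \<Delta>) \<Delta> j) \<le> 2 * thr (depth \<Delta>) + 1"
      by (rule params(9)[OF depth_pos]) (rule levels_props(4)[OF j(1)])
    then have le: "2 + par_P (depth \<Delta>) (Dseq (depth \<Delta>) \<Delta> j) * 3 \<le> 5 + 6 * thr (depth \<Delta>)" by linarith
    show "length xs \<le> 64 * depth \<Delta> * (5 + 6 * thr (depth \<Delta>)) + 1"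
      unfolding j split_steps_def Let_def length_level_steps par_I_def
      by (rule add_mono[OF mult_le_mono2[OF le] order_refl])
  qed
  also have "\<dots> \<le> depth \<Delta> * (64 * depth \<Delta> * (5 + 6 * thr (depth \<Delta>)) + 1)"
    using levels_props(1)[of \<Delta>] by (intro mult_le_mono1) simp
  finally show ?thesis .
qed

lemma final_D_le: "final_D \<Delta> \<le> 3 * \<Delta>"
proof -
  have "final_D \<Delta> \<le> 2 ^ levels \<Delta> * final_D \<Delta>" by simp
  then show ?thesis using levels_props(3)[of \<Delta>] by linarith
qed

lemma power_bits_le: "2 ^ bits m \<le> max 1 (2 * m)"
  using bits_le[of m] by (cases "m = 0") (auto simp: bits_def Least_eq_0)

lemma small_final_prog:
  assumes "2 \<le> n" "\<Delta> \<le> n" "st \<in> set (final_prog c n \<Delta>)"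
  shows "small_step (2 * c + 35) n \<Delta> st"
proof -
  let ?d = "2 * final_D \<Delta>" and ?m = "c * bits n + 1"
  have trial: "\<exists>x j. st = trial_step x j" if "st \<in> set (trial_steps K xs)" for K xs
  proof -
    have "set (trial_steps K xs) = (\<Union>x\<in>set xs. trial_step x ` {0..<K})" by (simp add: trial_steps_def)
    then show ?thesis using that by blast
  qed
  have st: "(\<exists>i. st = recolour_step ?d (colour_bits ?d ?m i)) \<or> st = rank_step \<or> (\<exists>x j. st = trial_step x j)"
    using assms(3) trial unfolding final_prog_def recolour_steps_def by (simp del: split_paired_Ex) blast
  have n_le: "n \<le> n ^ (2 * c + 35)" using assms(1) self_le_power[of n "2 * c + 35"] by simp
  have rec: "2 ^ next_bits ?d (colour_bits ?d ?m i) \<le> n ^ (2 * c + 35)" for i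
  proof -
    have nn: "2 * n \<le> n ^ 2" "16 * n \<le> n ^ 5"
    proof -
      show "2 * n \<le> n ^ 2" unfolding power2_eq_square by (rule mult_le_mono1[OF assms(1)])
      have "2 ^ 4 * n \<le> n ^ 4 * n" by (rule mult_le_mono1[OF power_mono[OF assms(1)]]) simp
      then show "16 * n \<le> n ^ 5" using power_Suc2[of n 4] by simp
    qed
    have "(2::nat) ^ next_bits ?d (colour_bits ?d ?m i) \<le> 2 ^ (?m + 14 + 4 * bits ?d)"
      using colour_bits_le[of ?d ?m "Suc i"] by (intro power_increasing) auto
    also have "\<dots> = (2 ^ bits n) ^ c * 2 ^ 15 * (2 ^ bits ?d) ^ 4"
      by (simp add: power_add power_mult[symmetric] mult.commute[of c] mult.commute[of 4])
    also have "\<dots> \<le> (n ^ 2) ^ c * n ^ 15 * (n ^ 5) ^ 4"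
    \<comment> \<open>The 35 is 15 for \<open>2 ^ 15\<close> plus 4 times 5 for the factor with
      \<open>bits (2 * final_D \<Delta>)\<close>.\<close>
    proof (intro mult_le_mono power_mono)
      show "2 ^ bits n \<le> n ^ 2" using bits_le[of n] nn assms(1) by linarith
      show "2 ^ bits ?d \<le> n ^ 5" using power_bits_le[of ?d] nn final_D_le[of \<Delta>] assms by linarith
    qed (use assms in auto)
    also have "\<dots> = n ^ (2 * c + 35)" by (simp add: power_add power_mult[symmetric] mult.commute)
    finally show ?thesis .
  qed
  have "msg st L i \<le> n ^ (2 * c + 35)" if L: "i < length L" "length L \<le> n" for L i
    using st
  proof (elim disjE exE)
    fix i' assume "st = recolour_step ?d (colour_bits ?d ?m i')"
    then have "msg st L i \<le> 2 ^ next_bits ?d (colour_bits ?d ?m i')"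
      by (simp add: recolour_step_def split: prod.split)
    then show ?thesis using rec[of i'] by linarith
  next
    assume "st = rank_step"
    then have "msg st L i \<le> card {..<i}"
      by (simp only: rank_step_def step.select_convs) (rule card_mono; auto)
    then show ?thesis using L n_le by simp
  next
    fix x j assume "st = trial_step x j"
    then have "msg st L i \<le> 1" by (simp add: trial_step_def)
    then show ?thesis using n_le assms(1) by linarith
  qed
  then show ?thesis using assms by (auto simp: small_step_def)
qed

lemma length_final_prog:
  "length (final_prog c n \<Delta>) = log_star n - 1 + 1 +
     (2 ^ (4 * bits (2 * final_D \<Delta>) + 8 * c + 42)) ^ 2 * (12 * final_D \<Delta> ^ 3)"
  by (simp add: final_prog_def recolour_steps_def length_trial_steps length_slots power2_eq_square power3_eq_cube)

definition init_edge :: "(bool \<Rightarrow> nat) \<Rightarrow> estate" where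
  "init_edge f = \<lparr>ids = f, cls = [], ori = None, hgt = (\<lambda>_. 0), cnt = (\<lambda>_. 0), used = False, ful = (\<lambda>_. False), prp = False\<rparr>"

definition to_fstate :: "estate \<Rightarrow> fstate" where
  "to_fstate s = \<lparr>kl = cls s, col = ids s, rk = (\<lambda>_. 0), fin = None\<rparr>"

definition split_result :: "network \<Rightarrow> nat set \<Rightarrow> estate" where
  "split_result N = exec N (split_prog (max_deg N)) (\<lambda>e. init_edge (\<lambda>b. ident N (endp N e b)))"

definition final_result :: "nat \<Rightarrow> network \<Rightarrow> nat set \<Rightarrow> fstate" where
  "final_result c N = exec N (final_prog c (num_nodes N) (max_deg N)) (\<lambda>e. to_fstate (split_result N e))"

text \<open>The class is the leading digit to the base \<open>3 * D\<close>, the colour within it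
  the last one; the 1 shifts the range to start at 1.\<close>

definition colour :: "nat \<Rightarrow> network \<Rightarrow> nat set \<Rightarrow> nat" where
  "colour c N e = (let s = final_result c N e in decode (kl s) * (3 * final_D (max_deg N)) + the (fin s) + 1)"

lemma computable_colour:
  "computable p (\<lambda>n \<Delta>. 1 + length (split_prog \<Delta>) + length (final_prog c n \<Delta>)) (colour c)"
proof -
  have "computable p (\<lambda>_ _. 1) (\<lambda>N e. init_edge (\<lambda>b. ident N (endp N e b)))"
    using computable_map[OF computable_idents, where f = "\<lambda>_ _. init_edge"] .
  then have "computable p (\<lambda>n \<Delta>. 1 + length (split_prog \<Delta>)) split_result"
    using computable_exec[where prog = "\<lambda>_. split_prog" and c = 3] small_split_prog
    unfolding split_result_def by blast
  then have "computable p (\<lambda>n \<Delta>. 1 + length (split_prog \<Delta>)) (\<lambda>N e. to_fstate (split_result N e))"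
    by (rule computable_map[where f = "\<lambda>_ _. to_fstate"])
  then have "computable p (\<lambda>n \<Delta>. 1 + length (split_prog \<Delta>) + length (final_prog c n \<Delta>)) (final_result c)"
    using computable_exec[where prog = "final_prog c" and c = "2 * c + 35"] small_final_prog
    unfolding final_result_def by blast
  then show ?thesis
    using computable_map[where f = "\<lambda>_ \<Delta> s. decode (kl s) * (3 * final_D \<Delta>) + the (fin s) + 1"]
    unfolding colour_def Let_def by blast
qed

context net
begin

lemma split_result_props:
  shows "bip_graph E (nd (split_result N)) (final_D \<Delta>) \<Delta>"
    and "e \<in> E \<Longrightarrow> length (cls (split_result N e)) = levels \<Delta>"
    and "ids (split_result N e) b = ident N (endp N e b)"
proof -
  define S where "S i = exec N (concat (map (split_steps \<Delta>) [0..<i])) (\<lambda>e. init_edge (\<lambda>b. ident N (endp N e b)))" for i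
  have main: "bip_graph E (nd (S i)) (Dseq (depth \<Delta>) \<Delta> i) \<Delta> \<and>
      (\<forall>e\<in>E. ori (S i e) = None \<and> length (cls (S i e)) = i)" if "i \<le> levels \<Delta>" for i
    using that
  proof (induction i)
    case 0
    have "bip_graph E (nd (S 0)) (2 * \<Delta>) \<Delta>"
      by (rule bip_graph_halfnode) (simp only: mult_2 add_mono inc_halfnode_le)
    then show ?case by (simp add: S_def exec_Nil init_edge_def)
  next
    case (Suc i)
    let ?l = "depth \<Delta>" and ?D = "Dseq (depth \<Delta>) \<Delta> i"
    have S: "S (Suc i) = exec N (level_steps \<Delta> (par_k ?l ?D) (par_a ?l ?D) (par_d ?l ?D) (par_P ?l ?D) (par_I ?l)) (S i)"
      by (simp add: S_def exec_append split_steps_def Let_def)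
    note D = params[OF depth_pos levels_props(4)[of i \<Delta>]]
    note lev = split_level[of "S i" ?D "par_a ?l ?D" "par_d ?l ?D" "par_k ?l ?D" "par_P ?l ?D" "par_I ?l", folded S]
    show ?case
      using lev D Suc by (simp add: next_D_def)
  qed
  have S: "split_result N = S (levels \<Delta>)" by (simp add: split_result_def S_def split_prog_def)
  show "bip_graph E (nd (split_result N)) (final_D \<Delta>) \<Delta>"
    using main[OF order_refl] unfolding S final_D_def by blast
  show "e \<in> E \<Longrightarrow> length (cls (split_result N e)) = levels \<Delta>"
    using main[OF order_refl] unfolding S by blast
  show "ids (split_result N e) b = ident N (endp N e b)"
    by (simp add: split_result_def ids_split_prog init_edge_def)
qed

lemma colour_proper:
  assumes c: "\<And>n. 2 \<le> n \<Longrightarrow> poly p n \<le> n ^ c" "1 \<le> c" and e: "e \<in> E"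
  shows "colour c N e \<in> {1..8 * \<Delta>}"
    and "f \<in> E \<Longrightarrow> e \<noteq> f \<Longrightarrow> e \<inter> f \<noteq> {} \<Longrightarrow> colour c N e \<noteq> colour c N f"
proof -
  let ?D = "final_D \<Delta>" and ?\<kappa> = "\<lambda>e. cls (split_result N e)" and ?\<sigma> = "\<lambda>e. to_fstate (split_result N e)"
  interpret class_graph p N ?\<kappa> ?D
    by (intro class_graph.intro class_graph_axioms.intro net_axioms split_result_props(1))
  let ?m = "c * bits (num_nodes N) + 1"
  have n2: "2 \<le> num_nodes N"
    using two_nodes[OF endp_node[OF e] port_props(1)[OF e, of False]] .
  have id_less: "ident N v < 2 ^ ?m" if "v \<in> nodes N" for v
  proof -
    have "ident N v \<le> poly p (num_nodes N)" using valid that by (auto simp: valid_network_def)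
    also have "\<dots> \<le> num_nodes N ^ c" using c(1)[OF n2] .
    also have "\<dots> \<le> (2 ^ bits (num_nodes N)) ^ c" by (intro power_mono le_bits) simp
    also have "\<dots> = 2 ^ (c * bits (num_nodes N))" by (simp add: power_mult[symmetric] mult.commute)
    also have "\<dots> < 2 ^ ?m" by simp
    finally show ?thesis .
  qed
  have leg: "legal ?m ?\<sigma>"
    unfolding legal_def
  proof (intro conjI ballI allI impI)
    fix e b assume "e \<in> E"
    then show "kl (?\<sigma> e) = ?\<kappa> e" "col (?\<sigma> e) False \<noteq> col (?\<sigma> e) True" "col (?\<sigma> e) b < 2 ^ ?m"
      using ident_endp[of e] id_less[OF endp_node] by (simp_all add: to_fstate_def split_result_props)
  qed (simp add: to_fstate_def split_result_props)
  have none: "fin (?\<sigma> e) = None" for e by (simp add: to_fstate_def)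
  have M: "2 ^ colour_bits (2 * ?D) ?m (log_star (num_nodes N) - 1) \<le> (2::nat) ^ (4 * bits (2 * ?D) + 8 * c + 42)"
    by (intro power_increasing colour_bits_final n2 c(2)) simp
  note fc = class_colouring[OF leg _ none M, folded final_prog_def, folded final_result_def]
  have kl: "kl (final_result c N e) = ?\<kappa> e" "the (fin (final_result c N e)) < 3 * ?D" if "e \<in> E" for e
    using fc(1,2)[OF _ that] by auto
  have dec: "decode (?\<kappa> e) + 1 \<le> 2 ^ levels \<Delta>" if "e \<in> E" for e
    using decode_less[of "?\<kappa> e"] split_result_props(2)[OF that] by simp
  have "colour c N e \<le> (decode (?\<kappa> e) + 1) * (3 * ?D)" using kl[OF e] by (simp add: colour_def Let_def)
  also have "\<dots> \<le> 2 ^ levels \<Delta> * (3 * ?D)" by (rule mult_le_mono1[OF dec[OF e]])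
  also have "\<dots> = 3 * (2 ^ levels \<Delta> * ?D)" by (rule mult.left_commute)
  also have "\<dots> \<le> 8 * \<Delta>" by (rule levels_props(3))
  finally show "colour c N e \<in> {1..8 * \<Delta>}" by (simp add: colour_def Let_def)
  show "colour c N e \<noteq> colour c N f" if f: "f \<in> E" "e \<noteq> f" "e \<inter> f \<noteq> {}"
  proof
    assume eq: "colour c N e = colour c N f"
    let ?x = "the (fin (final_result c N e))" and ?y = "the (fin (final_result c N f))"
    have eq: "decode (?\<kappa> e) * (3 * ?D) + ?x = decode (?\<kappa> f) * (3 * ?D) + ?y"
      using eq kl[OF e] kl[OF f(1)] by (simp add: colour_def Let_def)
    have xy: "?x < 3 * ?D" "?y < 3 * ?D" using kl(2)[OF e] kl(2)[OF f(1)] by auto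
    have "decode (?\<kappa> e) = (decode (?\<kappa> e) * (3 * ?D) + ?x) div (3 * ?D)" using xy by simp
    also have "\<dots> = decode (?\<kappa> f)" unfolding eq using xy by simp
    finally have d: "decode (?\<kappa> e) = decode (?\<kappa> f)" .
    then have "?\<kappa> e = ?\<kappa> f" using decode_inj split_result_props(2) e f(1) by metis
    then have "adj e f" using f by (auto simp: adj_def)
    then have "?x \<noteq> ?y" using fc(3)[OF _ e] by simp
    then show False using eq d by simp
  qed
qed

end

section \<open>Running time\<close>

definition total_rounds :: "nat \<Rightarrow> nat \<Rightarrow> nat \<Rightarrow> nat" where
  "total_rounds c n \<Delta> = 1 + length (split_prog \<Delta>) + length (final_prog c n \<Delta>)"

text \<open>The threshold is of order \<open>l ^ 6\<close>. The trials need \<open>thr l ^ 8\<close>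
  for pairs of vertex colours and \<open>thr l ^ 3\<close> for ranks and edge colours, up to
  constants, which makes \<open>l ^ 66\<close>.\<close>

lemma total_rounds_le: "\<exists>C0. \<forall>n \<Delta>. total_rounds c n \<Delta> \<le> C0 * depth \<Delta> ^ 66 + log_star n"
proof (intro exI allI)
  fix n \<Delta>
  define tc :: nat where "tc = 24 * 10000 ^ 3"
  define l where "l = depth \<Delta>"
  have l: "1 \<le> l" unfolding l_def by (rule depth_pos)
  have thr: "thr l = tc * l ^ 6" by (simp add: thr_def tc_def power_mult_distrib power_mult[symmetric])
  have thr1: "1 \<le> thr l" using thr_pos[OF l] by simp
  have pow: "l ^ i \<le> l ^ 66" if "i \<le> 66" for i using power_increasing[OF that l] .
  have "length (split_prog \<Delta>) \<le> l * (64 * l * (5 + 6 * thr l) + 1)" unfolding l_def by (rule length_split_prog)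
  also have "\<dots> \<le> l * (64 * l * (11 * thr l) + l * thr l)"
    using thr1 l by (intro mult_le_mono2 add_mono) (auto simp: Suc_le_eq)
  also have "\<dots> = 705 * tc * l ^ 8" by (simp add: thr algebra_simps power_numeral_reduce)
  also have "\<dots> \<le> 705 * tc * l ^ 66" by (intro mult_le_mono2 pow) simp
  finally have 1: "length (split_prog \<Delta>) \<le> 705 * tc * l ^ 66" .
  define D where "D = final_D \<Delta>"
  have D: "D \<le> thr l" unfolding D_def l_def using levels_props(2)[of \<Delta>] by simp
  have "2 ^ bits (2 * D) \<le> 4 * thr l" using power_bits_le[of "2 * D"] D thr1 by linarith
  then have "(2 ^ bits (2 * D)) ^ 4 * 2 ^ (8 * c + 42) \<le> (4 * thr l) ^ 4 * 2 ^ (8 * c + 42)"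
    by (intro mult_le_mono1 power_mono) auto
  moreover have "(2::nat) ^ (4 * bits (2 * D) + 8 * c + 42) = (2 ^ bits (2 * D)) ^ 4 * 2 ^ (8 * c + 42)"
    by (simp add: power_add power_mult[symmetric] mult.commute)
  ultimately have "(2::nat) ^ (4 * bits (2 * D) + 8 * c + 42) \<le> (4 * thr l) ^ 4 * 2 ^ (8 * c + 42)" by simp
  then have "((2::nat) ^ (4 * bits (2 * D) + 8 * c + 42)) ^ 2 * (12 * D ^ 3) \<le>
      ((4 * thr l) ^ 4 * 2 ^ (8 * c + 42)) ^ 2 * (12 * thr l ^ 3)"
    by (intro mult_le_mono power_mono mult_le_mono2 D) auto
  also have "\<dots> = 12 * 4 ^ 8 * (2 ^ (8 * c + 42)) ^ 2 * thr l ^ 11"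
    by (simp add: power_mult_distrib power_mult[symmetric] power_add[symmetric] algebra_simps flip: power_add)
  also have "thr l ^ 11 = tc ^ 11 * l ^ 66" by (simp add: thr power_mult_distrib power_mult[symmetric])
  finally have 2: "((2::nat) ^ (4 * bits (2 * D) + 8 * c + 42)) ^ 2 * (12 * D ^ 3) \<le>
      12 * 4 ^ 8 * (2 ^ (8 * c + 42)) ^ 2 * tc ^ 11 * l ^ 66" by (simp only: mult.assoc)
  have "1 \<le> l ^ 66" using l by simp
  then have "total_rounds c n \<Delta> \<le> 2 * l ^ 66 + 705 * tc * l ^ 66 + 12 * 4 ^ 8 * (2 ^ (8 * c + 42)) ^ 2 * tc ^ 11 * l ^ 66 + log_star n"
    unfolding total_rounds_def length_final_prog D_def[symmetric] using 1 2 by linarith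
  then show "total_rounds c n \<Delta> \<le> (2 + 705 * (24 * 10000 ^ 3) + 12 * 4 ^ 8 * (2 ^ (8 * c + 42)) ^ 2 * (24 * 10000 ^ 3) ^ 11) * depth \<Delta> ^ 66 + log_star n"
    unfolding tc_def[symmetric] l_def[symmetric] by (simp only: distrib_right)
qed

text \<open>The target has no constant in front of the power of the logarithm. For
  \<open>\<Delta> \<ge> 3\<close> the logarithm is at least 3 / 2, so a higher exponent swallows the
  constant; for \<open>\<Delta> \<le> 2\<close> it is charged to \<open>C * L\<close>.\<close>

lemma polylog_bound:
  fixes C0 e :: nat
  shows "\<exists>(k::nat) (C::real). 0 \<le> C \<and> (\<forall>\<Delta> L. 1 \<le> \<Delta> \<longrightarrow> 1 \<le> L \<longrightarrow>
    real (C0 * depth \<Delta> ^ e + L) \<le> log 2 (real \<Delta>) ^ k + C * real L)"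
proof -
  obtain m where m: "real C0 * 4 ^ e < (3 / 2) ^ m" using real_arch_pow[of "3 / 2"] by auto
  have "real (C0 * depth \<Delta> ^ e + L) \<le> log 2 (real \<Delta>) ^ (e + m) + (real C0 * 4 ^ e + 1) * real L"
    if \<Delta>: "1 \<le> \<Delta>" and L: "1 \<le> L" for \<Delta> L :: nat
  proof (cases "\<Delta> \<le> 2")
    case True
    have "2 ^ bits \<Delta> \<le> (2::nat) ^ 2" using bits_le[OF \<Delta>] True by simp
    then have "bits \<Delta> \<le> 2" by (rule power_le_imp_le_exp[rotated]) simp
    then have "real (depth \<Delta>) ^ e \<le> 4 ^ e" by (intro power_mono) (auto simp: depth_def)
    then have "real C0 * real (depth \<Delta>) ^ e \<le> real C0 * 4 ^ e" by (intro mult_left_mono) auto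
    also have "\<dots> \<le> real C0 * 4 ^ e * real L" using mult_left_mono[of 1 "real L" "real C0 * 4 ^ e"] L by simp
    finally have "real C0 * real (depth \<Delta>) ^ e + real L \<le> (real C0 * 4 ^ e + 1) * real L" by (simp add: algebra_simps)
    moreover have "0 \<le> log 2 (real \<Delta>) ^ (e + m)" using \<Delta> by simp
    ultimately show ?thesis by simp
  next
    case False
    define x where "x = log 2 (real \<Delta>)"
    \<comment> \<open>That is, \<open>2 ^ 3 \<le> 3 ^ 2\<close>.\<close>
    have "2 powr (3 / 2) \<le> (3::real)"
    proof -
      have "(2 powr (3 / 2)) ^ 2 = (2::real) powr (real 2 * (3 / 2))" by (rule powr_power[symmetric, THEN sym]) simp
      then have "(2 powr (3 / 2)) ^ 2 \<le> (3::real) ^ 2" by simp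
      then show ?thesis by (rule power2_le_imp_le) simp
    qed
    then have "3 / 2 \<le> log 2 3" by (subst le_log_iff) auto
    also have "\<dots> \<le> x" unfolding x_def using False by (subst log_le_cancel_iff) auto
    finally have x: "3 / 2 \<le> x" .
    have "real (depth \<Delta>) \<le> x + 3" using bits_le_log[OF \<Delta>] by (simp add: depth_def x_def)
    then have "real (depth \<Delta>) \<le> 4 * x" using x by linarith
    then have "real (depth \<Delta>) ^ e \<le> (4 * x) ^ e" by (intro power_mono) auto
    then have "real C0 * real (depth \<Delta>) ^ e \<le> real C0 * (4 * x) ^ e" by (intro mult_left_mono) auto
    also have "\<dots> = (real C0 * 4 ^ e) * x ^ e" by (simp add: power_mult_distrib)
    also have "\<dots> \<le> x ^ m * x ^ e"
    proof (rule mult_right_mono)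
      have "(3 / 2) ^ m \<le> x ^ m" using x by (intro power_mono) auto
      then show "real C0 * 4 ^ e \<le> x ^ m" using m by linarith
    qed (use x in simp)
    also have "\<dots> = x ^ (e + m)" by (simp add: power_add)
    finally have "real C0 * real (depth \<Delta>) ^ e \<le> x ^ (e + m)" .
    moreover have "real L \<le> (real C0 * 4 ^ e + 1) * real L"
      using mult_right_mono[of 1 "real C0 * 4 ^ e + 1" "real L"] by simp
    ultimately show ?thesis by (simp add: x_def)
  qed
  then show ?thesis by (intro exI[of _ "e + m"] exI[of _ "real C0 * 4 ^ e + 1"]) auto
qed

text \<open>For \<open>\<Delta> = 0\<close> the round bound can be 0, since
  \<open>log 2 0 = 0\<close> and \<open>log_star 1 = 0\<close>; hence the immediate output.
  Otherwise the knowledge is truncated to round \<open>T\<close>, at which the decoder is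
  specified.\<close>

definition edge_algorithm :: "(nat \<Rightarrow> nat \<Rightarrow> nat) \<Rightarrow> (knowledge \<Rightarrow> nat \<Rightarrow> message) \<Rightarrow> (knowledge \<Rightarrow> nat port_view) \<Rightarrow> nat list algorithm" where
  "edge_algorithm T s dec = \<lparr>send = s, out = \<lambda>K. if delta K = 0 then Some []
     else if T (size_n K) (delta K) \<le> length (received K)
     then Some (map snd (dec (K\<lparr>received := take (T (size_n K) (delta K)) (received K)\<rparr>))) else None\<rparr>"

lemma output_edge_algorithm:
  fixes T s dec N
  defines "T0 \<equiv> T (num_nodes N) (max_deg N)"
  assumes dec: "dec (knows s N T0 v) = view N \<chi> v" and "v \<in> nodes N" "valid_network p N"
  shows "output_after (edge_algorithm T s dec) N t v =
    (if max_deg N = 0 \<or> T0 \<le> t then Some (map (\<lambda>i. \<chi> {v, nbr N v i}) [0..<deg N v]) else None)"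
proof -
  interpret net p N by unfold_locales fact
  have "map snd (view N \<chi> v) = map (\<lambda>i. \<chi> {v, nbr N v i}) [0..<deg N v]" by (simp add: view_def link_def)
  moreover have "deg N v = 0" if "max_deg N = 0" using deg_le_max[of v] assms that by simp
  moreover have "(knows s N t v)\<lparr>received := take T0 (received (knows s N t v))\<rparr> = knows s N T0 v" if "T0 \<le> t"
    by (rule knows_truncate[OF that])
  moreover have "knowledge_after (edge_algorithm T s dec) N t v = knows s N t v"
    unfolding knows_eq by (simp add: edge_algorithm_def)
  ultimately show ?thesis
    unfolding output_after_def using dec by (simp add: edge_algorithm_def T0_def[symmetric])
qed

theorem theorem1p2:
  fixes \<epsilon> :: real and p :: "nat poly"
  assumes "\<epsilon> > 0"
  shows "\<exists>A :: nat list algorithm. congest_algorithm p A \<and>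
    (\<exists>(k::nat) (C::real). \<forall>N. valid_network p N \<longrightarrow>
       computes_edge_coloring A N (nat \<lfloor>(8 + \<epsilon>) * real (max_deg N)\<rfloor>) \<and>
       real (rounds A N) \<le> log 2 (real (max_deg N)) ^ k + C * real (log_star (num_nodes N)))"
proof -
  obtain c0 where c0: "\<And>n. 2 \<le> n \<Longrightarrow> poly p n \<le> n ^ c0" using poly_nat_bound by blast
  define c where "c = max 1 c0"
  have c: "poly p n \<le> n ^ c" if "2 \<le> n" for n
    by (rule order_trans[OF c0[OF that] power_increasing]) (use that in \<open>simp_all add: c_def\<close>)
  have c1: "1 \<le> c" by (simp add: c_def)
  obtain s dec C1 where s: "\<And>N v t i. valid_network p N \<Longrightarrow> v \<in> nodes N \<Longrightarrow> i < deg N v \<Longrightarrow>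
      real (length (s (knows s N t v) i)) \<le> C1 * log 2 (real (num_nodes N))"
    and dec: "\<And>N v. valid_network p N \<Longrightarrow> v \<in> nodes N \<Longrightarrow>
      dec (knows s N (total_rounds c (num_nodes N) (max_deg N)) v) = view N (colour c N) v"
    using computable_colour[of p c] unfolding computable_def total_rounds_def[symmetric] by metis
  define A where "A = edge_algorithm (total_rounds c) s dec"
  have out: "output_after A N t v = (if max_deg N = 0 \<or> total_rounds c (num_nodes N) (max_deg N) \<le> t
      then Some (map (\<lambda>i. colour c N {v, nbr N v i}) [0..<deg N v]) else None)"
    if "valid_network p N" "v \<in> nodes N" for N v t
    unfolding A_def using output_edge_algorithm[where T = "total_rounds c" and \<chi> = "colour c N"] dec[OF that] that
    by blast
  have "congest_algorithm p A"
    unfolding congest_algorithm_def knows_eq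
    by (rule exI[of _ C1]) (use s in \<open>simp add: A_def edge_algorithm_def\<close>)
  moreover obtain C0 where C0: "\<And>n \<Delta>. total_rounds c n \<Delta> \<le> C0 * depth \<Delta> ^ 66 + log_star n"
    using total_rounds_le by blast
  moreover obtain k C where C: "0 \<le> C" "\<And>\<Delta> L. 1 \<le> \<Delta> \<Longrightarrow> 1 \<le> L \<Longrightarrow>
      real (C0 * depth \<Delta> ^ 66 + L) \<le> log 2 (real \<Delta>) ^ k + C * real L"
    using polylog_bound[of C0 66] by blast
  moreover have "computes_edge_coloring A N (nat \<lfloor>(8 + \<epsilon>) * real (max_deg N)\<rfloor>) \<and>
       real (rounds A N) \<le> log 2 (real (max_deg N)) ^ k + C * real (log_star (num_nodes N))"
    if N: "valid_network p N" for N
  proof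
    interpret net p N by unfold_locales fact
    let ?T = "total_rounds c (num_nodes N) (max_deg N)" and ?K = "nat \<lfloor>(8 + \<epsilon>) * real (max_deg N)\<rfloor>"
    have "real (8 * max_deg N) \<le> (8 + \<epsilon>) * real (max_deg N)" using assms by (simp add: mult_right_mono)
    then have K: "8 * max_deg N \<le> ?K" by (metis floor_mono floor_of_nat nat_int nat_mono)
    have "is_edge_coloring N ?K (colour c N)"
      unfolding is_edge_coloring_def
    proof (intro conjI ballI impI)
      fix e assume "e \<in> edges N"
      then show "colour c N e \<in> {1..?K}" using colour_proper(1)[OF c c1] K by fastforce
    qed (use colour_proper(2)[OF c c1] in blast)
    moreover have "terminates A N"
      unfolding terminates_def using out[OF N] by (metis order_refl option.distinct(1))
    moreover have "node_output A N v = map (\<lambda>i. colour c N {v, nbr N v i}) [0..<deg N v]" if v: "v \<in> nodes N" for v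
    proof -
      have "output_after A N ?T v \<noteq> None" using out[OF N v] by simp
      then have "output_after A N (LEAST t. output_after A N t v \<noteq> None) v \<noteq> None" by (rule LeastI)
      then show ?thesis unfolding node_output_def using out[OF N v] by (auto split: if_splits)
    qed
    ultimately show "computes_edge_coloring A N ?K" unfolding computes_edge_coloring_def by blast
    show "real (rounds A N) \<le> log 2 (real (max_deg N)) ^ k + C * real (log_star (num_nodes N))"
    proof (cases "max_deg N = 0")
      case True
      then have "rounds A N \<le> 0" unfolding rounds_def using out[OF N] by (intro Least_le) auto
      moreover have "log 2 (real (max_deg N)) = 0" using True by (simp add: log_def)
      ultimately show ?thesis using C(1) by simp
    next
      case False
      have "rounds A N \<le> ?T" unfolding rounds_def using out[OF N] by (intro Least_le) auto
      also have "\<dots> \<le> C0 * depth (max_deg N) ^ 66 + log_star (num_nodes N)" by (rule C0)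
      finally have "real (rounds A N) \<le> real (C0 * depth (max_deg N) ^ 66 + log_star (num_nodes N))"
        by (simp only: of_nat_le_iff)
      also have "\<dots> \<le> log 2 (real (max_deg N)) ^ k + C * real (log_star (num_nodes N))"
      proof (rule C(2))
        show "1 \<le> max_deg N" using False by simp
        have "nodes N \<noteq> {}" using False by (auto simp: max_deg_def)
        then have "2 \<le> num_nodes N" using max_deg_less False by linarith
        then show "1 \<le> log_star (num_nodes N)" by (rule log_star_pos)
      qed
      finally show ?thesis .
    qed
  qed
  ultimately show ?thesis by blast
qed

end
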